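(* Let $s\in(0,1)$, $m>0$, $\alpha\in(0,3)$ and $p\in\left(1+\frac{\alpha}{3},\frac{3+\alpha}{3-2s}\right)$. Let $A:\mathbb{R}^3\to\mathbb{R}^3$ be a (continuous) vector field with locally bounded gradient, satisfying $$g(x-y)\cdot A\left(g\,\frac{x+y}{2}\right)=(x-y)\cdot A\left(\frac{x+y}{2}\right)\quad\text{for all }x,y\in\mathbb{R}^3,\ g\in O(3).$$ Then $$\tau_{A,\mathrm{rad}}:=\inf_{u\in H^s_{A,\mathrm{rad}}(\mathbb{R}^3,\mathbb{C})\setminus\{0\}}\frac{\|u\|_{A,s}^2}{\mathcal{D}(u)^{1/p}}$$ is achieved, i.e. there is $u\in H^s_{A,\mathrm{rad}}(\mathbb{R}^3,\mathbb{C})\setminus\{0\}$ with $\|u\|_{A,s}^2/\mathcal{D}(u)^{1/p}=\tau_{A,\mathrm{rad}}$.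
   Context: $C_s:=\dfrac{s\,2^{\frac{2s-1}{2}}}{\pi^{3/2}\,\Gamma(1-s)}$, where $\Gamma$ is the Gamma function. $\mathcal{K}_\nu$ is the modified Bessel function (also called MacDonald function) of order $\nu$: $\mathcal{K}_\nu(\zeta)=\frac12\left(\frac{\zeta}{2}\right)^\nu\int_0^{+\infty}e^{-\frac{\zeta^2}{4t}-t}t^{-1-\nu}\,dt$ for $\zeta>0$. For measurable $u,v:\mathbb{R}^3\to\mathbb{C}$ put $$\langle u,v\rangle_{A,s}:=\Re\int_{\mathbb{R}^3\times\mathbb{R}^3}\frac{\left(e^{-i(x-y)\cdot A\left(\frac{x+y}{2}\right)}u(x)-u(y)\right)\overline{\left(e^{-i(x-y)\cdot A\left(\frac{x+y}{2}\right)}v(x)-v(y)\right)}}{|x-y|^{\frac{3+2s}{2}}}\,\mathcal{K}_{\frac{3+2s}{2}}(m|x-y|)\,dx\,dy,$$ $(u,v)_{A,s}:=\frac{C_s}{2}m^{\frac{3+2s}{2}}\langle u,v\rangle_{A,s}+m^{2s}\Re\int_{\mathbb{R}^3}u\overline{v}\,dx$ and $\|u\|_{A,s}:=\sqrt{(u,u)_{A,s}}$. $H^s_A(\mathbb{R}^3,\mathbb{C})$ is the closure of $C^\infty_c(\mathbb{R}^3,\mathbb{C})$ in $\mathcal{H}:=\{u:\mathbb{R}^3\to\mathbb{C}: (u,u)_{A,s}<+\infty\}$ with respect to $\|\cdot\|_{A,s}$, and $H^s_{A,\mathrm{rad}}(\mathbb{R}^3,\mathbb{C}):=\{u\in H^s_A(\mathbb{R}^3,\mathbb{C}):u\text{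 radially symmetric}\}$. Moreover $\mathcal{D}(u):=\int_{\mathbb{R}^3}(I_\alpha*|u|^p)|u|^p\,dx$, where $I_\alpha(x)=\pi^{3/2}2^\alpha\frac{\Gamma(\alpha/2)}{\Gamma((3-\alpha)/2)}\frac{1}{|x|^{3-\alpha}}$ is the Riesz potential. "Locally bounded gradient" means that $\nabla A$ exists and is bounded on every compact set. *)

theory Defs
  imports "HOL-Analysis.Analysis"
begin

type_synonym R3 = "real ^ 3"

section \<open>Smooth functions with compact support\<close>

primrec Ck_fun :: "nat \<Rightarrow> (R3 \<Rightarrow> complex) \<Rightarrow> bool" where
  "Ck_fun 0 f \<longleftrightarrow> continuous_on UNIV f"
| "Ck_fun (Suc k) f \<longleftrightarrow>
     (\<forall>x. f differentiable (at x)) \<and> (\<forall>v. Ck_fun k (\<lambda>x. frechet_derivative f (at x) v))"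

definition smooth_compact_support :: "(R3 \<Rightarrow> complex) set" where
  "smooth_compact_support = {f. (\<forall>k. Ck_fun k f) \<and> compact (closure {x. f x \<noteq> 0})}"

section \<open>The magnetic form\<close>

definition C_const :: "real \<Rightarrow> real" where
  "C_const s = s * 2 powr ((2 * s - 1) / 2) / (pi powr (3 / 2) * Gamma (1 - s))"

definition besselK :: "real \<Rightarrow> real \<Rightarrow> real" where
  "besselK \<nu> \<zeta> = 1 / 2 * (\<zeta> / 2) powr \<nu> *
     (LBINT t:{0<..}. exp (- \<zeta>\<^sup>2 / (4 * t) - t) * t powr (- 1 - \<nu>))"

definition mag_diff :: "(R3 \<Rightarrow> R3) \<Rightarrow> (R3 \<Rightarrow> complex) \<Rightarrow> R3 \<Rightarrow> R3 \<Rightarrow> complex" where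
  "mag_diff A u x y =
     exp (- \<i> * complex_of_real ((x - y) \<bullet> A ((x + y) /\<^sub>R 2))) * u x - u y"

definition mag_integrand ::
    "real \<Rightarrow> real \<Rightarrow> (R3 \<Rightarrow> R3) \<Rightarrow> (R3 \<Rightarrow> complex) \<Rightarrow> (R3 \<Rightarrow> complex) \<Rightarrow> R3 \<times> R3 \<Rightarrow> complex" where
  "mag_integrand s m A u v = (\<lambda>(x, y).
     mag_diff A u x y * cnj (mag_diff A v x y) / complex_of_real (norm (x - y) powr ((3 + 2 * s) / 2))
     * complex_of_real (besselK ((3 + 2 * s) / 2) (m * norm (x - y))))"

definition mag_bracket ::
    "real \<Rightarrow> real \<Rightarrow> (R3 \<Rightarrow> R3) \<Rightarrow> (R3 \<Rightarrow> complex) \<Rightarrow> (R3 \<Rightarrow> complex) \<Rightarrow> real" where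
  "mag_bracket s m A u v = Re (LINT z|lebesgue. mag_integrand s m A u v z)"

definition mag_inner ::
    "real \<Rightarrow> real \<Rightarrow> (R3 \<Rightarrow> R3) \<Rightarrow> (R3 \<Rightarrow> complex) \<Rightarrow> (R3 \<Rightarrow> complex) \<Rightarrow> real" where
  "mag_inner s m A u v =
     C_const s / 2 * m powr ((3 + 2 * s) / 2) * mag_bracket s m A u v
     + m powr (2 * s) * Re (LINT x|lebesgue. u x * cnj (v x))"

definition mag_norm :: "real \<Rightarrow> real \<Rightarrow> (R3 \<Rightarrow> R3) \<Rightarrow> (R3 \<Rightarrow> complex) \<Rightarrow> real" where
  "mag_norm s m A u = sqrt (mag_inner s m A u u)"

section \<open>Function spaces\<close>

text \<open>Elements are measurable functions rather than equivalence classes; all properties below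
  are invariant under changes on null sets, and ``zero'' means zero almost everywhere.

  For \<open>v = u\<close> both integrands in \<open>mag_inner\<close> are nonnegative, so the form is finite at \<open>u\<close>
  iff both are integrable. This has to be said explicitly: the Bochner integral of a
  non-integrable function is \<open>0\<close>.\<close>

definition mag_space :: "real \<Rightarrow> real \<Rightarrow> (R3 \<Rightarrow> R3) \<Rightarrow> (R3 \<Rightarrow> complex) set" where
  "mag_space s m A = {u \<in> borel_measurable lebesgue.
     integrable lebesgue (mag_integrand s m A u u) \<and>
     integrable lebesgue (\<lambda>x. u x * cnj (u x))}"

text \<open>For a field with locally bounded gradient, test functions lie in \<open>mag_space\<close>, hence so does
  \<open>u - \<phi>\<close> below, and its norm is not affected by the convention for non-integrable functions.\<close>

definition HsA :: "real \<Rightarrow> real \<Rightarrow> (R3 \<Rightarrow> R3) \<Rightarrow> (R3 \<Rightarrow> complex) set" where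
  "HsA s m A = {u \<in> mag_space s m A.
     \<forall>\<epsilon>>0. \<exists>\<phi>\<in>smooth_compact_support. mag_norm s m A (\<lambda>x. u x - \<phi> x) < \<epsilon>}"

definition radially_symmetric :: "(R3 \<Rightarrow> complex) \<Rightarrow> bool" where
  "radially_symmetric u \<longleftrightarrow> (\<exists>f. AE x in lebesgue. u x = f (norm x))"

definition HsA_rad :: "real \<Rightarrow> real \<Rightarrow> (R3 \<Rightarrow> R3) \<Rightarrow> (R3 \<Rightarrow> complex) set" where
  "HsA_rad s m A = {u \<in> HsA s m A. radially_symmetric u}"

definition HsA_rad_nonzero :: "real \<Rightarrow> real \<Rightarrow> (R3 \<Rightarrow> R3) \<Rightarrow> (R3 \<Rightarrow> complex) set" where
  "HsA_rad_nonzero s m A = {u \<in> HsA_rad s m A. \<not> (AE x in lebesgue. u x = 0)}"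

section \<open>The Choquard energy and the minimization problem\<close>

definition riesz_potential :: "real \<Rightarrow> R3 \<Rightarrow> real" where
  "riesz_potential \<alpha> x =
     pi powr (3 / 2) * 2 powr \<alpha> * (Gamma (\<alpha> / 2) / Gamma ((3 - \<alpha>) / 2)) * (1 / norm x powr (3 - \<alpha>))"

definition choquard_energy :: "real \<Rightarrow> real \<Rightarrow> (R3 \<Rightarrow> complex) \<Rightarrow> ennreal" where
  "choquard_energy \<alpha> p u =
     (\<integral>\<^sup>+ x. (\<integral>\<^sup>+ y. ennreal (riesz_potential \<alpha> (x - y)) * ennreal (cmod (u y) powr p) \<partial>lebesgue)
       * ennreal (cmod (u x) powr p) \<partial>lebesgue)"

text \<open>For nonzero \<open>u\<close> in the magnetic space and the exponents considered, \<open>choquard_energy \<alpha> p u\<close>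
  is positive, and finite by the Hardy-Littlewood-Sobolev and Sobolev inequalities, so that the
  conversion to a real number is harmless.\<close>

definition choquard_quotient ::
    "real \<Rightarrow> real \<Rightarrow> real \<Rightarrow> real \<Rightarrow> (R3 \<Rightarrow> R3) \<Rightarrow> (R3 \<Rightarrow> complex) \<Rightarrow> real" where
  "choquard_quotient s m \<alpha> p A u =
     (mag_norm s m A u)\<^sup>2 / (enn2real (choquard_energy \<alpha> p u)) powr (1 / p)"

definition tau_rad :: "real \<Rightarrow> real \<Rightarrow> real \<Rightarrow> real \<Rightarrow> (R3 \<Rightarrow> R3) \<Rightarrow> real" where
  "tau_rad s m \<alpha> p A = (INF u\<in>HsA_rad_nonzero s m A. choquard_quotient s m \<alpha> p A u)"

section \<open>Assumptions on the vector field\<close>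

definition locally_bounded_gradient :: "(R3 \<Rightarrow> R3) \<Rightarrow> bool" where
  "locally_bounded_gradient A \<longleftrightarrow>
     (\<forall>x. A differentiable (at x)) \<and>
     (\<forall>K. compact K \<longrightarrow> (\<exists>B. \<forall>x\<in>K. onorm (frechet_derivative A (at x)) \<le> B))"

text \<open>\<open>O(3)\<close> is represented by the orthogonal linear maps.\<close>

definition O3_compatible :: "(R3 \<Rightarrow> R3) \<Rightarrow> bool" where
  "O3_compatible A \<longleftrightarrow>
     (\<forall>g x y. orthogonal_transformation g \<longrightarrow>
        g (x - y) \<bullet> A (g ((x + y) /\<^sub>R 2)) = (x - y) \<bullet> A ((x + y) /\<^sub>R 2))"

end

theory Submission
  imports Defs "HOL-Complex_Analysis.Great_Picard"
begin

text \<open>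
  Minimizing sequences, suitably scaled, have subsequences that converge in norm, and the reason is
  the parallelogram law.
  Let \<open>u n\<close> be a minimizing sequence, scaled to have Choquard energy \<open>1\<close>, so that the squared
  norms tend to the infimum \<open>\<tau>\<close>. Suppose that \<open>u n\<close> tends to \<open>w\<close> almost everywhere, with a common
  majorant \<open>h\<close> of finite Choquard energy. Then \<open>w\<close> has energy \<open>1\<close>, and so, in the limit, have the
  midpoints \<open>(u n + u k) / 2\<close>, by dominated convergence. By definition of \<open>\<tau>\<close> the squared norms of
  the midpoints are asymptotically at least \<open>\<tau>\<close>, and the parallelogram law leaves nothing for
  \<open>u n - u k\<close> (\<open>minimizing_sequence_Cauchy\<close>). Hence \<open>w\<close> belongs to the closed subspace, and Fatou's
  lemma bounds its squared norm by \<open>\<tau>\<close> (\<open>tau_rad_attained\<close>).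

  The almost everywhere limit and the majorant come from compactness in \<open>L\<^sup>q\<close> for
  \<open>2 < q < 6 / (3 - 2 s)\<close>, which rests on averages over dyadic cubes:

  \<^item> A function whose fractional energy is bounded, even if only pairs of points in a common unit cube
    are counted, is close in \<open>L\<^sup>q\<close> to its averages over cubes of side \<open>2\<^sup>-\<^sup>N\<close>, with an error that
    decays geometrically in \<open>N\<close> (\<open>avg_approximation\<close>).

  \<^item> Far from the origin the averages of a radial function are small: its mass near a point is repeated
    on many disjoint rotated balls (\<open>radial_ball_integral_decay\<close>). This is applied to \<open>\<bar>u\<bar>\<close>, whose energy
    is controlled by the magnetic one through the diamagnetic inequality (\<open>local_energy_modulus_le\<close>).

  \<^item> On a bounded set the phase factor differs from \<open>1\<close> by at most a multiple of \<open>\<bar>x - y\<bar>\<close>, so that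
    the energy of \<open>u\<close> itself is controlled (\<open>local_energy_box_le\<close>). There the averages at a given
    scale take finitely many values, and a diagonal subsequence makes all of them converge.

  Together this gives a subsequence that is Cauchy in every such \<open>L\<^sup>q\<close> (\<open>radial_compactness\<close>); passing to
  a rapidly convergent subsequence provides the limit and a majorant that lies in two spaces \<open>L\<^sup>q\<close>
  (\<open>dominated_subsequence\<close>). Two exponents are enough for a finite Choquard energy: the Riesz kernel is
  cut at radius \<open>1\<close>, and Young's inequality is applied to each part with an exponent slightly beside the
  critical one, for which the open range of \<open>p\<close> leaves room (\<open>choquard_energy_finite\<close>). The Bessel
  kernel enters only through its comparison with \<open>\<bar>x - y\<bar>\<close> to the power \<open>- (3 + 2 s)\<close>
  (\<open>kernel_bounds\<close>).
\<close>

section \<open>Dyadic cubes and averages\<close>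

abbreviation sq_integral :: "R3 set \<Rightarrow> (R3 \<Rightarrow> complex) \<Rightarrow> ennreal" where
  "sq_integral \<Omega> v \<equiv> (\<integral>\<^sup>+x\<in>\<Omega>. ennreal ((cmod (v x))\<^sup>2) \<partial>lborel)"

abbreviation mass :: "(R3 \<Rightarrow> complex) \<Rightarrow> ennreal" where
  "mass v \<equiv> (\<integral>\<^sup>+x. ennreal ((cmod (v x))\<^sup>2) \<partial>lborel)"

abbreviation powr_integral :: "real \<Rightarrow> R3 set \<Rightarrow> (R3 \<Rightarrow> complex) \<Rightarrow> ennreal" where
  "powr_integral q \<Omega> v \<equiv> (\<integral>\<^sup>+x\<in>\<Omega>. ennreal (cmod (v x) powr q) \<partial>lborel)"

abbreviation powr_mass :: "real \<Rightarrow> (R3 \<Rightarrow> complex) \<Rightarrow> ennreal" where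
  "powr_mass q v \<equiv> (\<integral>\<^sup>+x. ennreal (cmod (v x) powr q) \<partial>lborel)"

text \<open>The half-open dyadic cube of side \<open>2\<^sup>-\<^sup>k\<close> around a point. A cube is addressed by any of
  its points, so that averages over cubes become functions of the point.\<close>
definition cell :: "nat \<Rightarrow> R3 \<Rightarrow> R3 set" where
  "cell k x = {y. \<forall>i. \<lfloor>2 ^ k * y $ i\<rfloor> = \<lfloor>2 ^ k * x $ i\<rfloor>}"

lemma cell_refl [simp]: "x \<in> cell k x"
  by (simp add: cell_def)

lemma cell_sym: "y \<in> cell k x \<longleftrightarrow> x \<in> cell k y"
  by (auto simp: cell_def)

lemma cell_eqI: "y \<in> cell k x \<Longrightarrow> cell k y = cell k x"
  by (auto simp: cell_def)

lemma cell_Suc_subset: "cell (Suc k) x \<subseteq> cell k x"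
proof
  fix y assume y: "y \<in> cell (Suc k) x"
  have "\<lfloor>2 ^ k * y $ i\<rfloor> = \<lfloor>2 ^ k * x $ i\<rfloor>" for i
  proof -
    have *: "\<lfloor>z\<rfloor> = \<lfloor>2 * z\<rfloor> div 2" for z :: real
      by linarith
    have "\<lfloor>2 * (2 ^ k * y $ i)\<rfloor> = \<lfloor>2 * (2 ^ k * x $ i)\<rfloor>"
      using y by (simp add: cell_def mult.assoc)
    then show ?thesis using *[of "2 ^ k * y $ i"] *[of "2 ^ k * x $ i"] by simp
  qed
  then show "y \<in> cell k x" by (simp add: cell_def)
qed

lemma cell_mono: "j \<le> k \<Longrightarrow> cell k x \<subseteq> cell j x"
  by (induction k rule: dec_induct) (use cell_Suc_subset in blast)+

lemma norm_diff_cell_le: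
  assumes "y \<in> cell k x" shows "norm (x - y) \<le> 3 / 2 ^ k"
proof -
  have "\<bar>(x - y) $ i\<bar> \<le> 1 / 2 ^ k" for i
  proof -
    have "\<lfloor>2 ^ k * y $ i\<rfloor> = \<lfloor>2 ^ k * x $ i\<rfloor>" using assms by (simp add: cell_def)
    then have "\<bar>2 ^ k * x $ i - 2 ^ k * y $ i\<bar> \<le> 1" by linarith
    then have "2 ^ k * \<bar>x $ i - y $ i\<bar> \<le> 1"
      by (simp add: abs_mult flip: right_diff_distrib)
    then show ?thesis by (simp add: field_simps)
  qed
  then have "(\<Sum>i\<in>UNIV. \<bar>(x - y) $ i\<bar>) \<le> (\<Sum>i\<in>(UNIV::3 set). 1 / 2 ^ k)"
    by (intro sum_mono) auto
  then show ?thesis using norm_le_l1_cart[of "x - y"] by simp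
qed

lemma pred_cell [measurable]:
  assumes [measurable]: "f \<in> borel_measurable M" "g \<in> borel_measurable M"
  shows "Measurable.pred M (\<lambda>z. f z \<in> cell k (g z))"
  unfolding cell_def mem_Collect_eq cart_eq_inner_axis
  by (intro pred_intros_countable) measurable

lemma cell_borel [measurable]: "cell k x \<in> sets borel"
proof -
  have "Measurable.pred borel (\<lambda>y. y \<in> cell k x)" by measurable
  then show ?thesis by (simp add: pred_def)
qed

lemma emeasure_cell: "emeasure lborel (cell k x) = ennreal (1 / 8 ^ k)"
proof -
  \<comment> \<open>The half-open cube lies between an open and a closed box with the same corners.\<close>
  define l :: R3 where "l = (\<chi> i. of_int \<lfloor>2 ^ k * x $ i\<rfloor> / 2 ^ k)"
  define u :: R3 where "u = (\<chi> i. (of_int \<lfloor>2 ^ k * x $ i\<rfloor> + 1) / 2 ^ k)"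
  have d: "(u - l) \<bullet> b = 1 / 2 ^ k" if "b \<in> Basis" for b
    using that by (auto simp: Basis_vec_def inner_axis u_def l_def diff_divide_distrib[symmetric])
  have le: "l \<bullet> b \<le> u \<bullet> b" if "b \<in> Basis" for b
    using d[OF that] by (simp add: inner_diff_left) (smt (verit) divide_nonneg_nonneg zero_le_power)
  have p: "(\<Prod>b\<in>Basis. (u - l) \<bullet> b) = 1 / 8 ^ k"
  proof -
    have "(2 ^ k) ^ 3 = (8::real) ^ k"
    proof -
      have "(2 ^ k) ^ 3 = (2::real) ^ (k * 3)" by (simp only: power_mult)
      also have "\<dots> = (2 ^ 3) ^ k" by (simp only: power_mult mult.commute[of k 3])
      finally show ?thesis by simp
    qed
    then show ?thesis using d by (simp add: power_divide)
  qed
  have 1: "box l u \<subseteq> cell k x"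
    unfolding cell_def mem_box_cart l_def u_def
  proof (intro subsetI CollectI allI)
    fix y :: R3 and i assume "y \<in> box (\<chi> i. of_int \<lfloor>2 ^ k * x $ i\<rfloor> / 2 ^ k) (\<chi> i. (of_int \<lfloor>2 ^ k * x $ i\<rfloor> + 1) / 2 ^ k)"
    then have "of_int \<lfloor>2 ^ k * x $ i\<rfloor> / 2 ^ k < y $ i" "y $ i < (of_int \<lfloor>2 ^ k * x $ i\<rfloor> + 1) / 2 ^ k"
      by (auto simp: mem_box_cart)
    then show "\<lfloor>2 ^ k * y $ i\<rfloor> = \<lfloor>2 ^ k * x $ i\<rfloor>"
      by (simp add: field_simps floor_unique)
  qed
  have 2: "cell k x \<subseteq> cbox l u"
  proof
    fix y assume "y \<in> cell k x"
    then have y: "\<lfloor>2 ^ k * y $ i\<rfloor> = \<lfloor>2 ^ k * x $ i\<rfloor>" for i by (simp add: cell_def)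
    have "of_int \<lfloor>2 ^ k * x $ i\<rfloor> \<le> 2 ^ k * y $ i" "2 ^ k * y $ i \<le> of_int \<lfloor>2 ^ k * x $ i\<rfloor> + 1" for i
      unfolding y[symmetric] by linarith+
    then show "y \<in> cbox l u" by (simp add: mem_box_cart l_def u_def field_simps)
  qed
  have "emeasure lborel (box l u) \<le> emeasure lborel (cell k x)"
    by (intro emeasure_mono 1) simp
  moreover have "emeasure lborel (cell k x) \<le> emeasure lborel (cbox l u)"
    by (intro emeasure_mono 2) simp
  ultimately show ?thesis using p le by (simp add: emeasure_lborel_cbox_eq emeasure_lborel_box_eq)
qed

text \<open>Borel unions of unit cubes. Every dyadic cube of side at most \<open>1\<close> lies inside or outside
  such a set, so that averages taken inside never use values from outside.\<close>
definition saturated :: "R3 set \<Rightarrow> bool" where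
  "saturated \<Omega> \<longleftrightarrow> \<Omega> \<in> sets borel \<and> (\<forall>x\<in>\<Omega>. cell 0 x \<subseteq> \<Omega>)"

lemma saturated_borel [measurable_dest]: "saturated \<Omega> \<Longrightarrow> \<Omega> \<in> sets borel"
  by (simp add: saturated_def)

lemma saturated_iff: "saturated \<Omega> \<Longrightarrow> y \<in> cell k x \<Longrightarrow> y \<in> \<Omega> \<longleftrightarrow> x \<in> \<Omega>"
  using cell_mono[of 0 k] cell_sym[of y k x] unfolding saturated_def by blast

lemma saturated_UNIV [simp]: "saturated UNIV"
  by (simp add: saturated_def)

text \<open>Lying in a common cube is a symmetric relation. By Tonelli each \<open>y\<close> is therefore counted
  by the points \<open>x\<close> of its own cube, whose measure is \<open>8\<^sup>-\<^sup>k\<close>.\<close>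
lemma nn_integral_cell_swap:
  fixes f :: "R3 \<Rightarrow> ennreal"
  assumes [measurable]: "f \<in> borel_measurable borel" and \<Omega>: "saturated \<Omega>"
  shows "(\<integral>\<^sup>+x\<in>\<Omega>. (\<integral>\<^sup>+y\<in>cell k x. f y \<partial>lborel) \<partial>lborel) = ennreal (1 / 8 ^ k) * (\<integral>\<^sup>+x\<in>\<Omega>. f x \<partial>lborel)"
proof -
  note [measurable] = saturated_borel[OF \<Omega>]
  have "(\<integral>\<^sup>+x\<in>\<Omega>. (\<integral>\<^sup>+y\<in>cell k x. f y \<partial>lborel) \<partial>lborel)
      = (\<integral>\<^sup>+x. (\<integral>\<^sup>+y. f y * indicator (cell k x) y * indicator \<Omega> x \<partial>lborel) \<partial>lborel)"
    by (intro nn_integral_cong nn_integral_multc[symmetric]) measurable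
  also have "\<dots> = (\<integral>\<^sup>+y. (\<integral>\<^sup>+x. f y * indicator (cell k x) y * indicator \<Omega> x \<partial>lborel) \<partial>lborel)"
    by (rule lborel_pair.Fubini') measurable
  also have "\<dots> = (\<integral>\<^sup>+y. (\<integral>\<^sup>+x. (f y * indicator \<Omega> y) * indicator (cell k y) x \<partial>lborel) \<partial>lborel)"
    by (intro nn_integral_cong) (auto simp: indicator_def saturated_iff[OF \<Omega>] cell_sym)
  also have "\<dots> = (\<integral>\<^sup>+y. (f y * indicator \<Omega> y) * ennreal (1 / 8 ^ k) \<partial>lborel)"
    by (intro nn_integral_cong) (simp add: nn_integral_cmult_indicator emeasure_cell)
  also have "\<dots> = ennreal (1 / 8 ^ k) * (\<integral>\<^sup>+x\<in>\<Omega>. f x \<partial>lborel)"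
    by (subst nn_integral_multc) (auto simp: mult.commute)
  finally show ?thesis .
qed

definition L2 :: "(R3 \<Rightarrow> complex) \<Rightarrow> bool" where
  "L2 v \<longleftrightarrow> v \<in> borel_measurable borel \<and> mass v < \<infinity>"

lemma L2_borel [measurable_dest]: "L2 v \<Longrightarrow> v \<in> borel_measurable borel"
  by (simp add: L2_def)

lemma set_nn_integral_squared_le:
  assumes [measurable]: "f \<in> borel_measurable M" "S \<in> sets M"
  shows "(\<integral>\<^sup>+x\<in>S. f x \<partial>M)\<^sup>2 \<le> emeasure M S * (\<integral>\<^sup>+x\<in>S. (f x)\<^sup>2 \<partial>M)"
proof -
  have "(\<integral>\<^sup>+x\<in>S. f x \<partial>M)\<^sup>2 = (\<integral>\<^sup>+x. indicator S x * (f x * indicator S x) \<partial>M)\<^sup>2"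
    by (intro arg_cong[where f="\<lambda>t. t\<^sup>2"] nn_integral_cong) (auto simp: indicator_def)
  also have "\<dots> \<le> (\<integral>\<^sup>+x. (indicator S x)\<^sup>2 \<partial>M) * (\<integral>\<^sup>+x. (f x * indicator S x)\<^sup>2 \<partial>M)"
    by (rule Cauchy_Schwarz_nn_integral) measurable
  also have "(\<integral>\<^sup>+x. (indicator S x :: ennreal)\<^sup>2 \<partial>M) = (\<integral>\<^sup>+x. indicator S x \<partial>M)"
    by (intro nn_integral_cong) (auto simp: indicator_def)
  also have "(\<integral>\<^sup>+x. (f x * indicator S x)\<^sup>2 \<partial>M) = (\<integral>\<^sup>+x\<in>S. (f x)\<^sup>2 \<partial>M)"
    by (intro nn_integral_cong) (auto simp: indicator_def)
  finally show ?thesis by simp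
qed

definition avg :: "nat \<Rightarrow> (R3 \<Rightarrow> complex) \<Rightarrow> R3 \<Rightarrow> complex" where
  "avg k v x = 8 ^ k *\<^sub>R (LINT y|lborel. indicator (cell k x) y *\<^sub>R v y)"

lemma avg_borel [measurable]:
  assumes [measurable]: "v \<in> borel_measurable borel"
  shows "avg k v \<in> borel_measurable borel"
  unfolding avg_def[abs_def] by measurable

lemma avg_cong_cell: "y \<in> cell k x \<Longrightarrow> avg k v y = avg k v x"
  by (simp add: avg_def cell_eqI)

lemma integrable_cell:
  assumes "L2 v"
  shows "integrable lborel (\<lambda>y. indicator (cell k x) y *\<^sub>R v y)"
proof (rule integrableI_bounded)
  note [measurable] = L2_borel[OF assms]
  show "(\<lambda>y. indicator (cell k x) y *\<^sub>R v y) \<in> borel_measurable lborel" by measurable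
  have "(\<integral>\<^sup>+y. ennreal (norm (indicator (cell k x) y *\<^sub>R v y)) \<partial>lborel) = (\<integral>\<^sup>+y\<in>cell k x. ennreal (cmod (v y)) \<partial>lborel)"
    by (intro nn_integral_cong) (auto simp: indicator_def)
  also have "\<dots> < \<infinity>"
  proof (rule ccontr)
    assume "\<not> ?thesis"
    then have "(\<integral>\<^sup>+y\<in>cell k x. ennreal (cmod (v y)) \<partial>lborel)\<^sup>2 = \<infinity>" by (simp flip: less_top)
    moreover have "(\<integral>\<^sup>+y\<in>cell k x. ennreal (cmod (v y)) \<partial>lborel)\<^sup>2 \<le> emeasure lborel (cell k x) * (\<integral>\<^sup>+y\<in>cell k x. (ennreal (cmod (v y)))\<^sup>2 \<partial>lborel)"
      by (rule set_nn_integral_squared_le) auto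
    moreover have "(\<integral>\<^sup>+y\<in>cell k x. (ennreal (cmod (v y)))\<^sup>2 \<partial>lborel) \<le> mass v"
      by (intro nn_integral_mono) (auto simp: indicator_def ennreal_power)
    ultimately show False using assms
      by (simp add: emeasure_cell L2_def ennreal_mult_eq_top_iff top_unique less_top)
  qed
  finally show "(\<integral>\<^sup>+y. ennreal (norm (indicator (cell k x) y *\<^sub>R v y)) \<partial>lborel) < \<infinity>" .
qed

text \<open>Jensen's inequality on a cube. The constant \<open>c\<close> is free: \<open>c = 0\<close> bounds the size of an
  average, \<open>c = v x\<close> its distance to a value, and a coarser average the increment between two
  scales.\<close>
lemma avg_diff_squared_le:
  assumes "L2 v"
  shows "ennreal ((cmod (avg k v x - c))\<^sup>2) \<le> 8 ^ k * sq_integral (cell k x) (\<lambda>y. v y - c)"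
proof -
  note [measurable] = L2_borel[OF assms]
  have i1: "integrable lborel (\<lambda>y. indicator (cell k x) y *\<^sub>R c)"
    by (intro integrable_indicator) (auto simp: emeasure_cell)
  have meas: "(LINT y|lborel. indicator (cell k x) y *\<^sub>R c) = (1 / 8 ^ k) *\<^sub>R c"
    by (subst integral_scaleR_left) (auto simp: emeasure_cell measure_def intro: integrable_real_indicator)
  have i2: "integrable lborel (\<lambda>y. indicator (cell k x) y *\<^sub>R (v y - c))"
    unfolding scaleR_diff_right by (intro Bochner_Integration.integrable_diff integrable_cell assms i1)
  have "avg k v x - c = 8 ^ k *\<^sub>R (LINT y|lborel. indicator (cell k x) y *\<^sub>R (v y - c))"
    unfolding scaleR_diff_right avg_def
    by (subst Bochner_Integration.integral_diff[OF integrable_cell[OF assms] i1])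
      (simp add: scaleR_diff_right meas)
  then have "ennreal (cmod (avg k v x - c)) = 8 ^ k * ennreal (cmod (LINT y|lborel. indicator (cell k x) y *\<^sub>R (v y - c)))"
    by (simp add: ennreal_mult ennreal_power[symmetric])
  also have "\<dots> \<le> 8 ^ k * (\<integral>\<^sup>+y. ennreal (cmod (indicator (cell k x) y *\<^sub>R (v y - c))) \<partial>lborel)"
    by (intro mult_left_mono integral_norm_bound_ennreal i2) auto
  also have "(\<integral>\<^sup>+y. ennreal (cmod (indicator (cell k x) y *\<^sub>R (v y - c))) \<partial>lborel) = (\<integral>\<^sup>+y\<in>cell k x. ennreal (cmod (v y - c)) \<partial>lborel)"
    by (intro nn_integral_cong) (auto simp: indicator_def)
  finally have "(ennreal (cmod (avg k v x - c)))\<^sup>2 \<le> (8 ^ k * (\<integral>\<^sup>+y\<in>cell k x. ennreal (cmod (v y - c)) \<partial>lborel))\<^sup>2"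
    by (rule power_mono) auto
  also have "\<dots> = (8 ^ k)\<^sup>2 * (\<integral>\<^sup>+y\<in>cell k x. ennreal (cmod (v y - c)) \<partial>lborel)\<^sup>2"
    by (simp add: power_mult_distrib)
  also have "\<dots> \<le> (8 ^ k)\<^sup>2 * (emeasure lborel (cell k x) * (\<integral>\<^sup>+y\<in>cell k x. (ennreal (cmod (v y - c)))\<^sup>2 \<partial>lborel))"
    by (intro mult_left_mono set_nn_integral_squared_le) auto
  also have "\<dots> = ((8 ^ k)\<^sup>2 * ennreal (1 / 8 ^ k)) * (\<integral>\<^sup>+y\<in>cell k x. (ennreal (cmod (v y - c)))\<^sup>2 \<partial>lborel)"
    by (simp add: emeasure_cell mult.assoc)
  also have "(8 ^ k)\<^sup>2 * ennreal (1 / 8 ^ k) = 8 ^ k"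
  proof -
    have "(8 ^ k)\<^sup>2 * ennreal (1 / 8 ^ k) = ennreal ((8 ^ k)\<^sup>2 * (1 / 8 ^ k))"
      by (subst ennreal_mult) (auto simp: ennreal_power[symmetric])
    also have "\<dots> = ennreal (8 ^ k)" by (simp add: power2_eq_square)
    finally show ?thesis by (simp add: ennreal_power[symmetric])
  qed
  finally show ?thesis by (simp add: ennreal_power)
qed

definition osc :: "nat \<Rightarrow> (R3 \<Rightarrow> complex) \<Rightarrow> R3 \<Rightarrow> ennreal" where
  "osc k v x = sq_integral (cell k x) (\<lambda>y. v x - v y)"

text \<open>The Gagliardo energy of order \<open>s\<close>, counting only pairs of points in a common unit cube.
  The averages see no other pairs, and \<open>v\<close> need not be extended beyond \<open>\<Omega>\<close>.\<close>
definition local_energy :: "real \<Rightarrow> (R3 \<Rightarrow> complex) \<Rightarrow> R3 set \<Rightarrow> ennreal" where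
  "local_energy s v \<Omega> = (\<integral>\<^sup>+x\<in>\<Omega>. (\<integral>\<^sup>+y\<in>cell 0 x.
      ennreal ((cmod (v x - v y))\<^sup>2 * norm (x - y) powr - (3 + 2 * s)) \<partial>lborel) \<partial>lborel)"

lemma osc_borel [measurable]:
  assumes [measurable]: "v \<in> borel_measurable borel"
  shows "osc k v \<in> borel_measurable borel"
  unfolding osc_def[abs_def] by measurable

text \<open>Points of a common cube of side \<open>2\<^sup>-\<^sup>k\<close> have distance at most \<open>3 / 2\<^sup>k\<close>, so inserting the
  singular weight costs at most the factor on the right.\<close>
lemma osc_integral_le:
  assumes [measurable]: "v \<in> borel_measurable borel" and \<Omega>: "saturated \<Omega>" and "0 < s"
  shows "(\<integral>\<^sup>+x\<in>\<Omega>. osc k v x \<partial>lborel) \<le> ennreal ((3 / 2 ^ k) powr (3 + 2 * s)) * local_energy s v \<Omega>"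
proof -
  note [measurable] = saturated_borel[OF \<Omega>]
  let ?b = "(3 / 2 ^ k) powr (3 + 2 * s)"
  have pt: "(cmod (v x - v y))\<^sup>2 \<le> ?b * ((cmod (v x - v y))\<^sup>2 * norm (x - y) powr - (3 + 2 * s))"
    if "y \<in> cell k x" for x y
  proof (cases "x = y")
    case False
    then have "norm (x - y) powr (3 + 2 * s) \<le> ?b"
      using norm_diff_cell_le[OF that] assms by (intro powr_mono2) auto
    then have "norm (x - y) powr (3 + 2 * s) * norm (x - y) powr - (3 + 2 * s) \<le> ?b * norm (x - y) powr - (3 + 2 * s)"
      by (intro mult_right_mono) auto
    moreover have "norm (x - y) powr (3 + 2 * s) * norm (x - y) powr - (3 + 2 * s) = 1"
      using False by (simp flip: powr_add)
    ultimately have "(cmod (v x - v y))\<^sup>2 * 1 \<le> (cmod (v x - v y))\<^sup>2 * (?b * norm (x - y) powr - (3 + 2 * s))"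
      by (intro mult_left_mono) auto
    then show ?thesis by (simp add: mult_ac)
  qed auto
  have "(\<integral>\<^sup>+x\<in>\<Omega>. osc k v x \<partial>lborel) \<le> (\<integral>\<^sup>+x\<in>\<Omega>. (ennreal ?b * (\<integral>\<^sup>+y\<in>cell 0 x.
      ennreal ((cmod (v x - v y))\<^sup>2 * norm (x - y) powr - (3 + 2 * s)) \<partial>lborel)) \<partial>lborel)"
  proof (intro nn_integral_mono mult_right_mono)
    fix x
    have "osc k v x \<le> (\<integral>\<^sup>+y. ennreal ?b * (ennreal ((cmod (v x - v y))\<^sup>2 * norm (x - y) powr - (3 + 2 * s)) * indicator (cell 0 x) y) \<partial>lborel)"
      unfolding osc_def
    proof (intro nn_integral_mono)
      fix y
      show "ennreal ((cmod (v x - v y))\<^sup>2) * indicator (cell k x) y \<le> ennreal ?b * (ennreal ((cmod (v x - v y))\<^sup>2 * norm (x - y) powr - (3 + 2 * s)) * indicator (cell 0 x) y)"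
        using pt[of y x] cell_mono[of 0 k x]
        by (auto simp: indicator_def ennreal_mult[symmetric] intro!: ennreal_leI)
    qed
    also have "\<dots> = ennreal ?b * (\<integral>\<^sup>+y\<in>cell 0 x. ennreal ((cmod (v x - v y))\<^sup>2 * norm (x - y) powr - (3 + 2 * s)) \<partial>lborel)"
      by (rule nn_integral_cmult) measurable
    finally show "osc k v x \<le> \<dots>" .
  qed auto
  also have "\<dots> = ennreal ?b * local_energy s v \<Omega>"
    unfolding local_energy_def by (subst nn_integral_cmult[symmetric]) (auto simp: mult.assoc)
  finally show ?thesis .
qed

lemma diff_avg_squared_le_osc:
  assumes "L2 v"
  shows "ennreal ((cmod (v x - avg k v x))\<^sup>2) \<le> 8 ^ k * osc k v x"
  using avg_diff_squared_le[OF assms, of k x "v x"] by (simp add: osc_def norm_minus_commute)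

text \<open>Both averages are compared with \<open>v\<close> on the smaller cube, where the coarser average is a
  constant.\<close>
lemma avg_Suc_diff_squared_le:
  assumes "L2 v"
  shows "ennreal ((cmod (avg (Suc k) v x - avg k v x))\<^sup>2) \<le> 8 * 64 ^ k * (\<integral>\<^sup>+y\<in>cell (Suc k) x. osc k v y \<partial>lborel)"
proof -
  note [measurable] = L2_borel[OF assms]
  have "ennreal ((cmod (avg (Suc k) v x - avg k v x))\<^sup>2)
      \<le> 8 ^ Suc k * sq_integral (cell (Suc k) x) (\<lambda>y. v y - avg k v x)"
    by (rule avg_diff_squared_le[OF assms])
  also have "\<dots> \<le> 8 ^ Suc k * (\<integral>\<^sup>+y. 8 ^ k * (osc k v y * indicator (cell (Suc k) x) y) \<partial>lborel)"
  proof (intro mult_left_mono nn_integral_mono)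
    fix y
    show "ennreal ((cmod (v y - avg k v x))\<^sup>2) * indicator (cell (Suc k) x) y \<le> 8 ^ k * (osc k v y * indicator (cell (Suc k) x) y)"
      using diff_avg_squared_le_osc[OF assms, of y k] avg_cong_cell[of y k x v] cell_Suc_subset[of k x]
      by (auto simp: indicator_def)
  qed auto
  also have "\<dots> = 8 ^ Suc k * (8 ^ k * (\<integral>\<^sup>+y\<in>cell (Suc k) x. osc k v y \<partial>lborel))"
    by (subst nn_integral_cmult) auto
  also have "\<dots> = 8 * (8 ^ k * 8 ^ k) * (\<integral>\<^sup>+y\<in>cell (Suc k) x. osc k v y \<partial>lborel)"
    by (simp add: mult_ac)
  also have "(8 ^ k * 8 ^ k :: ennreal) = 64 ^ k" by (simp flip: power_mult_distrib)
  finally show ?thesis .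
qed

text \<open>The increment between two scales is bounded twice. Its supremum is dominated by the energy
  of a single cube, without regard to volume; in the square mean (\<open>avg_Suc_diff_integral_le\<close>),
  integration over \<open>x\<close> regains the volume of a cube. Interpolating the two gives the decay in
  \<open>L\<^sup>q\<close>.\<close>
lemma avg_Suc_diff_sup_le:
  assumes v: "L2 v" and \<Omega>: "saturated \<Omega>" and s: "0 < s" and x: "x \<in> \<Omega>"
  shows "ennreal ((cmod (avg (Suc k) v x - avg k v x))\<^sup>2)
     \<le> 8 * 64 ^ k * (ennreal ((3 / 2 ^ k) powr (3 + 2 * s)) * local_energy s v \<Omega>)"
proof -
  note [measurable] = L2_borel[OF v]
  have "(\<integral>\<^sup>+y\<in>cell (Suc k) x. osc k v y \<partial>lborel) \<le> (\<integral>\<^sup>+y\<in>\<Omega>. osc k v y \<partial>lborel)"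
    using saturated_iff[OF \<Omega>] x by (intro nn_integral_mono) (auto simp: indicator_def)
  also have "\<dots> \<le> ennreal ((3 / 2 ^ k) powr (3 + 2 * s)) * local_energy s v \<Omega>"
    by (intro osc_integral_le \<Omega> s) measurable
  finally show ?thesis
    using avg_Suc_diff_squared_le[OF v, of k x] by (meson mult_left_mono order_trans zero_le)
qed

lemma avg_Suc_diff_integral_le:
  assumes v: "L2 v" and \<Omega>: "saturated \<Omega>" and s: "0 < s"
  shows "sq_integral \<Omega> (\<lambda>x. avg (Suc k) v x - avg k v x)
     \<le> 8 ^ k * (ennreal ((3 / 2 ^ k) powr (3 + 2 * s)) * local_energy s v \<Omega>)"
proof -
  note [measurable] = L2_borel[OF v] saturated_borel[OF \<Omega>]
  have "sq_integral \<Omega> (\<lambda>x. avg (Suc k) v x - avg k v x)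
     \<le> (\<integral>\<^sup>+x. (8 * 64 ^ k) * ((\<integral>\<^sup>+y\<in>cell (Suc k) x. osc k v y \<partial>lborel) * indicator \<Omega> x) \<partial>lborel)"
    using avg_Suc_diff_squared_le[OF v, of k] by (intro nn_integral_mono) (auto simp: indicator_def)
  also have "\<dots> = (8 * 64 ^ k) * (ennreal (1 / 8 ^ Suc k) * (\<integral>\<^sup>+x\<in>\<Omega>. osc k v x \<partial>lborel))"
    by (subst nn_integral_cmult) (auto simp: nn_integral_cell_swap[OF _ \<Omega>])
  also have "\<dots> = ((8 * 64 ^ k) * ennreal (1 / 8 ^ Suc k)) * (\<integral>\<^sup>+x\<in>\<Omega>. osc k v x \<partial>lborel)"
    by (simp add: mult.assoc)
  also have "(8 * 64 ^ k) * ennreal (1 / 8 ^ Suc k) = 8 ^ k"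
  proof -
    have "(8 * 64 ^ k) * ennreal (1 / 8 ^ Suc k) = ennreal ((8 * 64 ^ k) * (1 / 8 ^ Suc k))"
      by (subst ennreal_mult) (auto simp: ennreal_power[symmetric] ennreal_mult)
    also have "(8 * 64 ^ k) * (1 / 8 ^ Suc k) = (8::real) ^ k"
      by (simp add: field_simps flip: power_mult_distrib)
    finally show ?thesis by (simp add: ennreal_power[symmetric])
  qed
  also have "8 ^ k * (\<integral>\<^sup>+x\<in>\<Omega>. osc k v x \<partial>lborel) \<le> 8 ^ k * (ennreal ((3 / 2 ^ k) powr (3 + 2 * s)) * local_energy s v \<Omega>)"
    by (intro mult_left_mono osc_integral_le \<Omega> s) measurable
  finally show ?thesis .
qed

lemma diff_avg_integral_le:
  assumes v: "L2 v" and \<Omega>: "saturated \<Omega>" and s: "0 < s"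
  shows "sq_integral \<Omega> (\<lambda>x. v x - avg k v x)
     \<le> 8 ^ k * (ennreal ((3 / 2 ^ k) powr (3 + 2 * s)) * local_energy s v \<Omega>)"
proof -
  note [measurable] = L2_borel[OF v] saturated_borel[OF \<Omega>]
  have "sq_integral \<Omega> (\<lambda>x. v x - avg k v x) \<le> (\<integral>\<^sup>+x. 8 ^ k * (osc k v x * indicator \<Omega> x) \<partial>lborel)"
    using diff_avg_squared_le_osc[OF v, of _ k] by (intro nn_integral_mono) (auto simp: indicator_def)
  also have "\<dots> = 8 ^ k * (\<integral>\<^sup>+x\<in>\<Omega>. osc k v x \<partial>lborel)"
    by (rule nn_integral_cmult) measurable
  also have "\<dots> \<le> 8 ^ k * (ennreal ((3 / 2 ^ k) powr (3 + 2 * s)) * local_energy s v \<Omega>)"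
    by (intro mult_left_mono osc_integral_le \<Omega> s) measurable
  finally show ?thesis .
qed

lemma nn_integral_powr_interpolation:
  assumes [measurable]: "f \<in> borel_measurable M" "\<Omega> \<in> sets M" and q: "2 \<le> q"
    and f: "\<And>x. 0 \<le> f x" and B: "\<And>x. x \<in> \<Omega> \<Longrightarrow> (f x)\<^sup>2 \<le> B"
  shows "(\<integral>\<^sup>+x\<in>\<Omega>. ennreal (f x powr q) \<partial>M) \<le> ennreal (B powr ((q - 2) / 2)) * (\<integral>\<^sup>+x\<in>\<Omega>. ennreal ((f x)\<^sup>2) \<partial>M)"
proof -
  have "f x powr q \<le> B powr ((q - 2) / 2) * (f x)\<^sup>2" if "x \<in> \<Omega>" for x
  proof (cases "f x = 0")
    case False
    then have pos: "f x > 0" using f[of x] by simp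
    then have "f x powr q = f x powr (q - 2) * f x powr 2"
      unfolding powr_add[symmetric] by simp
    also have "f x powr (q - 2) = ((f x)\<^sup>2) powr ((q - 2) / 2)"
    proof -
      have "((f x)\<^sup>2) powr ((q - 2) / 2) = (f x powr 2) powr ((q - 2) / 2)" using pos by simp
      also have "\<dots> = f x powr (2 * ((q - 2) / 2))" by (simp only: powr_powr)
      also have "2 * ((q - 2) / 2) = q - 2" by (simp add: field_simps)
      finally show ?thesis by simp
    qed
    also have "((f x)\<^sup>2) powr ((q - 2) / 2) * f x powr 2 = ((f x)\<^sup>2) powr ((q - 2) / 2) * (f x)\<^sup>2"
      using pos by simp
    also have "\<dots> \<le> B powr ((q - 2) / 2) * (f x)\<^sup>2"
      using B[OF that] q by (intro mult_right_mono powr_mono2) auto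
    finally show ?thesis .
  qed simp
  then have "(\<integral>\<^sup>+x\<in>\<Omega>. ennreal (f x powr q) \<partial>M) \<le> (\<integral>\<^sup>+x. ennreal (B powr ((q - 2) / 2)) * (ennreal ((f x)\<^sup>2) * indicator \<Omega> x) \<partial>M)"
    by (intro nn_integral_mono) (auto simp: indicator_def ennreal_mult[symmetric] intro!: ennreal_leI)
  also have "\<dots> = ennreal (B powr ((q - 2) / 2)) * (\<integral>\<^sup>+x\<in>\<Omega>. ennreal ((f x)\<^sup>2) \<partial>M)"
    by (rule nn_integral_cmult) measurable
  finally show ?thesis .
qed

section \<open>Approximation by dyadic averages in \<open>L\<^sup>q\<close>\<close>

lemma term_le_suminf_ennreal: "f k \<le> (\<Sum>k. f k :: ennreal)" for f :: "nat \<Rightarrow> ennreal"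
  using sum_le_suminf[of f "{k}"] by auto

text \<open>This replaces Minkowski's inequality for infinite sums. If every \<open>a k\<close> were below
  \<open>lam k * S\<close>, their sum would be at most \<open>S / 2\<close>; so one of the scaled terms alone reaches \<open>S\<close>.
  After integration, \<open>q\<close>-th powers of sums are controlled by weighted sums of \<open>q\<close>-th powers, and
  slowly decaying weights cost little against geometric decay.\<close>
lemma powr_le_suminf_scaled:
  fixes a lam :: "nat \<Rightarrow> real"
  assumes pos: "\<And>k. 0 < lam k" and sm: "summable lam" and half: "suminf lam \<le> 1 / 2"
    and a: "\<And>k. 0 \<le> a k" and q: "0 < q" and S: "0 \<le> S" and le: "ennreal S \<le> (\<Sum>k. ennreal (a k))"
  shows "ennreal (S powr q) \<le> (\<Sum>k. ennreal ((a k / lam k) powr q))"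
proof (cases "S = 0")
  case False
  have "\<exists>k. lam k * S \<le> a k"
  proof (rule ccontr)
    assume "\<not> ?thesis"
    then have *: "a k \<le> lam k * S" for k using less_imp_le not_le by blast
    have "ennreal S \<le> (\<Sum>k. ennreal (lam k * S))"
      using le by (rule order_trans) (intro suminf_le ennreal_leI * summableI)
    also have "\<dots> = ennreal (\<Sum>k. lam k * S)"
      using pos S sm by (intro suminf_ennreal2 summable_mult2) (auto simp: less_imp_le)
    also have "\<dots> = ennreal (suminf lam * S)" by (simp add: suminf_mult2[OF sm])
    finally have "S \<le> suminf lam * S"
      using S suminf_nonneg[OF sm] pos by (simp add: less_imp_le)
    also have "\<dots> \<le> 1 / 2 * S" using half S by (intro mult_right_mono) auto
    finally show False using S False by simp
  qed
  then obtain k where "lam k * S \<le> a k" by blast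
  then have "S \<le> a k / lam k" using pos[of k] by (simp add: field_simps)
  then have "S powr q \<le> (a k / lam k) powr q" using S q by (intro powr_mono2) auto
  then have "ennreal (S powr q) \<le> ennreal ((a k / lam k) powr q)" by (rule ennreal_leI)
  also have "\<dots> \<le> (\<Sum>k. ennreal ((a k / lam k) powr q))"
    by (rule term_le_suminf_ennreal)
  finally show ?thesis .
qed simp

lemma suminf_ennreal_le_geometric:
  fixes f :: "nat \<Rightarrow> ennreal"
  assumes "\<And>k. f k \<le> ennreal (K * r ^ k)" "0 \<le> K" "0 \<le> r" "r < 1"
  shows "(\<Sum>k. f k) \<le> ennreal (K / (1 - r))"
proof -
  have "(\<Sum>k. f k) \<le> (\<Sum>k. ennreal (K * r ^ k))"
    by (intro suminf_le assms summableI)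
  also have "\<dots> = ennreal (\<Sum>k. K * r ^ k)"
    using assms by (intro suminf_ennreal2 summable_mult summable_geometric) auto
  also have "(\<Sum>k. K * r ^ k) = K / (1 - r)"
    using assms by (subst suminf_mult) (auto simp: suminf_geometric summable_geometric)
  finally show ?thesis .
qed

lemma two_powr_neg_less_1: "0 < t \<Longrightarrow> 2 powr (- t) < (1::real)"
  by (simp add: powr_less_one)

lemma two_powr_mult_nat: "2 powr (t * real k) = (2 powr t) ^ k"
  by (simp add: powr_powr[symmetric] powr_realpow)

lemma cell_scale_powr:
  "(3 / 2 ^ k) powr (3 + 2 * s) = 3 powr (3 + 2 * s) * 2 powr (- (3 + 2 * s) * real k)"
proof -
  have "(2 ^ k) powr (3 + 2 * s) = (2 powr real k) powr (3 + 2 * s)" by (simp add: powr_realpow)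
  also have "\<dots> = 2 powr ((3 + 2 * s) * real k)" by (simp only: powr_powr mult.commute)
  finally have "(2 ^ k) powr (3 + 2 * s) = 2 powr ((3 + 2 * s) * real k)" .
  moreover have "(3 / 2 ^ k) powr (3 + 2 * s) = 3 powr (3 + 2 * s) / (2 ^ k) powr (3 + 2 * s)"
    by (simp add: powr_divide)
  moreover have "2 powr (- (3 + 2 * s) * real k) = 1 / 2 powr ((3 + 2 * s) * real k)"
    by (simp only: mult_minus_left powr_minus_divide)
  ultimately show ?thesis by simp
qed

text \<open>The mean square errors of the averages decay geometrically. Their sum is finite, hence
  almost every sequence of errors is summable.\<close>
lemma AE_avg_tendsto:
  assumes v: "L2 v" and \<Omega>: "saturated \<Omega>" and s: "0 < s" and fin: "local_energy s v \<Omega> < \<infinity>"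
  shows "AE x in lborel. x \<in> \<Omega> \<longrightarrow> (\<lambda>k. avg k v x) \<longlonglongrightarrow> v x"
proof -
  note [measurable] = L2_borel[OF v] saturated_borel[OF \<Omega>]
  obtain M where M: "0 \<le> M" "local_energy s v \<Omega> = ennreal M"
    using fin by (cases "local_energy s v \<Omega>") auto
  let ?f = "\<lambda>k x. ennreal ((cmod (v x - avg k v x))\<^sup>2) * indicator \<Omega> x"
  have "(\<integral>\<^sup>+x. (\<Sum>k. ?f k x) \<partial>lborel) = (\<Sum>k. \<integral>\<^sup>+x. ?f k x \<partial>lborel)"
    by (rule nn_integral_suminf) measurable
  also have "\<dots> \<le> ennreal (3 powr (3 + 2 * s) * M / (1 - 2 powr (- (2 * s))))"
  proof (rule suminf_ennreal_le_geometric)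
    fix k
    have "8 ^ k * (ennreal ((3 / 2 ^ k) powr (3 + 2 * s)) * ennreal M) = ennreal (8 ^ k * ((3 / 2 ^ k) powr (3 + 2 * s) * M))"
      using M by (simp add: ennreal_mult ennreal_power[symmetric])
    also have "8 ^ k * ((3 / 2 ^ k) powr (3 + 2 * s) * M) = 3 powr (3 + 2 * s) * M * (2 powr (- (2 * s))) ^ k"
    proof -
      have "(8::real) ^ k = 2 powr (3 * real k)" by (simp add: two_powr_mult_nat)
      then have A: "8 ^ k * 2 powr (- (3 + 2 * s) * real k) = 2 powr (- (2 * s) * real k)"
        by (simp add: algebra_simps flip: powr_add)
      have "8 ^ k * ((3 / 2 ^ k) powr (3 + 2 * s) * M) = 8 ^ k * (3 powr (3 + 2 * s) * 2 powr (- (3 + 2 * s) * real k) * M)"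
        by (simp only: cell_scale_powr)
      also have "\<dots> = 3 powr (3 + 2 * s) * M * (8 ^ k * 2 powr (- (3 + 2 * s) * real k))"
        by simp
      also have "\<dots> = 3 powr (3 + 2 * s) * M * (2 powr (- (2 * s))) ^ k"
        unfolding A by (simp only: two_powr_mult_nat)
      finally show ?thesis .
    qed
    finally show "(\<integral>\<^sup>+x. ?f k x \<partial>lborel) \<le> ennreal (3 powr (3 + 2 * s) * M * (2 powr (- (2 * s))) ^ k)"
      using diff_avg_integral_le[OF v \<Omega> s, of k] M by simp
  qed (use M s in \<open>auto simp: powr_less_one\<close>)
  also have "\<dots> < \<infinity>" by simp
  finally have "AE x in lborel. (\<Sum>k. ?f k x) \<noteq> \<infinity>"
    by (intro nn_integral_PInf_AE) auto
  then show ?thesis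
  proof eventually_elim
    fix x assume fin: "(\<Sum>k. ?f k x) \<noteq> \<infinity>"
    show "x \<in> \<Omega> \<longrightarrow> (\<lambda>k. avg k v x) \<longlonglongrightarrow> v x"
    proof
      assume "x \<in> \<Omega>"
      then have "(\<Sum>k. ennreal ((cmod (v x - avg k v x))\<^sup>2)) \<noteq> \<infinity>" using fin by simp
      then have "summable (\<lambda>k. (cmod (v x - avg k v x))\<^sup>2)"
        by (intro summable_suminf_not_top) auto
      then have "(\<lambda>k. (cmod (v x - avg k v x))\<^sup>2) \<longlonglongrightarrow> 0" by (rule summable_LIMSEQ_zero)
      then have "(\<lambda>k. sqrt ((cmod (v x - avg k v x))\<^sup>2)) \<longlonglongrightarrow> sqrt 0" by (intro tendsto_intros)
      then have "(\<lambda>k. cmod (v x - avg k v x)) \<longlonglongrightarrow> 0" by simp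
      then have "(\<lambda>k. v x - avg k v x) \<longlonglongrightarrow> 0" by (rule tendsto_norm_zero_cancel)
      then have "(\<lambda>k. v x - (v x - avg k v x)) \<longlonglongrightarrow> v x - 0" by (intro tendsto_intros)
      then show "(\<lambda>k. avg k v x) \<longlonglongrightarrow> v x" by simp
    qed
  qed
qed

lemma dist_le_suminf_increments:
  fixes e :: "nat \<Rightarrow> complex"
  assumes "e \<longlonglongrightarrow> z"
  shows "ennreal (cmod (z - e N)) \<le> (\<Sum>k. ennreal (cmod (e (Suc (N + k)) - e (N + k))))"
proof -
  have *: "ennreal (cmod (e (N + n) - e N)) \<le> (\<Sum>k. ennreal (cmod (e (Suc (N + k)) - e (N + k))))" for n
  proof -
    have "e (N + n) - e N = (\<Sum>k<n. e (Suc (N + k)) - e (N + k))"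
      by (induction n) (auto simp: algebra_simps)
    then have "cmod (e (N + n) - e N) \<le> (\<Sum>k<n. cmod (e (Suc (N + k)) - e (N + k)))"
      by (simp add: norm_sum)
    then have "ennreal (cmod (e (N + n) - e N)) \<le> (\<Sum>k<n. ennreal (cmod (e (Suc (N + k)) - e (N + k))))"
      by (simp add: sum_ennreal ennreal_leI)
    also have "\<dots> \<le> (\<Sum>k. ennreal (cmod (e (Suc (N + k)) - e (N + k))))"
      by (rule sum_le_suminf) auto
    finally show ?thesis .
  qed
  have "(\<lambda>n. ennreal (cmod (e (n + N) - e N))) \<longlonglongrightarrow> ennreal (cmod (z - e N))"
    by (intro tendsto_intros tendsto_ennrealI LIMSEQ_ignore_initial_segment assms)
  then show ?thesis by (rule LIMSEQ_le_const2) (use * in \<open>auto simp: add.commute\<close>)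
qed

text \<open>Interpolation between the two bounds on increments. The powers of \<open>2\<^sup>k\<close> combine to \<open>2\<close> to
  the power \<open>- \<sigma> k\<close>, and \<open>\<sigma>\<close> is positive precisely when \<open>q < 6 / (3 - 2 s)\<close>.\<close>
lemma avg_increment_powr_integral_le:
  assumes v: "L2 v" and \<Omega>: "saturated \<Omega>" and s: "0 < s" and q: "2 < q"
    and M: "0 \<le> M" "local_energy s v \<Omega> \<le> ennreal M"
  defines "\<sigma> \<equiv> 2 * s - (3 - 2 * s) * (q - 2) / 2"
  defines "b \<equiv> 3 powr (3 + 2 * s)"
  shows "powr_integral q \<Omega> (\<lambda>x. avg (Suc k) v x - avg k v x)
    \<le> ennreal ((8 * b) powr ((q - 2) / 2) * b * M powr (q / 2) * 2 powr (- \<sigma> * real k))"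
proof -
  note [measurable] = L2_borel[OF v] saturated_borel[OF \<Omega>]
  have b: "0 < b" by (simp add: b_def)
  have c: "(3 / 2 ^ k) powr (3 + 2 * s) = b * 2 powr (- (3 + 2 * s) * real k)"
    unfolding b_def by (rule cell_scale_powr)
  have e8: "(8::real) ^ k = 2 powr (3 * real k)" and e64: "(64::real) ^ k = 2 powr (6 * real k)"
    by (simp_all add: two_powr_mult_nat)
  define B where "B = 8 * b * M * 2 powr ((3 - 2 * s) * real k)"
  have sup: "(cmod (avg (Suc k) v x - avg k v x))\<^sup>2 \<le> B" if "x \<in> \<Omega>" for x
  proof -
    have "ennreal ((cmod (avg (Suc k) v x - avg k v x))\<^sup>2)
       \<le> 8 * 64 ^ k * (ennreal ((3 / 2 ^ k) powr (3 + 2 * s)) * ennreal M)"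
      using avg_Suc_diff_sup_le[OF v \<Omega> s that, of k] M(2) by (meson mult_left_mono order_trans zero_le)
    also have "\<dots> = ennreal (8 * 64 ^ k * ((3 / 2 ^ k) powr (3 + 2 * s) * M))"
      using M by (simp add: ennreal_mult ennreal_power[symmetric])
    also have "8 * 64 ^ k * ((3 / 2 ^ k) powr (3 + 2 * s) * M) = B"
    proof -
      have "64 ^ k * 2 powr (- (3 + 2 * s) * real k) = 2 powr ((3 - 2 * s) * real k)"
        unfolding e64 powr_add[symmetric] by (simp add: algebra_simps)
      then show ?thesis unfolding c B_def by (simp add: mult_ac)
    qed
    finally show ?thesis using M b by (simp add: B_def)
  qed
  have int: "sq_integral \<Omega> (\<lambda>x. avg (Suc k) v x - avg k v x) \<le> ennreal (b * M * 2 powr (- (2 * s) * real k))"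
  proof -
    have "sq_integral \<Omega> (\<lambda>x. avg (Suc k) v x - avg k v x)
      \<le> 8 ^ k * (ennreal ((3 / 2 ^ k) powr (3 + 2 * s)) * ennreal M)"
      using avg_Suc_diff_integral_le[OF v \<Omega> s, of k] M(2) by (meson mult_left_mono order_trans zero_le)
    also have "\<dots> = ennreal (8 ^ k * ((3 / 2 ^ k) powr (3 + 2 * s) * M))"
      using M by (simp add: ennreal_mult ennreal_power[symmetric])
    also have "8 ^ k * ((3 / 2 ^ k) powr (3 + 2 * s) * M) = b * M * 2 powr (- (2 * s) * real k)"
    proof -
      have "8 ^ k * 2 powr (- (3 + 2 * s) * real k) = 2 powr (- (2 * s) * real k)"
        unfolding e8 powr_add[symmetric] by (simp add: algebra_simps)
      then show ?thesis unfolding c by (simp add: mult_ac)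
    qed
    finally show ?thesis .
  qed
  have "powr_integral q \<Omega> (\<lambda>x. avg (Suc k) v x - avg k v x)
      \<le> ennreal (B powr ((q - 2) / 2)) * sq_integral \<Omega> (\<lambda>x. avg (Suc k) v x - avg k v x)"
    using q by (intro nn_integral_powr_interpolation sup) auto
  also have "\<dots> \<le> ennreal (B powr ((q - 2) / 2)) * ennreal (b * M * 2 powr (- (2 * s) * real k))"
    by (intro mult_left_mono int) auto
  also have "\<dots> = ennreal (B powr ((q - 2) / 2) * (b * M * 2 powr (- (2 * s) * real k)))"
    using b M by (simp add: ennreal_mult)
  also have "B powr ((q - 2) / 2) * (b * M * 2 powr (- (2 * s) * real k))
      = (8 * b) powr ((q - 2) / 2) * b * M powr (q / 2) * 2 powr (- \<sigma> * real k)"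
  proof -
    have 1: "B powr ((q - 2) / 2) = (8 * b) powr ((q - 2) / 2) * M powr ((q - 2) / 2) * 2 powr ((3 - 2 * s) * real k * ((q - 2) / 2))"
      unfolding B_def using b M by (simp add: powr_mult powr_powr)
    have 2: "M powr ((q - 2) / 2) * M = M powr (q / 2)"
    proof (cases "M = 0")
      case False
      then have "M powr ((q - 2) / 2) * M = M powr ((q - 2) / 2) * M powr 1" using M by simp
      also have "\<dots> = M powr (q / 2)" unfolding powr_add[symmetric] by (simp add: field_simps)
      finally show ?thesis .
    qed (use q in simp)
    have 3: "2 powr ((3 - 2 * s) * real k * ((q - 2) / 2)) * 2 powr (- (2 * s) * real k) = 2 powr (- \<sigma> * real k)"
      unfolding powr_add[symmetric] \<sigma>_def
      by (rule arg_cong[where f="\<lambda>t. 2 powr t"]) (simp add: field_simps)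
    show ?thesis unfolding 1 2[symmetric] 3[symmetric] by (simp only: mult_ac)
  qed
  finally show ?thesis .
qed

text \<open>The quantitative form of the compact Sobolev embedding: the distance of \<open>v\<close> to its
  averages is the sum of all finer increments, each of which is geometrically small in \<open>L\<^sup>q\<close>.
  The constants depend only on \<open>s\<close> and \<open>q\<close>.\<close>
theorem avg_approximation:
  fixes s q :: real
  assumes s: "0 < s" "s < 1" and q: "2 < q" "q < 6 / (3 - 2 * s)"
  obtains C \<delta> where "0 \<le> C" "0 < \<delta>"
    "\<And>N v \<Omega> M. L2 v \<Longrightarrow> saturated \<Omega> \<Longrightarrow> 0 \<le> M \<Longrightarrow> local_energy s v \<Omega> \<le> ennreal M \<Longrightarrow>
      powr_integral q \<Omega> (\<lambda>x. v x - avg N v x) \<le> ennreal (C * M powr (q / 2) * 2 powr (- \<delta> * real N))"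
proof -
  define \<sigma> where "\<sigma> = 2 * s - (3 - 2 * s) * (q - 2) / 2"
  have \<sigma>: "0 < \<sigma>"
  proof -
    have "q * (3 - 2 * s) < 6" using s q by (simp add: field_simps)
    then show ?thesis unfolding \<sigma>_def by (simp add: algebra_simps)
  qed
  define b where "b = 3 powr (3 + 2 * s)"
  define C1 where "C1 = (8 * b) powr ((q - 2) / 2) * b"
  have C1: "0 \<le> C1" by (simp add: C1_def b_def)
  \<comment> \<open>The weights decay so slowly that their \<open>- q\<close>-th powers use up only half of the decay \<open>\<sigma>\<close>.\<close>
  define \<eta> where "\<eta> = \<sigma> / (2 * q)"
  have \<eta>: "0 < \<eta>" using \<sigma> q by (simp add: \<eta>_def)
  \<comment> \<open>The factor \<open>c\<close> makes the weights sum to \<open>1 / 2\<close>.\<close>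
  define c where "c = (1 - 2 powr (- \<eta>)) / 2"
  have c: "0 < c" using two_powr_neg_less_1[OF \<eta>] by (simp add: c_def)
  define lam where "lam k = c * (2 powr (- \<eta>)) ^ k" for k :: nat
  have lam: "0 < lam k" for k using c by (simp add: lam_def)
  have r1: "norm (2 powr (- \<eta>)) < 1" using two_powr_neg_less_1[OF \<eta>] by simp
  have lam_sum: "summable lam" "suminf lam \<le> 1 / 2"
  proof -
    show "summable lam" unfolding lam_def by (intro summable_mult summable_geometric r1)
    have "suminf lam = c * (1 / (1 - 2 powr (- \<eta>)))"
      unfolding lam_def by (subst suminf_mult[OF summable_geometric[OF r1]]) (simp add: suminf_geometric[OF r1])
    then show "suminf lam \<le> 1 / 2" using two_powr_neg_less_1[OF \<eta>] by (simp add: c_def)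
  qed
  define r where "r = 2 powr (- (\<sigma> / 2))"
  have r: "0 \<le> r" "r < 1" using two_powr_neg_less_1[of "\<sigma> / 2"] \<sigma> by (auto simp: r_def)
  define C where "C = c powr (- q) * C1 / (1 - r)"
  have "0 \<le> C" using C1 r by (simp add: C_def)
  moreover note \<sigma>
  moreover have "powr_integral q \<Omega> (\<lambda>x. v x - avg N v x) \<le> ennreal (C * M powr (q / 2) * 2 powr (- \<sigma> * real N))"
    if v: "L2 v" and \<Omega>: "saturated \<Omega>" and M: "0 \<le> M" "local_energy s v \<Omega> \<le> ennreal M" for N v \<Omega> M
  proof -
    note [measurable] = L2_borel[OF v] saturated_borel[OF \<Omega>]
    let ?w = "\<lambda>k x. cmod (avg (Suc (N + k)) v x - avg (N + k) v x)"
    have fin: "local_energy s v \<Omega> < \<infinity>"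
      using M(2) by (rule order_le_less_trans) simp
    have "powr_integral q \<Omega> (\<lambda>x. v x - avg N v x)
       \<le> (\<integral>\<^sup>+x. (\<Sum>k. ennreal ((?w k x / lam k) powr q) * indicator \<Omega> x) \<partial>lborel)"
      using AE_avg_tendsto[OF v \<Omega> s(1) fin]
    proof (intro nn_integral_mono_AE, eventually_elim)
      fix x assume x: "x \<in> \<Omega> \<longrightarrow> (\<lambda>k. avg k v x) \<longlonglongrightarrow> v x"
      show "ennreal (cmod (v x - avg N v x) powr q) * indicator \<Omega> x \<le> (\<Sum>k. ennreal ((?w k x / lam k) powr q) * indicator \<Omega> x)"
      proof (cases "x \<in> \<Omega>")
        case True
        then have "ennreal (cmod (v x - avg N v x)) \<le> (\<Sum>k. ennreal (?w k x))"
          using x by (intro dist_le_suminf_increments) auto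
        then have "ennreal (cmod (v x - avg N v x) powr q) \<le> (\<Sum>k. ennreal ((?w k x / lam k) powr q))"
          using q by (intro powr_le_suminf_scaled lam lam_sum) auto
        then show ?thesis using True by simp
      qed simp
    qed
    also have "\<dots> = (\<Sum>k. \<integral>\<^sup>+x\<in>\<Omega>. ennreal ((?w k x / lam k) powr q) \<partial>lborel)"
      by (rule nn_integral_suminf) measurable
    also have "\<dots> \<le> ennreal (c powr (- q) * C1 * M powr (q / 2) * 2 powr (- \<sigma> * real N) / (1 - r))"
    proof (rule suminf_ennreal_le_geometric)
      fix k
      have eq: "(?w k x / lam k) powr q = lam k powr (- q) * ?w k x powr q" for x
        using lam[of k] by (simp add: powr_divide powr_minus_divide)
      have "(\<integral>\<^sup>+x\<in>\<Omega>. ennreal ((?w k x / lam k) powr q) \<partial>lborel)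
          = (\<integral>\<^sup>+x. ennreal (lam k powr (- q)) * (ennreal (?w k x powr q) * indicator \<Omega> x) \<partial>lborel)"
        unfolding eq by (intro nn_integral_cong) (simp add: ennreal_mult mult.assoc)
      also have "\<dots> = ennreal (lam k powr (- q)) * (\<integral>\<^sup>+x\<in>\<Omega>. ennreal (?w k x powr q) \<partial>lborel)"
        by (rule nn_integral_cmult) measurable
      also have "\<dots> \<le> ennreal (lam k powr (- q)) * ennreal (C1 * M powr (q / 2) * 2 powr (- \<sigma> * real (N + k)))"
        unfolding C1_def b_def \<sigma>_def
        by (intro mult_left_mono avg_increment_powr_integral_le v \<Omega> s q M) auto
      also have "\<dots> = ennreal (lam k powr (- q) * (C1 * M powr (q / 2) * 2 powr (- \<sigma> * real (N + k))))"
        using C1 by (simp add: ennreal_mult)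
      also have "lam k powr (- q) * (C1 * M powr (q / 2) * 2 powr (- \<sigma> * real (N + k)))
          = c powr (- q) * C1 * M powr (q / 2) * 2 powr (- \<sigma> * real N) * r ^ k"
      proof -
        have 1: "lam k powr (- q) = c powr (- q) * 2 powr (\<sigma> / 2 * real k)"
        proof -
          have "lam k = c * 2 powr (- \<eta> * real k)" using two_powr_mult_nat[of "- \<eta>" k] by (simp add: lam_def)
          then have "lam k powr (- q) = c powr (- q) * 2 powr (- \<eta> * real k * - q)"
            using c by (simp add: powr_mult powr_powr)
          also have "- \<eta> * real k * - q = \<sigma> / 2 * real k" using q by (simp add: \<eta>_def)
          finally show ?thesis .
        qed
        have 2: "2 powr (- \<sigma> * real (N + k)) * 2 powr (\<sigma> / 2 * real k) = 2 powr (- \<sigma> * real N) * 2 powr (- (\<sigma> / 2) * real k)"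
          unfolding powr_add[symmetric] by (simp add: algebra_simps)
        have 3: "r ^ k = 2 powr (- (\<sigma> / 2) * real k)" by (simp only: r_def two_powr_mult_nat)
        have "lam k powr (- q) * (C1 * M powr (q / 2) * 2 powr (- \<sigma> * real (N + k)))
          = c powr (- q) * C1 * M powr (q / 2) * (2 powr (- \<sigma> * real (N + k)) * 2 powr (\<sigma> / 2 * real k))"
          unfolding 1 by (simp only: mult_ac)
        then show ?thesis unfolding 2 3 by (simp only: mult_ac)
      qed
      finally show "(\<integral>\<^sup>+x\<in>\<Omega>. ennreal ((?w k x / lam k) powr q) \<partial>lborel) \<le> ennreal (c powr (- q) * C1 * M powr (q / 2) * 2 powr (- \<sigma> * real N) * r ^ k)" .
    qed (use C1 r in auto)
    finally show ?thesis by (simp add: C_def mult_ac)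
  qed
  ultimately show thesis by (rule that)
qed

lemma avg_squared_le:
  assumes "L2 v"
  shows "ennreal ((cmod (avg k v x))\<^sup>2) \<le> 8 ^ k * sq_integral (cell k x) v"
  using avg_diff_squared_le[OF assms, of k x 0] by simp

lemma avg_squared_integral_le:
  assumes v: "L2 v" and \<Omega>: "saturated \<Omega>"
  shows "sq_integral \<Omega> (avg k v) \<le> sq_integral \<Omega> v"
proof -
  note [measurable] = L2_borel[OF v] saturated_borel[OF \<Omega>]
  have "sq_integral \<Omega> (avg k v)
     \<le> (\<integral>\<^sup>+x. 8 ^ k * (sq_integral (cell k x) v * indicator \<Omega> x) \<partial>lborel)"
    using avg_squared_le[OF v, of k] by (intro nn_integral_mono) (auto simp: indicator_def)
  also have "\<dots> = 8 ^ k * (ennreal (1 / 8 ^ k) * sq_integral \<Omega> v)"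
    by (subst nn_integral_cmult) (auto simp: nn_integral_cell_swap[OF _ \<Omega>])
  also have "\<dots> = (8 ^ k * ennreal (1 / 8 ^ k)) * sq_integral \<Omega> v"
    by (simp add: mult.assoc)
  also have "8 ^ k * ennreal (1 / 8 ^ k) = ennreal (8 ^ k * (1 / 8 ^ k))"
    by (subst ennreal_mult) (auto simp: ennreal_power[symmetric])
  finally show ?thesis by simp
qed

text \<open>If no cube that meets \<open>\<Omega>\<close> carries more mass than \<open>m\<close>, then the averages are bounded by a
  power of \<open>m\<close>, which makes them small in \<open>L\<^sup>q\<close> for \<open>q > 2\<close>. This is how the decay of radial
  functions is used.\<close>
lemma avg_powr_integral_le:
  assumes v: "L2 v" and \<Omega>: "saturated \<Omega>" and q: "2 \<le> q" and m: "0 \<le> m"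
    and le: "\<And>x. x \<in> \<Omega> \<Longrightarrow> sq_integral (cell k x) v \<le> ennreal m"
  shows "powr_integral q \<Omega> (avg k v)
    \<le> ennreal ((8 ^ k * m) powr ((q - 2) / 2)) * mass v"
proof -
  note [measurable] = L2_borel[OF v] saturated_borel[OF \<Omega>]
  have "powr_integral q \<Omega> (avg k v)
    \<le> ennreal ((8 ^ k * m) powr ((q - 2) / 2)) * sq_integral \<Omega> (avg k v)"
  proof (rule nn_integral_powr_interpolation)
    fix x assume "x \<in> \<Omega>"
    then have "ennreal ((cmod (avg k v x))\<^sup>2) \<le> 8 ^ k * ennreal m"
      using avg_squared_le[OF v, of k x] le by (meson mult_left_mono order_trans zero_le)
    also have "\<dots> = ennreal (8 ^ k * m)" using m by (simp add: ennreal_mult ennreal_power[symmetric])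
    finally show "(cmod (avg k v x))\<^sup>2 \<le> 8 ^ k * m" using m by simp
  qed (use q in auto)
  also have "\<dots> \<le> ennreal ((8 ^ k * m) powr ((q - 2) / 2)) * sq_integral \<Omega> v"
    by (intro mult_left_mono avg_squared_integral_le v \<Omega>) auto
  also have "\<dots> \<le> ennreal ((8 ^ k * m) powr ((q - 2) / 2)) * mass v"
    by (intro mult_left_mono nn_integral_mono) (auto simp: indicator_def)
  finally show ?thesis .
qed

section \<open>Decay of radial functions\<close>

lemma orthogonal_transformation_borel:
  fixes g :: "R3 \<Rightarrow> R3"
  assumes "orthogonal_transformation g"
  shows "g \<in> borel_measurable borel"
  using assms by (intro borel_measurable_continuous_onI linear_continuous_on)
      (simp add: orthogonal_transformation_linear linear_conv_bounded_linear[symmetric])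

text \<open>Invariance of measures of boxes under rotations, turned into a rule for changing
  variables.\<close>
lemma distr_lborel_orthogonal:
  fixes g :: "R3 \<Rightarrow> R3"
  assumes g: "orthogonal_transformation g"
  shows "distr lborel borel g = lborel"
proof (rule lborel_eqI[symmetric])
  note gm [measurable] = orthogonal_transformation_borel[OF g]
  have bij: "bij g" using g by (rule orthogonal_transformation_bij)
  define h where "h = inv g"
  have h: "orthogonal_transformation h" unfolding h_def using g by (rule orthogonal_transformation_inv)
  fix l u :: R3 assume le: "\<And>b. b \<in> Basis \<Longrightarrow> l \<bullet> b \<le> u \<bullet> b"
  have vim: "g -` box l u = h ` box l u" unfolding h_def using bij by (simp add: bij_vimage_eq_inv_image)
  have lm: "box l u \<in> lmeasurable" by simp
  have "emeasure (distr lborel borel g) (box l u) = emeasure lborel (g -` box l u)"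
    by (subst emeasure_distr) auto
  also have "\<dots> = emeasure lebesgue (g -` box l u)"
    using measurable_sets[OF gm, of "box l u"] by simp
  also have "\<dots> = emeasure lebesgue (h ` box l u)" by (simp add: vim)
  also have "\<dots> = ennreal (measure lebesgue (h ` box l u))"
    using measurable_orthogonal_image[OF h lm] by (rule emeasure_eq_measure2)
  also have "\<dots> = ennreal (measure lebesgue (box l u))"
    by (simp only: measure_orthogonal_image[OF h lm])
  also have "\<dots> = emeasure lebesgue (box l u)" using lm by (rule emeasure_eq_measure2[symmetric])
  also have "\<dots> = emeasure lborel (box l u)" by simp
  finally show "emeasure (distr lborel borel g) (box l u) = ennreal (\<Prod>b\<in>Basis. (u - l) \<bullet> b)"
    using le by (simp add: emeasure_lborel_box_eq)
qed simp

lemma ball_borel [measurable]: "ball (z :: R3) r \<in> sets borel"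
  by simp

lemma radial_ball_integral_eq:
  assumes [measurable]: "v \<in> borel_measurable borel" and rad: "radially_symmetric v" and n: "norm x = norm z"
  shows "sq_integral (ball x r) v = sq_integral (ball z r) v"
proof -
  obtain g where g: "orthogonal_transformation g" and gx: "g x = z"
    using orthogonal_transformation_exists[OF n] by blast
  note [measurable] = orthogonal_transformation_borel[OF g]
  obtain f where f: "AE y in lborel. v y = f (norm y)"
    using rad by (auto simp: radially_symmetric_def AE_completion_iff)
  have "AE y in distr lborel borel g. v y = f (norm y)"
    using f unfolding distr_lborel_orthogonal[OF g] .
  then have "AE y in lborel. v (g y) = f (norm (g y))"
    by (rule AE_distrD[rotated]) simp
  then have eq: "AE y in lborel. v (g y) = v y"
    using f by eventually_elim (simp add: orthogonal_transformation_norm[OF g])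
  have ind: "indicator (ball z r) (g y) = (indicator (ball x r) y :: ennreal)" for y
  proof -
    have "dist z (g y) = dist x y"
      unfolding gx[symmetric] using g by (simp add: orthogonal_transformation_isometry)
    then show ?thesis by (simp add: indicator_def)
  qed
  have "sq_integral (ball z r) v
      = (\<integral>\<^sup>+y\<in>ball z r. ennreal ((cmod (v y))\<^sup>2) \<partial>distr lborel borel g)"
    by (simp add: distr_lborel_orthogonal[OF g])
  also have "\<dots> = (\<integral>\<^sup>+y. ennreal ((cmod (v (g y)))\<^sup>2) * indicator (ball z r) (g y) \<partial>lborel)"
    by (rule nn_integral_distr) measurable
  also have "\<dots> = sq_integral (ball x r) v"
    using eq by (intro nn_integral_cong_AE, eventually_elim) (simp add: ind)
  finally show ?thesis by simp
qed

lemma separated_unit_vectors: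
  fixes n :: nat
  obtains F :: "R3 set" and d where "finite F" "card F = n" "F \<subseteq> sphere 0 1" "0 < d"
    "\<And>a b. a \<in> F \<Longrightarrow> b \<in> F \<Longrightarrow> a \<noteq> b \<Longrightarrow> d \<le> dist a b"
proof -
  have "infinite (sphere 0 1 :: R3 set)"
  proof
    assume fin: "finite (sphere 0 1 :: R3 set)"
    have "connected (sphere 0 1 :: R3 set)" by (rule connected_sphere) simp
    then have "sphere 0 1 = ({} :: R3 set) \<or> (\<exists>x. sphere 0 1 = {x :: R3})"
      using fin by (metis connected_finite_iff_sing)
    moreover have "axis 1 1 \<in> (sphere 0 1 :: R3 set)" "- axis 1 1 \<in> (sphere 0 1 :: R3 set)" by simp_all
    ultimately have "axis 1 1 = (- axis 1 1 :: R3)" by (metis empty_iff singletonD)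
    then have "(axis 1 1 :: R3) $ 1 = (- axis 1 1 :: R3) $ 1" by (rule arg_cong[where f="\<lambda>v. v $ 1"])
    then show False by (simp add: axis_def)
  qed
  then obtain F :: "R3 set" where F: "finite F" "card F = n" "F \<subseteq> sphere 0 1"
    using infinite_arbitrarily_large by blast
  have "\<exists>d>0. \<forall>x\<in>F. x \<noteq> a \<longrightarrow> d \<le> dist a x" for a using finite_set_avoid[OF F(1)] by blast
  then obtain d where d: "\<And>a. 0 < d a" "\<And>a x. x \<in> F \<Longrightarrow> x \<noteq> a \<Longrightarrow> d a \<le> dist a x" by metis
  define D where "D = Min (insert 1 (d ` F))"
  have "0 < D" unfolding D_def using F d by (subst Min_gr_iff) auto
  moreover have "D \<le> dist a b" if "a \<in> F" "b \<in> F" "a \<noteq> b" for a b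
  proof -
    have "D \<le> d a" unfolding D_def using F that by (intro Min_le) auto
    then show ?thesis using d(2)[of b a] that by force
  qed
  ultimately show thesis using that F by blast
qed

text \<open>On the sphere through a distant \<open>x\<close> there is room for the centres of \<open>n\<close> disjoint balls of
  radius \<open>4\<close>. A rotation carries each to the ball around \<open>x\<close>, so all carry the same share of the
  mass. The radius \<open>R\<close> depends on \<open>n\<close> alone, which makes the decay uniform in \<open>v\<close>. Balls of
  radius \<open>4\<close> contain the unit cubes around their centres.\<close>
lemma radial_ball_integral_decay:
  fixes n :: nat
  assumes n: "0 < n"
  obtains R where "0 < R" "\<And>v M x. v \<in> borel_measurable borel \<Longrightarrow> radially_symmetric v \<Longrightarrow> 0 \<le> M \<Longrightarrow>
    mass v \<le> ennreal M \<Longrightarrow> R \<le> norm x \<Longrightarrow>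
    sq_integral (ball x 4) v \<le> ennreal (M / real n)"
proof -
  obtain F :: "R3 set" and d where F: "finite F" "card F = n" "F \<subseteq> sphere 0 1" "0 < d"
    "\<And>a b. a \<in> F \<Longrightarrow> b \<in> F \<Longrightarrow> a \<noteq> b \<Longrightarrow> d \<le> dist a b"
    using separated_unit_vectors[of n] by metis
  have "sq_integral (ball x 4) v \<le> ennreal (M / real n)"
    if [measurable]: "v \<in> borel_measurable borel" and rad: "radially_symmetric v" and M: "0 \<le> M"
      and le: "mass v \<le> ennreal M" and x: "8 / d \<le> norm x" for v M x
  proof -
    let ?B = "\<lambda>a. ball (norm x *\<^sub>R a) 4"
    \<comment> \<open>The centres lie on the sphere through \<open>x\<close>, with distances at least \<open>norm x * d\<close>.\<close>
    have disj: "disjoint_family_on ?B F"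
      unfolding disjoint_family_on_def
    proof (intro ballI impI)
      fix a b assume ab: "a \<in> F" "b \<in> F" "a \<noteq> b"
      have "8 \<le> norm x * d" using x F(4) by (simp add: field_simps)
      also have "\<dots> \<le> norm x * dist a b" using F(5)[OF ab] by (intro mult_left_mono) auto
      also have "\<dots> = dist (norm x *\<^sub>R a) (norm x *\<^sub>R b)" by (simp add: dist_norm flip: scaleR_diff_right)
      finally have "8 \<le> dist (norm x *\<^sub>R a) (norm x *\<^sub>R b)" .
      then show "?B a \<inter> ?B b = {}" by (intro disjoint_ballI) simp
    qed
    have "of_nat n * sq_integral (ball x 4) v
        = (\<Sum>a\<in>F. \<integral>\<^sup>+y\<in>?B a. ennreal ((cmod (v y))\<^sup>2) \<partial>lborel)"
    proof -
      have "sq_integral (?B a) v = sq_integral (ball x 4) v"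
        if "a \<in> F" for a
        using F(3) that by (intro radial_ball_integral_eq rad) auto
      then show ?thesis by (simp add: F(2))
    qed
    also have "\<dots> = (\<integral>\<^sup>+y. (\<Sum>a\<in>F. ennreal ((cmod (v y))\<^sup>2) * indicator (?B a) y) \<partial>lborel)"
      by (rule nn_integral_sum[symmetric]) measurable
    also have "\<dots> \<le> mass v"
    proof (rule nn_integral_mono)
      fix y
      have "(\<Sum>a\<in>F. ennreal ((cmod (v y))\<^sup>2) * indicator (?B a) y)
          = ennreal ((cmod (v y))\<^sup>2) * indicator (\<Union>a\<in>F. ?B a) y"
        using indicator_UN_disjoint[OF F(1) disj, where 'c=ennreal] by (simp add: sum_distrib_left)
      then show "(\<Sum>a\<in>F. ennreal ((cmod (v y))\<^sup>2) * indicator (?B a) y) \<le> ennreal ((cmod (v y))\<^sup>2)"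
        by (simp add: indicator_def)
    qed
    also note le
    finally have *: "of_nat n * sq_integral (ball x 4) v \<le> ennreal M" .
    then have "sq_integral (ball x 4) v \<noteq> top"
      using n by (auto simp: ennreal_mult_top top_unique)
    then obtain t where t: "0 \<le> t" "sq_integral (ball x 4) v = ennreal t"
      by (cases "sq_integral (ball x 4) v") auto
    have "ennreal (real n * t) \<le> ennreal M"
      using * unfolding t(2) by (simp add: ennreal_mult t ennreal_of_nat_eq_real_of_nat)
    then have "t \<le> M / real n" using n M by (simp add: field_simps)
    then show ?thesis unfolding t(2) by (rule ennreal_leI)
  qed
  then show thesis using F(4) that[of "8 / d"] by simp
qed

text \<open>Half-open, so that it is a union of unit cubes.\<close>
definition sbox :: "nat \<Rightarrow> R3 set" where
  "sbox R = {x. \<forall>i. - real R \<le> x $ i \<and> x $ i < real R}"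

lemma sbox_borel [measurable]: "sbox R \<in> sets borel"
proof -
  have "Measurable.pred borel (\<lambda>x. x \<in> sbox R)"
    unfolding sbox_def mem_Collect_eq cart_eq_inner_axis
    by (intro pred_intros_countable) measurable
  then show ?thesis by (simp add: pred_def)
qed

lemma sbox_cell_iff: "y \<in> cell 0 x \<Longrightarrow> y \<in> sbox R \<longleftrightarrow> x \<in> sbox R"
proof -
  assume "y \<in> cell 0 x"
  then have f: "\<lfloor>y $ i\<rfloor> = \<lfloor>x $ i\<rfloor>" for i by (simp add: cell_def)
  have "(- real R \<le> t \<and> t < real R) \<longleftrightarrow> (- int R \<le> \<lfloor>t\<rfloor> \<and> \<lfloor>t\<rfloor> < int R)" for t
    by (simp add: le_floor_iff floor_less_iff)
  then show ?thesis by (simp add: sbox_def f)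
qed

lemma saturated_sbox [simp]: "saturated (sbox R)" "saturated (- sbox R)"
  by (auto simp: saturated_def sbox_cell_iff intro: borel_comp)

lemma norm_le_sbox: "x \<in> sbox R \<Longrightarrow> norm x \<le> 3 * real R"
proof -
  assume "x \<in> sbox R"
  then have "\<bar>x $ i\<bar> \<le> real R" for i unfolding sbox_def by (simp add: abs_le_iff) (smt (verit))
  then have "(\<Sum>i\<in>UNIV. \<bar>x $ i\<bar>) \<le> (\<Sum>i\<in>(UNIV::3 set). real R)"
    by (intro sum_mono) auto
  then show ?thesis using norm_le_l1_cart[of x] by simp
qed

lemma norm_ge_not_sbox: "x \<notin> sbox R \<Longrightarrow> real R \<le> norm x"
proof -
  assume "x \<notin> sbox R"
  then obtain i where "\<not> (- real R \<le> x $ i \<and> x $ i < real R)" by (auto simp: sbox_def)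
  then have "real R \<le> \<bar>x $ i\<bar>" by linarith
  then show ?thesis using component_le_norm_cart[of x i] by linarith
qed

lemma powr_add_le_two: 
  fixes a b :: real assumes "0 \<le> a" "0 \<le> b" "0 < q" "c \<le> a + b" "0 \<le> c"
  shows "c powr q \<le> 2 powr q * (a powr q + b powr q)"
proof -
  have "c \<le> 2 * max a b" using assms by auto
  then have "c powr q \<le> (2 * max a b) powr q" using assms by (intro powr_mono2) auto
  also have "\<dots> = 2 powr q * (max a b) powr q" using assms by (simp add: powr_mult)
  also have "(max a b) powr q \<le> a powr q + b powr q" by (simp add: max_def)
  finally show ?thesis by simp
qed

lemma powr_integral_add_le:
  assumes [measurable]: "f \<in> borel_measurable borel" "g \<in> borel_measurable borel" "\<Omega> \<in> sets borel" and q: "0 < q"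
  shows "powr_integral q \<Omega> (\<lambda>x. f x + g x) \<le> ennreal (2 powr q) * (powr_integral q \<Omega> f + powr_integral q \<Omega> g)"
proof -
  have "powr_integral q \<Omega> (\<lambda>x. f x + g x)
      \<le> (\<integral>\<^sup>+x. ennreal (2 powr q) * (ennreal (cmod (f x) powr q) * indicator \<Omega> x + ennreal (cmod (g x) powr q) * indicator \<Omega> x) \<partial>lborel)"
  proof (rule nn_integral_mono)
    fix x
    have "ennreal (cmod (f x + g x) powr q) \<le> ennreal (2 powr q * (cmod (f x) powr q + cmod (g x) powr q))"
      using q norm_triangle_ineq[of "f x" "g x"] by (intro ennreal_leI powr_add_le_two) auto
    then show "ennreal (cmod (f x + g x) powr q) * indicator \<Omega> x \<le> ennreal (2 powr q) * (ennreal (cmod (f x) powr q) * indicator \<Omega> x + ennreal (cmod (g x) powr q) * indicator \<Omega> x)"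
      by (simp add: indicator_def ennreal_mult ennreal_plus)
  qed
  also have "\<dots> = ennreal (2 powr q) * (powr_integral q \<Omega> f + powr_integral q \<Omega> g)"
    by (simp add: nn_integral_cmult nn_integral_add)
  finally show ?thesis .
qed

text \<open>Three choices in this order: a scale at which \<open>v\<close> is close to its averages, a fraction
  \<open>1 / n\<close> of the mass for which the averages at this scale are small, and a box outside of which
  every cube carries no more than this fraction.\<close>
lemma radial_tail_uniformly_small:
  assumes s: "0 < s" "s < 1" and q: "2 < q" "q < 6 / (3 - 2 * s)" and M: "0 \<le> M" and \<epsilon>: "0 < \<epsilon>"
  obtains R where "\<And>v. L2 v \<Longrightarrow> radially_symmetric v \<Longrightarrow> local_energy s v UNIV \<le> ennreal M \<Longrightarrow>
    mass v \<le> ennreal M \<Longrightarrow>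
    powr_integral q (- sbox R) v \<le> ennreal \<epsilon>"
proof -
  obtain C \<delta> where C: "0 \<le> C" "0 < \<delta>"
    "\<And>N v \<Omega> M. L2 v \<Longrightarrow> saturated \<Omega> \<Longrightarrow> 0 \<le> M \<Longrightarrow> local_energy s v \<Omega> \<le> ennreal M \<Longrightarrow>
      powr_integral q \<Omega> (\<lambda>x. v x - avg N v x) \<le> ennreal (C * M powr (q / 2) * 2 powr (- \<delta> * real N))"
    using avg_approximation[OF s q] by blast
  have "(\<lambda>N. 2 powr q * (C * M powr (q / 2) * (2 powr (- \<delta>)) ^ N)) \<longlonglongrightarrow> 2 powr q * (C * M powr (q / 2) * 0)"
    using two_powr_neg_less_1[OF C(2)] by (intro tendsto_intros LIMSEQ_power_zero) simp
  then have "eventually (\<lambda>N. 2 powr q * (C * M powr (q / 2) * (2 powr (- \<delta>)) ^ N) < \<epsilon> / 2) sequentially"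
    by (rule order_tendstoD(2)) (use \<epsilon> in simp)
  then obtain N where N: "2 powr q * (C * M powr (q / 2) * (2 powr (- \<delta>)) ^ N) < \<epsilon> / 2"
    by (auto simp: eventually_sequentially)
  have "(\<lambda>n. 2 powr q * ((8 ^ N * (M * inverse (real (Suc n)))) powr ((q - 2) / 2) * M)) \<longlonglongrightarrow> 2 powr q * ((8 ^ N * (M * 0)) powr ((q - 2) / 2) * M)"
    using M q by (intro tendsto_intros tendsto_powr' LIMSEQ_inverse_real_of_nat) (auto intro!: always_eventually)
  then have "eventually (\<lambda>n. 2 powr q * ((8 ^ N * (M * inverse (real (Suc n)))) powr ((q - 2) / 2) * M) < \<epsilon> / 2) sequentially"
    by (rule order_tendstoD(2)) (use \<epsilon> q in simp)
  then obtain n where n: "2 powr q * ((8 ^ N * (M * inverse (real (Suc n)))) powr ((q - 2) / 2) * M) < \<epsilon> / 2"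
    by (auto simp: eventually_sequentially)
  obtain R0 where R0: "0 < R0" "\<And>v M x. v \<in> borel_measurable borel \<Longrightarrow> radially_symmetric v \<Longrightarrow> 0 \<le> M \<Longrightarrow>
    mass v \<le> ennreal M \<Longrightarrow> R0 \<le> norm x \<Longrightarrow>
    sq_integral (ball x 4) v \<le> ennreal (M / real (Suc n))"
    using radial_ball_integral_decay[of "Suc n"] by blast
  obtain R :: nat where R: "R0 \<le> real R" using real_arch_simple by blast
  show thesis
  proof (rule that[of R])
    fix v assume v: "L2 v" and rad: "radially_symmetric v" and E: "local_energy s v UNIV \<le> ennreal M"
      and vM: "mass v \<le> ennreal M"
    note [measurable] = L2_borel[OF v]
    have local: "sq_integral (cell N x) v \<le> ennreal (M * inverse (real (Suc n)))"
      if "x \<in> - sbox R" for x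
    proof -
      have "cell N x \<subseteq> ball x 4"
      proof
        fix y assume "y \<in> cell N x"
        then have "y \<in> cell 0 x" using cell_mono[of 0 N x] by auto
        then show "y \<in> ball x 4" using norm_diff_cell_le[of y 0 x] by (simp add: dist_norm)
      qed
      then have "sq_integral (cell N x) v \<le> sq_integral (ball x 4) v"
        by (intro nn_integral_mono) (auto simp: indicator_def)
      also have "\<dots> \<le> ennreal (M / real (Suc n))"
        using that norm_ge_not_sbox[of x R] R by (intro R0(2) rad M vM) auto
      finally show ?thesis by (simp add: divide_inverse)
    qed
    have "powr_integral q (- sbox R) v \<le> ennreal (2 powr q) *
        (powr_integral q (- sbox R) (\<lambda>x. v x - avg N v x) + powr_integral q (- sbox R) (avg N v))"
      using powr_integral_add_le[of "\<lambda>x. v x - avg N v x" "avg N v" "- sbox R" q] q by simp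
    also have "\<dots> \<le> ennreal (2 powr q) * (ennreal (C * M powr (q / 2) * 2 powr (- \<delta> * real N))
         + ennreal ((8 ^ N * (M * inverse (real (Suc n)))) powr ((q - 2) / 2)) * ennreal M)"
    proof (intro mult_left_mono add_mono)
      show "powr_integral q (- sbox R) (\<lambda>x. v x - avg N v x) \<le> ennreal (C * M powr (q / 2) * 2 powr (- \<delta> * real N))"
      proof (rule C(3)[OF v _ M])
        have "local_energy s v (- sbox R) \<le> local_energy s v UNIV"
          unfolding local_energy_def by (intro nn_integral_mono) (auto simp: indicator_def)
        then show "local_energy s v (- sbox R) \<le> ennreal M" using E by (rule order_trans)
      qed simp
      have "powr_integral q (- sbox R) (avg N v)
        \<le> ennreal ((8 ^ N * (M * inverse (real (Suc n)))) powr ((q - 2) / 2)) * mass v"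
        using q M by (intro avg_powr_integral_le v local) auto
      also have "\<dots> \<le> ennreal ((8 ^ N * (M * inverse (real (Suc n)))) powr ((q - 2) / 2)) * ennreal M"
        by (intro mult_left_mono vM) auto
      finally show "powr_integral q (- sbox R) (avg N v) \<le> ennreal ((8 ^ N * (M * inverse (real (Suc n)))) powr ((q - 2) / 2)) * ennreal M" .
    qed auto
    also have "\<dots> = ennreal (2 powr q * (C * M powr (q / 2) * 2 powr (- \<delta> * real N) + (8 ^ N * (M * inverse (real (Suc n)))) powr ((q - 2) / 2) * M))"
      using C M by (simp add: ennreal_mult ennreal_plus)
    also have "\<dots> \<le> ennreal \<epsilon>"
      using N n two_powr_mult_nat[of "- \<delta>" N] by (intro ennreal_leI) (simp add: distrib_left)
    finally show "powr_integral q (- sbox R) v \<le> ennreal \<epsilon>" .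
  qed
qed

section \<open>Compactness of radial sequences\<close>

text \<open>Integer coordinates of cubes make the family of all cubes countable and the cubes of one
  scale in a box finite in number.\<close>
definition cell_index :: "nat \<Rightarrow> R3 \<Rightarrow> int ^ 3" where
  "cell_index k x = (\<chi> i. \<lfloor>2 ^ k * x $ i\<rfloor>)"

definition cell_corner :: "nat \<Rightarrow> int ^ 3 \<Rightarrow> R3" where
  "cell_corner k z = (\<chi> i. of_int (z $ i) / 2 ^ k)"

lemma cell_corner_in_cell: "cell_corner k (cell_index k x) \<in> cell k x"
  by (simp add: cell_def cell_corner_def cell_index_def)

lemma avg_cell_corner: "avg k v (cell_corner k (cell_index k x)) = avg k v x"
  by (rule avg_cong_cell[OF cell_corner_in_cell])

lemma finite_cell_index_sbox: "finite (cell_index k ` sbox R)"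
proof (rule finite_subset)
  let ?B = "Pi\<^sub>E (UNIV :: 3 set) (\<lambda>_. {- (2 ^ k * int R)..2 ^ k * int R})"
  show "finite (vec_lambda ` ?B)" by (intro finite_imageI finite_PiE) auto
  show "cell_index k ` sbox R \<subseteq> vec_lambda ` ?B"
  proof
    fix z assume "z \<in> cell_index k ` sbox R"
    then obtain x where x: "x \<in> sbox R" "z = cell_index k x" by blast
    have "z $ i \<in> {- (2 ^ k * int R)..2 ^ k * int R}" for i
    proof -
      have b: "- real R \<le> x $ i" "x $ i \<le> real R" using x(1) by (auto simp: sbox_def less_imp_le)
      have "2 ^ k * - real R \<le> 2 ^ k * x $ i" "2 ^ k * x $ i \<le> 2 ^ k * real R"
        by (intro mult_left_mono b; simp)+
      then have 1: "of_int (- (2 ^ k * int R)) \<le> 2 ^ k * x $ i" and 2: "2 ^ k * x $ i \<le> of_int (2 ^ k * int R)"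
        by simp_all
      have "- (2 ^ k * int R) \<le> \<lfloor>2 ^ k * x $ i\<rfloor>" using 1 by (simp only: le_floor_iff)
      moreover have "\<lfloor>2 ^ k * x $ i\<rfloor> \<le> \<lfloor>of_int (2 ^ k * int R) :: real\<rfloor>" using 2 by (rule floor_mono)
      ultimately show ?thesis unfolding x(2) cell_index_def floor_of_int by simp
    qed
    then have "vec_nth z \<in> ?B" by (auto simp: PiE_def extensional_def)
    then show "z \<in> vec_lambda ` ?B" by (metis image_eqI vec_nth_inverse)
  qed
qed

text \<open>The diagonal argument over all dyadic cubes.\<close>
lemma avg_convergent_subsequence:
  fixes u :: "nat \<Rightarrow> R3 \<Rightarrow> complex"
  assumes u: "\<And>n. L2 (u n)" and M: "0 \<le> M"
    and le: "\<And>n. mass (u n) \<le> ennreal M"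
  obtains r :: "nat \<Rightarrow> nat" where "strict_mono r" "\<And>k x. convergent (\<lambda>n. avg k (u (r n)) x)"
proof -
  \<comment> \<open>Integrals instead of averages: they are bounded by \<open>sqrt M\<close> uniformly in the scale.\<close>
  define f :: "nat \<Rightarrow> nat \<times> (int ^ 3) \<Rightarrow> complex"
    where "f n p = (1 / 8 ^ fst p) *\<^sub>R avg (fst p) (u n) (cell_corner (fst p) (snd p))" for n p
  have bound: "cmod (avg k (u n) x) \<le> 8 ^ k * sqrt M" for k n x
  proof -
    have "ennreal ((cmod (avg k (u n) x))\<^sup>2) \<le> 8 ^ k * sq_integral (cell k x) (u n)"
      by (rule avg_squared_le[OF u])
    also have "\<dots> \<le> 8 ^ k * mass (u n)"
      by (intro mult_left_mono nn_integral_mono) (auto simp: indicator_def)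
    also have "\<dots> \<le> 8 ^ k * ennreal M" by (intro mult_left_mono le) auto
    also have "\<dots> = ennreal (8 ^ k * M)" using M by (simp add: ennreal_mult ennreal_power[symmetric])
    finally have "(cmod (avg k (u n) x))\<^sup>2 \<le> 8 ^ k * M" using M by simp
    also have "\<dots> \<le> 8 ^ k * 8 ^ k * M" using M by (intro mult_right_mono) (simp_all add: self_le_power)
    also have "\<dots> = (8 ^ k * sqrt M)\<^sup>2" using M by (simp add: power2_eq_square)
    finally show ?thesis by (rule power2_le_imp_le) (use M in simp)
  qed
  have "norm (f n p) \<le> sqrt M" for n p
    using bound[of "fst p" n "cell_corner (fst p) (snd p)"] by (simp add: f_def divide_simps mult.commute)
  then have "\<exists>r :: nat \<Rightarrow> nat. strict_mono r \<and> (\<forall>p. \<exists>l. (\<lambda>n. f (r n) p) \<longlonglongrightarrow> l)"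
    by (rule function_convergent_subsequence[of "UNIV :: (nat \<times> (int ^ 3)) set" f "sqrt M", rotated]) auto
  then obtain r where r: "strict_mono (r :: nat \<Rightarrow> nat)" "\<And>p. \<exists>l. (\<lambda>n. f (r n) p) \<longlonglongrightarrow> l"
    by blast
  have "convergent (\<lambda>n. avg k (u (r n)) x)" for k x
  proof -
    obtain l where "(\<lambda>n. f (r n) (k, cell_index k x)) \<longlonglongrightarrow> l" using r(2) by blast
    then have "(\<lambda>n. 8 ^ k *\<^sub>R f (r n) (k, cell_index k x)) \<longlonglongrightarrow> 8 ^ k *\<^sub>R l" by (intro tendsto_intros)
    then show ?thesis by (auto simp: f_def avg_cell_corner convergent_def)
  qed
  then show thesis using r(1) that by blast
qed

text \<open>A box meets finitely many cubes of one scale, and averages are constant on each of them,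
  so pointwise convergence is uniform.\<close>
lemma avg_uniformly_Cauchy:
  fixes u :: "nat \<Rightarrow> R3 \<Rightarrow> complex"
  assumes conv: "\<And>x. convergent (\<lambda>n. avg k (u n) x)" and \<epsilon>: "0 < \<epsilon>"
  obtains N where "\<And>n m x. N \<le> n \<Longrightarrow> N \<le> m \<Longrightarrow> x \<in> sbox R \<Longrightarrow> cmod (avg k (u n) x - avg k (u m) x) \<le> \<epsilon>"
proof -
  have "\<exists>N. \<forall>n\<ge>N. \<forall>m\<ge>N. cmod (avg k (u n) x - avg k (u m) x) < \<epsilon>" for x
    using convergent_Cauchy[OF conv] \<epsilon> unfolding Cauchy_def dist_norm by blast
  then obtain F where F: "\<And>x n m. F x \<le> n \<Longrightarrow> F x \<le> m \<Longrightarrow> cmod (avg k (u n) x - avg k (u m) x) < \<epsilon>"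
    by metis
  define S where "S = (\<lambda>x. F (cell_corner k (cell_index k x))) ` sbox R"
  have "S = (\<lambda>z. F (cell_corner k z)) ` (cell_index k ` sbox R)" by (auto simp: S_def)
  then have fin: "finite S" using finite_cell_index_sbox by simp
  show thesis
  proof (rule that[of "Max S"])
    fix n m x assume nm: "Max S \<le> n" "Max S \<le> m" "x \<in> sbox R"
    then have "F (cell_corner k (cell_index k x)) \<le> Max S" unfolding S_def[symmetric]
      by (intro Max_ge fin) (auto simp: S_def)
    then show "cmod (avg k (u n) x - avg k (u m) x) \<le> \<epsilon>"
      using F[of "cell_corner k (cell_index k x)" n m] nm by (simp add: avg_cell_corner)
  qed
qed

lemma powr_add_le_three:
  fixes a b d :: real assumes "0 \<le> a" "0 \<le> b" "0 \<le> d" "0 < q" "c \<le> a + b + d" "0 \<le> c"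
  shows "c powr q \<le> 3 powr q * (a powr q + b powr q + d powr q)"
proof -
  define m where "m = max a (max b d)"
  have "c \<le> 3 * m" "0 \<le> m" using assms by (auto simp: m_def)
  then have "c powr q \<le> (3 * m) powr q" using assms by (intro powr_mono2) auto
  also have "\<dots> = 3 powr q * m powr q" using \<open>0 \<le> m\<close> by (simp add: powr_mult)
  also have "m powr q \<le> a powr q + b powr q + d powr q" by (auto simp: m_def max_def)
  finally show ?thesis by simp
qed

text \<open>Inside a large box the functions are close to averages that converge uniformly; outside
  they are small. The hypotheses differ accordingly: globally only the energy of the modulus is
  bounded, and the energy of the function itself is bounded on each box, by a constant that may
  grow with the box.\<close>
theorem radial_compactness:
  fixes u :: "nat \<Rightarrow> R3 \<Rightarrow> complex"
  assumes s: "0 < s" "s < 1" and M: "0 \<le> M"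
    and u: "\<And>n. L2 (u n)" and rad: "\<And>n. radially_symmetric (u n)"
    and mass: "\<And>n. mass (u n) \<le> ennreal M"
    and mod_energy: "\<And>n. local_energy s (\<lambda>x. complex_of_real (cmod (u n x))) UNIV \<le> ennreal M"
    and box_energy: "\<And>R. \<exists>K. \<forall>n. local_energy s (u n) (sbox R) \<le> ennreal K"
  obtains r :: "nat \<Rightarrow> nat" where "strict_mono r"
    "\<And>q \<epsilon>. 2 < q \<Longrightarrow> q < 6 / (3 - 2 * s) \<Longrightarrow> 0 < \<epsilon> \<Longrightarrow>
      \<exists>N. \<forall>n\<ge>N. \<forall>m\<ge>N. powr_mass q (\<lambda>x. u (r n) x - u (r m) x) \<le> ennreal \<epsilon>"
proof -
  obtain r :: "nat \<Rightarrow> nat" where r: "strict_mono r" and conv: "\<And>k x. convergent (\<lambda>n. avg k (u (r n)) x)"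
    by (rule avg_convergent_subsequence[OF u M mass]) (rule that)
  note [measurable] = L2_borel[OF u]
  have "\<exists>N. \<forall>n\<ge>N. \<forall>m\<ge>N. powr_mass q (\<lambda>x. u (r n) x - u (r m) x) \<le> ennreal \<epsilon>"
    if q: "2 < q" "q < 6 / (3 - 2 * s)" and \<epsilon>: "0 < \<epsilon>" for q \<epsilon>
  proof -
    \<comment> \<open>Five error terms: two approximations, two tails, and the difference of the averages; the
      factor \<open>3 powr q\<close> comes from \<open>powr_add_le_three\<close>.\<close>
    define e where "e = \<epsilon> / (5 * 3 powr q)"
    have e: "0 < e" using \<epsilon> by (simp add: e_def)
    obtain R where R: "\<And>v. L2 v \<Longrightarrow> radially_symmetric v \<Longrightarrow> local_energy s v UNIV \<le> ennreal M \<Longrightarrow>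
      mass v \<le> ennreal M \<Longrightarrow>
      powr_integral q (- sbox R) v \<le> ennreal e"
      using radial_tail_uniformly_small[OF s q M e] by blast
    have tail: "powr_integral q (- sbox R) (u n) \<le> ennreal e" for n
    proof -
      let ?v = "\<lambda>x. complex_of_real (cmod (u n x))"
      have "powr_integral q (- sbox R) ?v \<le> ennreal e"
      proof (rule R)
        show "L2 ?v" using u[of n] by (simp add: L2_def)
        obtain f where "AE x in lebesgue. u n x = f (norm x)" using rad[of n] by (auto simp: radially_symmetric_def)
        then have "AE x in lebesgue. ?v x = (\<lambda>t. complex_of_real (cmod (f t))) (norm x)"
          by eventually_elim simp
        then show "radially_symmetric ?v" 
          unfolding radially_symmetric_def by (intro exI[of _ "\<lambda>t. complex_of_real (cmod (f t))"])
      qed (use mod_energy[of n] mass[of n] in simp_all)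
      then show ?thesis by simp
    qed
    obtain K where "\<forall>n. local_energy s (u n) (sbox R) \<le> ennreal K" using box_energy by blast
    then have K0: "local_energy s (u n) (sbox R) \<le> ennreal K" for n by blast
    have "ennreal K \<le> ennreal (max 0 K)" by (rule ennreal_leI) simp
    then have K: "local_energy s (u n) (sbox R) \<le> ennreal (max 0 K)" for n
      using K0[of n] by (rule order_trans[rotated])
    obtain C \<delta> where C: "0 \<le> C" "0 < \<delta>"
      "\<And>N v \<Omega> M. L2 v \<Longrightarrow> saturated \<Omega> \<Longrightarrow> 0 \<le> M \<Longrightarrow> local_energy s v \<Omega> \<le> ennreal M \<Longrightarrow>
        powr_integral q \<Omega> (\<lambda>x. v x - avg N v x) \<le> ennreal (C * M powr (q / 2) * 2 powr (- \<delta> * real N))"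
      using avg_approximation[OF s q] by blast
    have "(\<lambda>N. C * (max 0 K) powr (q / 2) * (2 powr (- \<delta>)) ^ N) \<longlonglongrightarrow> C * (max 0 K) powr (q / 2) * 0"
      using two_powr_neg_less_1[OF C(2)] by (intro tendsto_intros LIMSEQ_power_zero) simp
    then have "eventually (\<lambda>N. C * (max 0 K) powr (q / 2) * (2 powr (- \<delta>)) ^ N < e) sequentially"
      by (rule order_tendstoD(2)) (use e in simp)
    then obtain k where k: "C * (max 0 K) powr (q / 2) * (2 powr (- \<delta>)) ^ k < e"
      by (auto simp: eventually_sequentially)
    have approx: "powr_integral q (sbox R) (\<lambda>x. u n x - avg k (u n) x) \<le> ennreal e" for n
    proof -
      have "powr_integral q (sbox R) (\<lambda>x. u n x - avg k (u n) x)
          \<le> ennreal (C * (max 0 K) powr (q / 2) * 2 powr (- \<delta> * real k))"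
        by (rule C(3)[OF u _ _ K]) auto
      also have "\<dots> \<le> ennreal e" using k two_powr_mult_nat[of "- \<delta>" k] by (intro ennreal_leI) simp
      finally show ?thesis .
    qed
    have "emeasure lborel (sbox R) < \<infinity>"
    proof (rule order_le_less_trans)
      have "sbox R \<subseteq> cbox (\<chi> i. - real R) (\<chi> i. real R)"
        by (auto simp: sbox_def mem_box_cart less_imp_le)
      then show "emeasure lborel (sbox R) \<le> emeasure lborel (cbox (\<chi> i. - real R) (\<chi> i. real R) :: R3 set)"
        by (rule emeasure_mono) simp
    qed (rule emeasure_lborel_cbox_finite)
    then obtain V where V: "0 \<le> V" "emeasure lborel (sbox R) = ennreal V"
      by (cases "emeasure lborel (sbox R)") auto
    define d where "d = (e / (V + 1)) powr (1 / q)"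
    have d: "0 < d" using e V by (simp add: d_def)
    have dq: "d powr q * V \<le> e"
    proof -
      have "d powr q = e / (V + 1)" using e V q by (simp add: d_def powr_powr)
      have "d powr q * V \<le> d powr q * (V + 1)" by (intro mult_left_mono) auto
      also have "\<dots> = e" unfolding \<open>d powr q = e / (V + 1)\<close> using V by simp
      finally show ?thesis .
    qed
    obtain N where N: "\<And>n m x. N \<le> n \<Longrightarrow> N \<le> m \<Longrightarrow> x \<in> sbox R \<Longrightarrow> cmod (avg k (u (r n)) x - avg k (u (r m)) x) \<le> d"
      using avg_uniformly_Cauchy[of k "\<lambda>n. u (r n)" d R, OF conv d] by blast
    have "powr_mass q (\<lambda>x. u (r n) x - u (r m) x) \<le> ennreal \<epsilon>" if nm: "N \<le> n" "N \<le> m" for n m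
    proof -
      let ?a = "\<lambda>n x. ennreal (cmod (u (r n) x - avg k (u (r n)) x) powr q) * indicator (sbox R) x"
      let ?t = "\<lambda>n x. ennreal (cmod (u (r n) x) powr q) * indicator (- sbox R) x"
      have sub: "ennreal (cmod (u (r n) x - u (r m) x) powr q)
         \<le> ennreal (3 powr q) * (?a n x + ?a m x + ennreal (d powr q) * indicator (sbox R) x + ?t n x + ?t m x)" for x
      proof (cases "x \<in> sbox R")
        case True
        have "u (r n) x - u (r m) x = (u (r n) x - avg k (u (r n)) x) + (avg k (u (r n)) x - avg k (u (r m)) x) - (u (r m) x - avg k (u (r m)) x)"
          by simp
        then have "cmod (u (r n) x - u (r m) x) = cmod ((u (r n) x - avg k (u (r n)) x) + (avg k (u (r n)) x - avg k (u (r m)) x) - (u (r m) x - avg k (u (r m)) x))"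
          by (rule arg_cong)
        also have "\<dots> \<le> cmod (u (r n) x - avg k (u (r n)) x) + cmod (avg k (u (r n)) x - avg k (u (r m)) x) + cmod (u (r m) x - avg k (u (r m)) x)"
          by (rule order_trans[OF norm_triangle_ineq4 add_right_mono[OF norm_triangle_ineq]])
        also have "\<dots> \<le> cmod (u (r n) x - avg k (u (r n)) x) + cmod (u (r m) x - avg k (u (r m)) x) + d"
          using N[OF nm True] by simp
        finally have "cmod (u (r n) x - u (r m) x) powr q \<le> 3 powr q * (cmod (u (r n) x - avg k (u (r n)) x) powr q + cmod (u (r m) x - avg k (u (r m)) x) powr q + d powr q)"
          using q d by (intro powr_add_le_three) auto
        then have "ennreal (cmod (u (r n) x - u (r m) x) powr q) \<le> ennreal (3 powr q * (cmod (u (r n) x - avg k (u (r n)) x) powr q + cmod (u (r m) x - avg k (u (r m)) x) powr q + d powr q))"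
          by (rule ennreal_leI)
        then show ?thesis using True by (simp add: ennreal_mult ennreal_plus)
      next
        case False
        have "cmod (u (r n) x - u (r m) x) powr q \<le> 3 powr q * (cmod (u (r n) x) powr q + cmod (u (r m) x) powr q + 0 powr q)"
          using q norm_triangle_ineq4[of "u (r n) x" "u (r m) x"] by (intro powr_add_le_three) auto
        then have "ennreal (cmod (u (r n) x - u (r m) x) powr q) \<le> ennreal (3 powr q * (cmod (u (r n) x) powr q + cmod (u (r m) x) powr q))"
          by (intro ennreal_leI) simp
        then show ?thesis using False by (simp add: ennreal_mult ennreal_plus)
      qed
      have "powr_mass q (\<lambda>x. u (r n) x - u (r m) x)
        \<le> (\<integral>\<^sup>+x. ennreal (3 powr q) * (?a n x + ?a m x + ennreal (d powr q) * indicator (sbox R) x + ?t n x + ?t m x) \<partial>lborel)"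
        by (intro nn_integral_mono sub)
      also have "\<dots> = ennreal (3 powr q) * ((\<integral>\<^sup>+x. ?a n x \<partial>lborel) + (\<integral>\<^sup>+x. ?a m x \<partial>lborel)
          + ennreal (d powr q) * emeasure lborel (sbox R) + (\<integral>\<^sup>+x. ?t n x \<partial>lborel) + (\<integral>\<^sup>+x. ?t m x \<partial>lborel))"
        by (simp add: nn_integral_cmult nn_integral_add nn_integral_cmult_indicator)
      also have "\<dots> \<le> ennreal (3 powr q) * (ennreal e + ennreal e + ennreal e + ennreal e + ennreal e)"
        using dq V by (intro mult_left_mono add_mono approx tail) (auto simp: ennreal_mult[symmetric] ennreal_leI)
      also have "\<dots> = ennreal (3 powr q * (e + e + e + e + e))"
        by (subst ennreal_mult) (use e in \<open>simp_all flip: ennreal_plus\<close>)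
      also have "3 powr q * (e + e + e + e + e) = \<epsilon>" by (simp add: e_def)
      finally show ?thesis .
    qed
    then show ?thesis by blast
  qed
  then show thesis using r that by blast
qed

text \<open>The argument of Riesz and Fischer for finitely many exponents at once. Along a rapidly
  convergent subsequence the sum \<open>h\<close> of the moduli of all increments lies in each of the spaces;
  it is therefore finite almost everywhere, and where it is finite the sequence converges and
  stays below it.\<close>
lemma dominated_subsequence:
  fixes u :: "nat \<Rightarrow> R3 \<Rightarrow> complex" and Q :: "real set"
  assumes u[measurable]: "\<And>n. u n \<in> borel_measurable borel" and Q: "finite Q" "Q \<noteq> {}" "\<And>q. q \<in> Q \<Longrightarrow> 0 < q"
    and fin: "\<And>n q. q \<in> Q \<Longrightarrow> powr_mass q (u n) < \<infinity>"
    and cauchy: "\<And>q \<epsilon>. q \<in> Q \<Longrightarrow> 0 < \<epsilon> \<Longrightarrow>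
      \<exists>N. \<forall>n\<ge>N. \<forall>m\<ge>N. powr_mass q (\<lambda>x. u n x - u m x) \<le> ennreal \<epsilon>"
  obtains r :: "nat \<Rightarrow> nat" and w :: "R3 \<Rightarrow> complex" and h :: "R3 \<Rightarrow> real"
  where "strict_mono r" "w \<in> borel_measurable borel" "h \<in> borel_measurable borel" "\<And>x. 0 \<le> h x"
    "AE x in lborel. (\<lambda>n. u (r n) x) \<longlonglongrightarrow> w x"
    "AE x in lborel. \<forall>n. cmod (u (r n) x) \<le> h x"
    "\<And>q. q \<in> Q \<Longrightarrow> (\<integral>\<^sup>+x. ennreal (h x powr q) \<partial>lborel) < \<infinity>"
proof -
  define lam :: "nat \<Rightarrow> real" where "lam k = 1 / 4 * (1 / 2) ^ k" for k
  have lam: "0 < lam k" for k by (simp add: lam_def)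
  have lam_sum: "summable lam" "suminf lam \<le> 1 / 2"
  proof -
    show "summable lam" unfolding lam_def by (intro summable_mult summable_geometric) simp
    have "suminf lam = 1 / 4 * (\<Sum>k. (1 / 2) ^ k)" unfolding lam_def
      by (rule suminf_mult) (simp add: summable_geometric)
    then show "suminf lam \<le> 1 / 2" by (simp add: suminf_geometric)
  qed
  \<comment> \<open>The minimum makes one subsequence fast enough for all exponents; the factor
    \<open>lam (Suc k) powr q\<close> cancels the loss in \<open>powr_le_suminf_scaled\<close>.\<close>
  define e where "e k = (1 / 2) ^ k * Min ((\<lambda>q. lam (Suc k) powr q) ` Q)" for k
  have e: "0 < e k" for k unfolding e_def using Q lam[of "Suc k"] by (intro mult_pos_pos) (auto simp: Min_gr_iff)
  have e_le: "e k \<le> (1 / 2) ^ k * lam (Suc k) powr q" if "q \<in> Q" for k q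
    unfolding e_def using Q that by (intro mult_left_mono Min_le) auto
  have "\<exists>N. \<forall>q\<in>Q. \<forall>n\<ge>N. \<forall>m\<ge>N. powr_mass q (\<lambda>x. u n x - u m x) \<le> ennreal (e k)" for k
  proof -
    obtain F where F: "\<And>q n m. q \<in> Q \<Longrightarrow> F q \<le> n \<Longrightarrow> F q \<le> m \<Longrightarrow> powr_mass q (\<lambda>x. u n x - u m x) \<le> ennreal (e k)"
      using cauchy[OF _ e[of k]] by metis
    have "F q \<le> Max (F ` Q)" if "q \<in> Q" for q using that Q by simp
    then show ?thesis using F by (meson order_trans)
  qed
  then obtain Nf where Nf: "\<And>k q n m. q \<in> Q \<Longrightarrow> Nf k \<le> n \<Longrightarrow> Nf k \<le> m \<Longrightarrow> powr_mass q (\<lambda>x. u n x - u m x) \<le> ennreal (e k)"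
    by metis
  define r where "r k = (\<Sum>j\<le>k. Suc (Nf j))" for k
  have r: "strict_mono r" unfolding strict_mono_Suc_iff by (simp add: r_def)
  have rN: "Nf k \<le> r k" for k by (cases k) (simp_all add: r_def)
  define a where "a k x = (case k of 0 \<Rightarrow> cmod (u (r 0) x) | Suc j \<Rightarrow> cmod (u (r (Suc j)) x - u (r j) x))" for k x
  have a0: "0 \<le> a k x" for k x by (simp add: a_def split: nat.split)
  have am [measurable]: "a k \<in> borel_measurable borel" for k
    by (cases k) (simp_all add: a_def[abs_def])
  define T where "T q x = (\<Sum>k. ennreal ((a k x / lam k) powr q))" for q x
  have Tm [measurable]: "T q \<in> borel_measurable borel" for q unfolding T_def[abs_def] by measurable
  have Tfin: "(\<integral>\<^sup>+x. T q x \<partial>lborel) < \<infinity>" if q: "q \<in> Q" for q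
  proof -
    have q0: "0 < q" using Q(3)[OF q] .
    have term_eq: "(\<integral>\<^sup>+x. ennreal ((a k x / lam k) powr q) \<partial>lborel) = ennreal (lam k powr (- q)) * (\<integral>\<^sup>+x. ennreal (a k x powr q) \<partial>lborel)" for k
    proof -
      have eq: "(a k x / lam k) powr q = lam k powr (- q) * a k x powr q" for x
        using lam[of k] a0[of k x] by (simp add: powr_divide powr_minus_divide)
      show ?thesis unfolding eq by (subst nn_integral_cmult[symmetric]) (simp_all add: ennreal_mult)
    qed
    have "(\<integral>\<^sup>+x. T q x \<partial>lborel) = (\<Sum>k. \<integral>\<^sup>+x. ennreal ((a k x / lam k) powr q) \<partial>lborel)"
      unfolding T_def by (rule nn_integral_suminf) measurable
    also have "\<dots> = (\<integral>\<^sup>+x. ennreal ((a 0 x / lam 0) powr q) \<partial>lborel) + (\<Sum>k. \<integral>\<^sup>+x. ennreal ((a (Suc k) x / lam (Suc k)) powr q) \<partial>lborel)"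
      by (subst suminf_offset[where i = 1]) (simp_all add: summableI)
    also have "\<dots> < \<infinity>"
    proof -
      have "(\<integral>\<^sup>+x. ennreal (a 0 x powr q) \<partial>lborel) < \<infinity>" using fin[OF q, of "r 0"] by (simp add: a_def)
      then have 1: "(\<integral>\<^sup>+x. ennreal ((a 0 x / lam 0) powr q) \<partial>lborel) < \<infinity>"
        unfolding term_eq by (simp add: ennreal_mult_less_top)
      have "(\<Sum>k. \<integral>\<^sup>+x. ennreal ((a (Suc k) x / lam (Suc k)) powr q) \<partial>lborel) \<le> ennreal (1 / (1 - 1 / 2))"
      proof (rule suminf_ennreal_le_geometric)
        fix k
        have "(\<integral>\<^sup>+x. ennreal (a (Suc k) x powr q) \<partial>lborel) \<le> ennreal (e k)"
        proof -
          have "r k \<le> r (Suc k)" using r by (simp add: strict_mono_less_eq)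
          then show ?thesis using Nf[OF q, of k "r (Suc k)" "r k"] rN[of k] by (simp add: a_def)
        qed
        then have "(\<integral>\<^sup>+x. ennreal ((a (Suc k) x / lam (Suc k)) powr q) \<partial>lborel) \<le> ennreal (lam (Suc k) powr (- q)) * ennreal (e k)"
          unfolding term_eq by (intro mult_left_mono) auto
        also have "\<dots> = ennreal (lam (Suc k) powr (- q) * e k)" using e by (simp add: ennreal_mult less_imp_le)
        also have "\<dots> \<le> ennreal (1 * (1 / 2) ^ k)"
        proof (rule ennreal_leI)
          have "lam (Suc k) powr (- q) * e k \<le> lam (Suc k) powr (- q) * ((1 / 2) ^ k * lam (Suc k) powr q)"
            by (intro mult_left_mono e_le q) simp
          also have "\<dots> = 1 * (1 / 2) ^ k" using lam[of "Suc k"] by (simp add: powr_minus)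
          finally show "lam (Suc k) powr (- q) * e k \<le> 1 * (1 / 2) ^ k" .
        qed
        finally show "(\<integral>\<^sup>+x. ennreal ((a (Suc k) x / lam (Suc k)) powr q) \<partial>lborel) \<le> ennreal (1 * (1 / 2) ^ k)" .
      qed auto
      also have "\<dots> < \<infinity>" by simp
      finally show ?thesis using 1 by simp
    qed
    finally show ?thesis .
  qed
  define H where "H x = (\<Sum>k. ennreal (a k x))" for x
  have Hm [measurable]: "H \<in> borel_measurable borel" unfolding H_def[abs_def] by measurable
  define h where "h x = enn2real (H x)" for x
  have hm: "h \<in> borel_measurable borel" unfolding h_def[abs_def] by measurable
  have scaled: "ennreal (S powr q) \<le> T q x" if "q \<in> Q" "0 \<le> S" "ennreal S \<le> H x" for S q x
    unfolding T_def using that Q(3) by (intro powr_le_suminf_scaled lam lam_sum a0) (auto simp: H_def)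
  obtain q0 where q0: "q0 \<in> Q" using Q by blast
  have "AE x in lborel. T q0 x \<noteq> \<infinity>" using Tfin[OF q0] by (intro nn_integral_PInf_AE) auto
  then have Hfin: "AE x in lborel. H x < \<infinity>"
  proof eventually_elim
    fix x assume T: "T q0 x \<noteq> \<infinity>"
    show "H x < \<infinity>"
    proof (rule ccontr)
      assume "\<not> H x < \<infinity>"
      then have "H x = top" by (simp flip: less_top)
      obtain t where t: "0 \<le> t" "T q0 x = ennreal t" using T by (cases "T q0 x") auto
      \<comment> \<open>If the sum is infinite, every \<open>S\<close> is admissible in \<open>scaled\<close>; this one contradicts the
        value \<open>t\<close>.\<close>
      have "ennreal (((t + 1) powr (1 / q0)) powr q0) \<le> T q0 x"
        using \<open>H x = top\<close> by (intro scaled q0) auto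
      then have "t + 1 \<le> t" using t Q(3)[OF q0] by (simp add: powr_powr)
      then show False by simp
    qed
  qed
  have H_eq: "H x = ennreal (h x)" if "H x < \<infinity>" for x using that by (simp add: h_def less_top)
  have le_h: "cmod (u (r n) x) \<le> h x" if "H x < \<infinity>" for n x
  proof -
    have "cmod (u (r n) x) \<le> (\<Sum>k\<le>n. a k x)"
    proof (induction n)
      case (Suc n)
      have "cmod (u (r (Suc n)) x) \<le> cmod (u (r n) x) + a (Suc n) x"
        unfolding a_def by simp (metis norm_triangle_sub)
      then show ?case using Suc by simp
    qed (simp add: a_def)
    then have "ennreal (cmod (u (r n) x)) \<le> (\<Sum>k\<le>n. ennreal (a k x))"
      by (simp add: sum_ennreal a0 ennreal_leI)
    also have "\<dots> \<le> H x" unfolding H_def by (rule sum_le_suminf) auto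
    finally show ?thesis unfolding H_eq[OF that] by (simp add: h_def)
  qed
  define w where "w x = lim (\<lambda>n. u (r n) x)" for x
  have wm: "w \<in> borel_measurable borel" unfolding w_def[abs_def] by measurable
  have conv: "(\<lambda>n. u (r n) x) \<longlonglongrightarrow> w x" if "H x < \<infinity>" for x
  proof -
    have "summable (\<lambda>k. a k x)" using that unfolding H_def by (intro summable_suminf_not_top a0) (simp add: less_top)
    then have "summable (\<lambda>k. a (Suc k) x)" using summable_Suc_iff[of "\<lambda>k. a k x"] by simp
    then have "summable (\<lambda>k. u (r (Suc k)) x - u (r k) x)"
      by (intro summable_norm_cancel[of "\<lambda>k. u (r (Suc k)) x - u (r k) x"]) (simp add: a_def)
    then have "convergent (\<lambda>n. \<Sum>k<n. u (r (Suc k)) x - u (r k) x)" by (simp add: summable_iff_convergent)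
    then have "convergent (\<lambda>n. u (r n) x - u (r 0) x)" using sum_lessThan_telescope[of "\<lambda>k. u (r k) x"] by simp
    then have "convergent (\<lambda>n. (u (r n) x - u (r 0) x) + u (r 0) x)" by (intro convergent_add convergent_const)
    then show ?thesis by (simp add: w_def convergent_LIMSEQ_iff)
  qed
  show thesis
  proof (rule that[OF r wm hm])
    show "0 \<le> h x" for x by (simp add: h_def)
    show "AE x in lborel. (\<lambda>n. u (r n) x) \<longlonglongrightarrow> w x" using Hfin by eventually_elim (rule conv)
    show "AE x in lborel. \<forall>n. cmod (u (r n) x) \<le> h x" using Hfin by eventually_elim (simp add: le_h)
    show "(\<integral>\<^sup>+x. ennreal (h x powr q) \<partial>lborel) < \<infinity>" if q: "q \<in> Q" for q
    proof -
      have "(\<integral>\<^sup>+x. ennreal (h x powr q) \<partial>lborel) \<le> (\<integral>\<^sup>+x. T q x \<partial>lborel)"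
        using Hfin
      proof (intro nn_integral_mono_AE, eventually_elim)
        fix x assume "H x < \<infinity>"
        then have "ennreal (h x) \<le> H x" using H_eq[of x] by (simp only: order_refl)
        then show "ennreal (h x powr q) \<le> T q x" by (intro scaled q) (simp add: h_def)
      qed
      then show ?thesis using Tfin[OF q] by (rule order_le_less_trans)
    qed
  qed
qed

section \<open>Finiteness of the Choquard energy\<close>

lemma nn_integral_lborel_translate:
  fixes f :: "R3 \<Rightarrow> ennreal"
  assumes [measurable]: "f \<in> borel_measurable borel"
  shows "(\<integral>\<^sup>+y. f (y - x) \<partial>lborel) = (\<integral>\<^sup>+y. f y \<partial>lborel)"
    and "(\<integral>\<^sup>+y. f (x - y) \<partial>lborel) = (\<integral>\<^sup>+y. f y \<partial>lborel)"
proof -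
  have 1: "lborel = distr lborel borel (\<lambda>y. - x + 1 *\<^sub>R y)"
    using lborel_affine[of 1 "- x"] by (simp add: density_1)
  have "(\<integral>\<^sup>+y. f y \<partial>lborel) = (\<integral>\<^sup>+y. f (- x + 1 *\<^sub>R y) \<partial>lborel)"
    by (subst 1, subst nn_integral_distr) simp_all
  then show "(\<integral>\<^sup>+y. f (y - x) \<partial>lborel) = (\<integral>\<^sup>+y. f y \<partial>lborel)" by simp
  have 2: "lborel = distr lborel borel (\<lambda>y. x + (-1) *\<^sub>R y)"
    using lborel_affine[of "-1" x] by (simp add: density_1)
  have "(\<integral>\<^sup>+y. f y \<partial>lborel) = (\<integral>\<^sup>+y. f (x + (-1) *\<^sub>R y) \<partial>lborel)"
    by (subst 2, subst nn_integral_distr) simp_all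
  then show "(\<integral>\<^sup>+y. f (x - y) \<partial>lborel) = (\<integral>\<^sup>+y. f y \<partial>lborel)" by simp
qed

lemma dyadic_bracket:
  fixes t :: real assumes "1 \<le> t"
  obtains k where "2 ^ k \<le> t" "t < 2 ^ Suc k"
proof -
  define n where "n = (LEAST n. t < 2 ^ n)"
  have ex: "\<exists>n. t < 2 ^ n" using real_arch_pow[of 2 t] by simp
  have n: "t < 2 ^ n" unfolding n_def using ex by (rule LeastI_ex)
  with assms have "n \<noteq> 0" by (intro notI) simp
  then obtain k where k: "n = Suc k" by (cases n) auto
  have "\<not> t < 2 ^ k" using not_less_Least[of k "\<lambda>n. t < 2 ^ n"] k by (simp add: n_def)
  then show thesis using that[of k] n k by simp
qed

lemma cball_borel [measurable]: "cball (c :: R3) r \<in> sets borel"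
  by (rule borel_closed) (rule closed_cball)

lemma emeasure_cball_R3: "0 \<le> r \<Longrightarrow> emeasure lborel (cball (c :: R3) r) = ennreal (unit_ball_vol 3 * r ^ 3)"
  using emeasure_cball[of r c] by simp

text \<open>Dyadic shells around the origin take the place of polar coordinates: \<open>f\<close> is dominated by a
  sum of constants \<open>c k\<close> on balls of radius \<open>\<rho> k\<close>, whose integrals form a geometric series.\<close>
lemma nn_integral_shells_finite:
  fixes f :: "R3 \<Rightarrow> ennreal"
  assumes f: "\<And>x. f x \<noteq> 0 \<Longrightarrow> \<exists>k. f x \<le> ennreal (c k) \<and> norm x \<le> \<rho> k"
    and \<rho>: "\<And>k. 0 \<le> \<rho> k" and c: "\<And>k. 0 \<le> c k" and geo: "\<And>k. c k * \<rho> k ^ 3 = K * r ^ k" and r: "0 \<le> r" "r < 1"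
  shows "(\<integral>\<^sup>+x. f x \<partial>lborel) < \<infinity>"
proof -
  let ?g = "\<lambda>k x. ennreal (c k) * indicator (cball 0 (\<rho> k)) (x :: R3)"
  have "0 \<le> c 0 * \<rho> 0 ^ 3" using \<rho>[of 0] c[of 0] by simp
  then have K: "0 \<le> K" using geo[of 0] by simp
  have "(\<integral>\<^sup>+x. f x \<partial>lborel) \<le> (\<integral>\<^sup>+x. (\<Sum>k. ?g k x) \<partial>lborel)"
  proof (rule nn_integral_mono)
    fix x
    show "f x \<le> (\<Sum>k. ?g k x)"
    proof (cases "f x = 0")
      case False
      then obtain k where "f x \<le> ennreal (c k)" "norm x \<le> \<rho> k" using f by blast
      then have "f x \<le> ?g k x" by simp
      also have "\<dots> \<le> (\<Sum>k. ?g k x)" by (rule term_le_suminf_ennreal)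
      finally show ?thesis .
    qed simp
  qed
  also have "\<dots> = (\<Sum>k. \<integral>\<^sup>+x. ?g k x \<partial>lborel)" by (rule nn_integral_suminf) measurable
  also have "\<dots> \<le> ennreal ((unit_ball_vol 3 * K) / (1 - r))"
  proof (rule suminf_ennreal_le_geometric)
    fix k
    have "(\<integral>\<^sup>+x. ?g k x \<partial>lborel) = ennreal (c k) * ennreal (unit_ball_vol 3 * \<rho> k ^ 3)"
      using \<rho> by (subst nn_integral_cmult_indicator) (simp_all add: emeasure_cball_R3)
    also have "\<dots> = ennreal (unit_ball_vol 3 * (c k * \<rho> k ^ 3))"
      using \<rho> c by (simp add: ennreal_mult[symmetric] mult_ac)
    finally show "(\<integral>\<^sup>+x. ?g k x \<partial>lborel) \<le> ennreal (unit_ball_vol 3 * K * r ^ k)"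
      unfolding geo by (simp add: mult.assoc)
  qed (use r K in auto)
  also have "\<dots> < \<infinity>" by simp
  finally show ?thesis .
qed

lemma scaled_powr_cubed:
  fixes \<rho> :: real
  assumes "0 < \<rho>" "0 < d"
  shows "(\<rho> * d ^ k) powr - \<beta> * (\<rho>' * d ^ k) ^ 3 = \<rho> powr - \<beta> * \<rho>' ^ 3 * (d powr (3 - \<beta>)) ^ k"
proof -
  have 1: "(d ^ k) powr - \<beta> * (d ^ k) ^ 3 = (d powr (3 - \<beta>)) ^ k"
  proof -
    have "(d ^ k) powr - \<beta> * (d ^ k) ^ 3 = (d ^ k) powr - \<beta> * (d ^ k) powr 3" using assms by simp
    also have "\<dots> = (d powr real k) powr (3 - \<beta>)" unfolding powr_add[symmetric] using assms by (simp add: powr_realpow)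
    also have "\<dots> = (d powr (3 - \<beta>)) powr real k" by (simp only: powr_powr mult.commute)
    finally show ?thesis using assms by (simp add: powr_realpow)
  qed
  have "(\<rho> * d ^ k) powr - \<beta> * (\<rho>' * d ^ k) ^ 3 = \<rho> powr - \<beta> * \<rho>' ^ 3 * ((d ^ k) powr - \<beta> * (d ^ k) ^ 3)"
    using assms by (simp add: powr_mult power_mult_distrib)
  then show ?thesis unfolding 1 .
qed

lemma norm_powr_integrable_near_0:
  fixes \<beta> \<rho> :: real
  assumes \<beta>: "0 \<le> \<beta>" "\<beta> < 3" and \<rho>: "0 < \<rho>"
  shows "(\<integral>\<^sup>+x\<in>cball 0 \<rho>. ennreal (norm (x :: R3) powr - \<beta>) \<partial>lborel) < \<infinity>"
proof (rule nn_integral_shells_finite)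
  fix x :: R3
  assume "ennreal (norm x powr - \<beta>) * indicator (cball 0 \<rho>) x \<noteq> 0"
  then have x: "0 < norm x" "norm x \<le> \<rho>" by (auto simp: indicator_def split: if_splits)
  then obtain k where k: "2 ^ k \<le> \<rho> / norm x" "\<rho> / norm x < 2 ^ Suc k"
    using dyadic_bracket[of "\<rho> / norm x"] by auto
  have 1: "norm x \<le> \<rho> * (1 / 2) ^ k" "\<rho> / 2 * (1 / 2) ^ k \<le> norm x"
    using k x by (simp_all add: field_simps power_divide)
  have "norm x powr - \<beta> \<le> (\<rho> / 2 * (1 / 2) ^ k) powr - \<beta>"
    using \<rho> \<beta> by (intro powr_mono2' 1) auto
  then show "\<exists>k. ennreal (norm x powr - \<beta>) * indicator (cball 0 \<rho>) x \<le> ennreal ((\<rho> / 2 * (1 / 2) ^ k) powr - \<beta>) \<and> norm x \<le> \<rho> * (1 / 2) ^ k"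
    using x 1 by (intro exI[of _ k]) (simp add: ennreal_leI)
next
  show "(\<rho> / 2 * (1 / 2) ^ k) powr - \<beta> * (\<rho> * (1 / 2) ^ k) ^ 3 = (\<rho> / 2) powr - \<beta> * \<rho> ^ 3 * ((1 / 2) powr (3 - \<beta>)) ^ k" for k
    using \<rho> by (intro scaled_powr_cubed) auto
  show "(1 / 2) powr (3 - \<beta>) < (1::real)" using powr_less_mono2[of "3 - \<beta>" "1 / 2" 1] \<beta> by simp
qed (use \<rho> in auto)

lemma norm_powr_integrable_at_infinity:
  fixes \<beta> \<rho> :: real
  assumes \<beta>: "3 < \<beta>" and \<rho>: "0 < \<rho>"
  shows "(\<integral>\<^sup>+x\<in>- cball 0 \<rho>. ennreal (norm (x :: R3) powr - \<beta>) \<partial>lborel) < \<infinity>"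
proof (rule nn_integral_shells_finite)
  fix x :: R3
  assume "ennreal (norm x powr - \<beta>) * indicator (- cball 0 \<rho>) x \<noteq> 0"
  then have x: "\<rho> < norm x" by (auto simp: indicator_def split: if_splits)
  then obtain k where k: "2 ^ k \<le> norm x / \<rho>" "norm x / \<rho> < 2 ^ Suc k"
    using dyadic_bracket[of "norm x / \<rho>"] \<rho> by auto
  have 1: "\<rho> * 2 ^ k \<le> norm x" "norm x \<le> 2 * \<rho> * 2 ^ k"
    using k \<rho> by (simp_all add: field_simps)
  have "norm x powr - \<beta> \<le> (\<rho> * 2 ^ k) powr - \<beta>"
    using \<rho> \<beta> by (intro powr_mono2' 1) auto
  then show "\<exists>k. ennreal (norm x powr - \<beta>) * indicator (- cball 0 \<rho>) x \<le> ennreal ((\<rho> * 2 ^ k) powr - \<beta>) \<and> norm x \<le> 2 * \<rho> * 2 ^ k"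
    using x 1 by (intro exI[of _ k]) (simp add: ennreal_leI)
next
  show "(\<rho> * 2 ^ k) powr - \<beta> * (2 * \<rho> * 2 ^ k) ^ 3 = \<rho> powr - \<beta> * (2 * \<rho>) ^ 3 * (2 powr (3 - \<beta>)) ^ k" for k
    using \<rho> by (intro scaled_powr_cubed) auto
  show "2 powr (3 - \<beta>) < (1::real)" using \<beta> by (simp add: powr_less_one)
qed (use \<rho> in auto)

text \<open>Tonelli for a product of a function of one variable and a function of the difference, by
  translation invariance.\<close>
lemma nn_integral_convolution:
  fixes f k :: "R3 \<Rightarrow> ennreal"
  assumes [measurable]: "f \<in> borel_measurable borel" "k \<in> borel_measurable borel"
  shows "(\<integral>\<^sup>+x. (\<integral>\<^sup>+y. f x * k (x - y) \<partial>lborel) \<partial>lborel) = (\<integral>\<^sup>+x. f x \<partial>lborel) * (\<integral>\<^sup>+x. k x \<partial>lborel)"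
    and "(\<integral>\<^sup>+x. (\<integral>\<^sup>+y. f y * k (x - y) \<partial>lborel) \<partial>lborel) = (\<integral>\<^sup>+x. f x \<partial>lborel) * (\<integral>\<^sup>+x. k x \<partial>lborel)"
proof -
  show "(\<integral>\<^sup>+x. (\<integral>\<^sup>+y. f x * k (x - y) \<partial>lborel) \<partial>lborel) = (\<integral>\<^sup>+x. f x \<partial>lborel) * (\<integral>\<^sup>+x. k x \<partial>lborel)"
    by (simp add: nn_integral_cmult nn_integral_lborel_translate nn_integral_multc)
  have "(\<integral>\<^sup>+x. (\<integral>\<^sup>+y. f y * k (x - y) \<partial>lborel) \<partial>lborel) = (\<integral>\<^sup>+y. (\<integral>\<^sup>+x. f y * k (x - y) \<partial>lborel) \<partial>lborel)"
    by (rule lborel_pair.Fubini') measurable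
  then show "(\<integral>\<^sup>+x. (\<integral>\<^sup>+y. f y * k (x - y) \<partial>lborel) \<partial>lborel) = (\<integral>\<^sup>+x. f x \<partial>lborel) * (\<integral>\<^sup>+x. k x \<partial>lborel)"
    by (simp add: nn_integral_cmult nn_integral_lborel_translate nn_integral_multc)
qed

text \<open>With \<open>a\<close>, \<open>b\<close>, \<open>c\<close> denoting the powers of \<open>x\<close>, \<open>y\<close>, \<open>k\<close> on the right, the left side is a
  weighted geometric mean of \<open>a b\<close>, \<open>a c\<close> and \<open>b c\<close> with weights \<open>1 - \<tau>\<close>, \<open>\<tau> / 2\<close>, \<open>\<tau> / 2\<close>, and
  hence at most their sum.\<close>
lemma young_pointwise:
  fixes x y k \<tau> :: real
  assumes "0 \<le> x" "0 \<le> y" "0 \<le> k" and \<tau>: "0 < \<tau>" "\<tau> \<le> 1"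
  defines "r \<equiv> 2 / (2 - \<tau>)"
  shows "x * y * k \<le> x powr r * y powr r + x powr r * k powr (1 / \<tau>) + y powr r * k powr (1 / \<tau>)"
proof (cases "x = 0 \<or> y = 0 \<or> k = 0")
  case False
  then have pos: "0 < x" "0 < y" "0 < k" using assms by auto
  define a b c where "a = x powr r" and "b = y powr r" and "c = k powr (1 / \<tau>)"
  have abc: "0 < a" "0 < b" "0 < c" using pos by (simp_all add: a_def b_def c_def)
  define M where "M = a * b + a * c + b * c"
  have M: "a * b \<le> M" "a * c \<le> M" "b * c \<le> M" "0 < M" using abc by (simp_all add: M_def add_pos_pos)
  have "(a * b) powr (1 - \<tau>) * ((a * c) powr (\<tau> / 2) * (b * c) powr (\<tau> / 2)) \<le> M powr (1 - \<tau>) * (M powr (\<tau> / 2) * M powr (\<tau> / 2))"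
    using M abc \<tau> by (intro mult_mono powr_mono2) auto
  also have "\<dots> = M powr ((1 - \<tau>) + (\<tau> / 2 + \<tau> / 2))" by (simp only: powr_add)
  also have "\<dots> = M" using M by simp
  finally have 1: "(a * b) powr (1 - \<tau>) * ((a * c) powr (\<tau> / 2) * (b * c) powr (\<tau> / 2)) \<le> M" .
  have "(a * b) powr (1 - \<tau>) * ((a * c) powr (\<tau> / 2) * (b * c) powr (\<tau> / 2))
     = a powr ((1 - \<tau>) + \<tau> / 2) * b powr ((1 - \<tau>) + \<tau> / 2) * c powr (\<tau> / 2 + \<tau> / 2)"
    using abc by (simp only: powr_add powr_mult less_imp_le) (simp only: mult_ac)
  also have "a powr ((1 - \<tau>) + \<tau> / 2) = x"
  proof -
    have "r * ((1 - \<tau>) + \<tau> / 2) = 1" using \<tau> by (simp add: r_def field_simps)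
    then show ?thesis using pos by (simp add: a_def powr_powr)
  qed
  also have "b powr ((1 - \<tau>) + \<tau> / 2) = y"
  proof -
    have "r * ((1 - \<tau>) + \<tau> / 2) = 1" using \<tau> by (simp add: r_def field_simps)
    then show ?thesis using pos by (simp add: b_def powr_powr)
  qed
  also have "c powr (\<tau> / 2 + \<tau> / 2) = k" using \<tau> pos by (simp add: c_def powr_powr)
  finally show ?thesis using 1 by (simp add: M_def a_def b_def c_def)
qed (use assms in auto)

text \<open>Young's convolution inequality, reduced to the finiteness of the left side. The exponents
  are \<open>r = 2 / (2 - \<tau>)\<close> for \<open>f\<close> and \<open>1 / \<tau>\<close> for the kernel.\<close>
lemma young_integral_finite:
  fixes f k :: "R3 \<Rightarrow> real"
  assumes [measurable]: "f \<in> borel_measurable borel" "k \<in> borel_measurable borel"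
    and f: "\<And>x. 0 \<le> f x" and k: "\<And>x. 0 \<le> k x" and \<tau>: "0 < \<tau>" "\<tau> \<le> 1"
    and fin: "(\<integral>\<^sup>+x. ennreal (f x powr (2 / (2 - \<tau>))) \<partial>lborel) < \<infinity>" "(\<integral>\<^sup>+x. ennreal (k x powr (1 / \<tau>)) \<partial>lborel) < \<infinity>"
  shows "(\<integral>\<^sup>+x. (\<integral>\<^sup>+y. ennreal (f x * f y * k (x - y)) \<partial>lborel) \<partial>lborel) < \<infinity>"
proof -
  let ?r = "2 / (2 - \<tau>)"
  define F K where "F x = ennreal (f x powr ?r)" and "K x = ennreal (k x powr (1 / \<tau>))" for x
  have FK [measurable]: "F \<in> borel_measurable borel" "K \<in> borel_measurable borel"
    unfolding F_def[abs_def] K_def[abs_def] by measurable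
  have "(\<integral>\<^sup>+x. (\<integral>\<^sup>+y. ennreal (f x * f y * k (x - y)) \<partial>lborel) \<partial>lborel)
     \<le> (\<integral>\<^sup>+x. (\<integral>\<^sup>+y. F x * F y + F x * K (x - y) + F y * K (x - y) \<partial>lborel) \<partial>lborel)"
  proof (intro nn_integral_mono)
    fix x y
    have "ennreal (f x * f y * k (x - y)) \<le> ennreal (f x powr ?r * f y powr ?r + f x powr ?r * k (x - y) powr (1 / \<tau>) + f y powr ?r * k (x - y) powr (1 / \<tau>))"
      by (intro ennreal_leI young_pointwise f k \<tau>)
    then show "ennreal (f x * f y * k (x - y)) \<le> F x * F y + F x * K (x - y) + F y * K (x - y)"
      by (simp add: F_def K_def ennreal_mult ennreal_plus)
  qed
  also have "\<dots> = (\<integral>\<^sup>+x. (\<integral>\<^sup>+y. F x * F y \<partial>lborel) \<partial>lborel) + (\<integral>\<^sup>+x. (\<integral>\<^sup>+y. F x * K (x - y) \<partial>lborel) \<partial>lborel)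
      + (\<integral>\<^sup>+x. (\<integral>\<^sup>+y. F y * K (x - y) \<partial>lborel) \<partial>lborel)"
    by (simp add: nn_integral_add)
  also have "\<dots> < \<infinity>"
    unfolding nn_integral_convolution[OF FK]
    using fin by (simp add: nn_integral_cmult nn_integral_multc ennreal_mult_less_top flip: F_def K_def)
  finally show ?thesis .
qed

definition riesz_const :: "real \<Rightarrow> real" where
  "riesz_const \<alpha> = pi powr (3 / 2) * 2 powr \<alpha> * (Gamma (\<alpha> / 2) / Gamma ((3 - \<alpha>) / 2))"

lemma riesz_const_pos: "0 < \<alpha> \<Longrightarrow> \<alpha> < 3 \<Longrightarrow> 0 < riesz_const \<alpha>"
  unfolding riesz_const_def by (intro mult_pos_pos divide_pos_pos Gamma_real_pos) auto

lemma riesz_potential_eq: "riesz_potential \<alpha> x = riesz_const \<alpha> * norm x powr - (3 - \<alpha>)"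
  by (simp add: riesz_potential_def riesz_const_def powr_minus_divide[of _ "3 - \<alpha>", simplified])

lemma riesz_potential_borel [measurable]: "riesz_potential \<alpha> \<in> borel_measurable borel"
  unfolding riesz_potential_def[abs_def] by measurable

lemma choquard_energy_lborel:
  "choquard_energy \<alpha> p u = (\<integral>\<^sup>+x. (\<integral>\<^sup>+y. ennreal (riesz_potential \<alpha> (x - y)) * ennreal (cmod (u y) powr p) \<partial>lborel)
       * ennreal (cmod (u x) powr p) \<partial>lborel)"
  by (simp add: choquard_energy_def nn_integral_completion)

lemma choquard_energy_cong_AE:
  assumes "AE x in lborel. u x = v x"
  shows "choquard_energy \<alpha> p u = choquard_energy \<alpha> p v"
proof -
  have "(\<integral>\<^sup>+y. ennreal (riesz_potential \<alpha> (x - y)) * ennreal (cmod (u y) powr p) \<partial>lborel)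
      = (\<integral>\<^sup>+y. ennreal (riesz_potential \<alpha> (x - y)) * ennreal (cmod (v y) powr p) \<partial>lborel)" for x
    using assms by (intro nn_integral_cong_AE, eventually_elim) simp
  then have eq: "choquard_energy \<alpha> p u = (\<integral>\<^sup>+x. (\<integral>\<^sup>+y. ennreal (riesz_potential \<alpha> (x - y)) * ennreal (cmod (v y) powr p) \<partial>lborel)
       * ennreal (cmod (u x) powr p) \<partial>lborel)"
    by (simp add: choquard_energy_lborel)
  show ?thesis unfolding eq choquard_energy_lborel[of \<alpha> p v]
    using assms by (intro nn_integral_cong_AE, eventually_elim) simp
qed

lemma choquard_energy_pair:
  assumes [measurable]: "u \<in> borel_measurable borel"
  shows "choquard_energy \<alpha> p u = (\<integral>\<^sup>+z. ennreal (riesz_potential \<alpha> (fst z - snd z)) * ennreal (cmod (u (snd z)) powr p)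
      * ennreal (cmod (u (fst z)) powr p) \<partial>(lborel \<Otimes>\<^sub>M lborel))"
proof -
  have "choquard_energy \<alpha> p u = (\<integral>\<^sup>+x. (\<integral>\<^sup>+y. (\<lambda>z. ennreal (riesz_potential \<alpha> (fst z - snd z)) * ennreal (cmod (u (snd z)) powr p)
      * ennreal (cmod (u (fst z)) powr p)) (x, y) \<partial>lborel) \<partial>lborel)"
    unfolding choquard_energy_lborel by (intro nn_integral_cong) (simp add: nn_integral_multc)
  also have "\<dots> = (\<integral>\<^sup>+z. ennreal (riesz_potential \<alpha> (fst z - snd z)) * ennreal (cmod (u (snd z)) powr p)
      * ennreal (cmod (u (fst z)) powr p) \<partial>(lborel \<Otimes>\<^sub>M lborel))"
    by (rule lborel.nn_integral_fst) measurable
  finally show ?thesis .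
qed

text \<open>The kernel \<open>\<bar>x\<bar>\<close> to the power \<open>\<alpha> - 3\<close> lies in no \<open>L\<^sup>t\<close>: near the origin one needs
  \<open>t < 3 / (3 - \<alpha>)\<close>, at infinity \<open>t > 3 / (3 - \<alpha>)\<close>. Cut at radius \<open>1\<close>, both parts are admissible
  in Young's inequality with \<open>t\<close> as close to \<open>3 / (3 - \<alpha>)\<close> as desired. The resulting exponents
  of \<open>u\<close> are close to \<open>6 p / (3 + \<alpha>)\<close>, which lies strictly between \<open>2\<close> and \<open>6 / (3 - 2 s)\<close>.\<close>
lemma choquard_energy_finite:
  fixes s \<alpha> p :: real
  assumes s: "0 < s" "s < 1" and \<alpha>: "0 < \<alpha>" "\<alpha> < 3" and p: "1 + \<alpha> / 3 < p" "p < (3 + \<alpha>) / (3 - 2 * s)"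
  obtains q1 q2 where "2 < q1" "q1 < 6 / (3 - 2 * s)" "2 < q2" "q2 < 6 / (3 - 2 * s)"
    "\<And>u. u \<in> borel_measurable borel \<Longrightarrow> powr_mass q1 u < \<infinity> \<Longrightarrow>
      powr_mass q2 u < \<infinity> \<Longrightarrow> choquard_energy \<alpha> p u < \<infinity>"
proof -
  \<comment> \<open>With \<open>\<tau> = 1 / t\<close> the exponent of \<open>u\<close> is \<open>2 p / (2 - \<tau>)\<close>; it exceeds \<open>2\<close> for \<open>\<tau> > 2 - p\<close> and
    is subcritical for \<open>\<tau> < tp\<close>. The critical value is \<open>\<tau>0\<close>.\<close>
  define \<tau>0 where "\<tau>0 = (3 - \<alpha>) / 3"
  define tp where "tp = 2 - p * (3 - 2 * s) / 3"
  have \<tau>0: "0 < \<tau>0" "\<tau>0 < 1" "\<tau>0 < tp" "2 - p < \<tau>0"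
  proof -
    have "p * (3 - 2 * s) < 3 + \<alpha>" using s p by (simp add: field_simps)
    then show "\<tau>0 < tp" by (simp add: \<tau>0_def tp_def field_simps)
  qed (use \<alpha> p in \<open>auto simp: \<tau>0_def field_simps\<close>)
  obtain \<tau>1 where \<tau>1: "\<tau>0 < \<tau>1" "\<tau>1 < min 1 tp" using dense[of \<tau>0 "min 1 tp"] \<tau>0 by auto
  obtain \<tau>2 where \<tau>2: "max 0 (2 - p) < \<tau>2" "\<tau>2 < \<tau>0" using dense[of "max 0 (2 - p)" \<tau>0] \<tau>0 by auto
  have range: "2 < p * (2 / (2 - \<tau>))" "p * (2 / (2 - \<tau>)) < 6 / (3 - 2 * s)" if "2 - p < \<tau>" "\<tau> < min 1 tp" for \<tau>
  proof -
    have "\<tau> < 1" "\<tau> < tp" using that by auto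
    then show "2 < p * (2 / (2 - \<tau>))" using that by (simp add: field_simps)
    have "p * (3 - 2 * s) < 3 * (2 - \<tau>)" using \<open>\<tau> < tp\<close> by (simp add: tp_def field_simps)
    then show "p * (2 / (2 - \<tau>)) < 6 / (3 - 2 * s)" using \<open>\<tau> < 1\<close> s by (simp add: field_simps)
  qed
  define k1 k2 :: "R3 \<Rightarrow> real" where "k1 x = norm x powr - (3 - \<alpha>) * indicator (cball 0 1) x"
    and "k2 x = norm x powr - (3 - \<alpha>) * indicator (- cball 0 1) x" for x
  have km [measurable]: "k1 \<in> borel_measurable borel" "k2 \<in> borel_measurable borel"
    unfolding k1_def[abs_def] k2_def[abs_def] by measurable
  have k0: "0 \<le> k1 x" "0 \<le> k2 x" for x by (simp_all add: k1_def k2_def)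
  have fin1: "(\<integral>\<^sup>+x. ennreal (k1 x powr (1 / \<tau>1)) \<partial>lborel) < \<infinity>"
  proof -
    have "(\<integral>\<^sup>+x. ennreal (k1 x powr (1 / \<tau>1)) \<partial>lborel) = (\<integral>\<^sup>+x\<in>cball 0 1. ennreal (norm (x :: R3) powr - ((3 - \<alpha>) / \<tau>1)) \<partial>lborel)"
      by (intro nn_integral_cong) (simp add: k1_def indicator_def powr_powr minus_divide_left[of "3 - \<alpha>"] del: minus_divide_left[symmetric])
    also have "\<dots> < \<infinity>"
      using \<tau>1 \<tau>0 \<alpha> by (intro norm_powr_integrable_near_0) (auto simp: \<tau>0_def field_simps)
    finally show ?thesis .
  qed
  have fin2: "(\<integral>\<^sup>+x. ennreal (k2 x powr (1 / \<tau>2)) \<partial>lborel) < \<infinity>"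
  proof -
    have "(\<integral>\<^sup>+x. ennreal (k2 x powr (1 / \<tau>2)) \<partial>lborel) = (\<integral>\<^sup>+x\<in>- cball 0 1. ennreal (norm (x :: R3) powr - ((3 - \<alpha>) / \<tau>2)) \<partial>lborel)"
      by (intro nn_integral_cong) (simp add: k2_def indicator_def powr_powr minus_divide_left[of "3 - \<alpha>"] del: minus_divide_left[symmetric])
    also have "\<dots> < \<infinity>"
      using \<tau>2 \<tau>0 \<alpha> by (intro norm_powr_integrable_at_infinity) (auto simp: \<tau>0_def field_simps)
    finally show ?thesis .
  qed
  show thesis
  proof (rule that[of "p * (2 / (2 - \<tau>1))" "p * (2 / (2 - \<tau>2))"])
    fix u :: "R3 \<Rightarrow> complex" assume [measurable]: "u \<in> borel_measurable borel"
      and u1: "(\<integral>\<^sup>+x. ennreal (cmod (u x) powr (p * (2 / (2 - \<tau>1)))) \<partial>lborel) < \<infinity>"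
      and u2: "(\<integral>\<^sup>+x. ennreal (cmod (u x) powr (p * (2 / (2 - \<tau>2)))) \<partial>lborel) < \<infinity>"
    define f where "f x = cmod (u x) powr p" for x
    have [measurable]: "f \<in> borel_measurable borel" unfolding f_def[abs_def] by measurable
    have f0: "0 \<le> f x" for x by (simp add: f_def)
    let ?Y = "\<lambda>k. \<integral>\<^sup>+x. (\<integral>\<^sup>+y. ennreal (f x * f y * k (x - y)) \<partial>lborel) \<partial>lborel"
    have Y1: "?Y k1 < \<infinity>"
      using \<tau>1 \<tau>0 by (intro young_integral_finite[of f k1 \<tau>1] f0 k0 fin1) (use u1 in \<open>auto simp: f_def powr_powr\<close>)
    have Y2: "?Y k2 < \<infinity>"
      using \<tau>2 \<tau>0 by (intro young_integral_finite[of f k2 \<tau>2] f0 k0 fin2) (use u2 in \<open>auto simp: f_def powr_powr\<close>)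
    have "choquard_energy \<alpha> p u = (\<integral>\<^sup>+x. (\<integral>\<^sup>+y. ennreal (riesz_const \<alpha>) * (ennreal (f x * f y * k1 (x - y)) + ennreal (f x * f y * k2 (x - y))) \<partial>lborel) \<partial>lborel)"
      unfolding choquard_energy_lborel
    proof (intro nn_integral_cong)
      fix x
      have "(\<integral>\<^sup>+y. ennreal (riesz_potential \<alpha> (x - y)) * ennreal (cmod (u y) powr p) \<partial>lborel) * ennreal (cmod (u x) powr p)
         = (\<integral>\<^sup>+y. ennreal (riesz_potential \<alpha> (x - y)) * ennreal (cmod (u y) powr p) * ennreal (cmod (u x) powr p) \<partial>lborel)"
        by (rule nn_integral_multc[symmetric]) measurable
      also have "\<dots> = (\<integral>\<^sup>+y. ennreal (riesz_const \<alpha>) * (ennreal (f x * f y * k1 (x - y)) + ennreal (f x * f y * k2 (x - y))) \<partial>lborel)"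
      proof (intro nn_integral_cong)
        fix y
        have "riesz_potential \<alpha> (x - y) * f y * f x = riesz_const \<alpha> * (f x * f y * k1 (x - y) + f x * f y * k2 (x - y))"
          by (simp add: riesz_potential_eq k1_def k2_def indicator_def)
        then have "ennreal (riesz_potential \<alpha> (x - y) * f y * f x) = ennreal (riesz_const \<alpha> * (f x * f y * k1 (x - y) + f x * f y * k2 (x - y)))"
          by simp
        moreover have "0 \<le> riesz_potential \<alpha> (x - y)" using riesz_const_pos[OF \<alpha>] by (simp add: riesz_potential_eq)
        ultimately show "ennreal (riesz_potential \<alpha> (x - y)) * ennreal (cmod (u y) powr p) * ennreal (cmod (u x) powr p)
          = ennreal (riesz_const \<alpha>) * (ennreal (f x * f y * k1 (x - y)) + ennreal (f x * f y * k2 (x - y)))"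
          using riesz_const_pos[OF \<alpha>] f0 k0 by (simp add: ennreal_mult'' ennreal_plus f_def[symmetric])
      qed
      finally show "(\<integral>\<^sup>+y. ennreal (riesz_potential \<alpha> (x - y)) * ennreal (cmod (u y) powr p) \<partial>lborel) * ennreal (cmod (u x) powr p)
        = (\<integral>\<^sup>+y. ennreal (riesz_const \<alpha>) * (ennreal (f x * f y * k1 (x - y)) + ennreal (f x * f y * k2 (x - y))) \<partial>lborel)" .
    qed
    also have "\<dots> = ennreal (riesz_const \<alpha>) * (?Y k1 + ?Y k2)"
      by (simp add: nn_integral_cmult nn_integral_add)
    also have "\<dots> < \<infinity>" using Y1 Y2 by (simp add: ennreal_mult_less_top)
    finally show "choquard_energy \<alpha> p u < \<infinity>" .
  qed (use range[of \<tau>1] range[of \<tau>2] \<tau>0 \<tau>1 \<tau>2 in auto)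
qed

section \<open>The Bessel kernel and Borel representatives\<close>

lemma powr_mult_exp_neg_le:
  fixes z c :: real assumes "0 < z" "0 < c"
  shows "z powr c * exp (- z) \<le> c powr c"
proof -
  have "z / c \<le> exp (z / c)" using exp_ge_add_one_self[of "z / c"] by linarith
  then have "(z / c) powr c \<le> exp (z / c) powr c" using assms by (intro powr_mono2) auto
  also have "\<dots> = exp z" using assms by (simp add: powr_def)
  finally show ?thesis using assms by (simp add: powr_divide exp_minus field_simps)
qed

definition bessel_integrand :: "real \<Rightarrow> real \<Rightarrow> real \<Rightarrow> real" where
  "bessel_integrand \<nu> \<zeta> t = exp (- \<zeta>\<^sup>2 / (4 * t) - t) * t powr (- 1 - \<nu>)"

text \<open>For \<open>t \<le> \<zeta>\<^sup>2\<close> the factor \<open>exp (- \<zeta>\<^sup>2 / (4 t))\<close> compensates the singular power of \<open>t\<close>, so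
  that the integrand is bounded; for larger \<open>t\<close> the power alone is integrable. Both
  contributions scale like \<open>\<zeta>\<close> to the power \<open>- 2 \<nu>\<close>.\<close>
lemma bessel_integrand_upper:
  assumes \<nu>: "0 < \<nu>" and \<zeta>: "0 < \<zeta>"
  shows "(\<integral>\<^sup>+t\<in>{0<..}. ennreal (bessel_integrand \<nu> \<zeta> t) \<partial>lborel)
    \<le> ennreal (((4 * (1 + \<nu>)) powr (1 + \<nu>) + 1 / \<nu>) * \<zeta> powr (- 2 * \<nu>))"
proof -
  define a where "a = \<zeta>\<^sup>2"
  have a: "0 < a" using \<zeta> by (simp add: a_def)
  define K where "K = (4 * (1 + \<nu>)) powr (1 + \<nu>)"
  have small: "bessel_integrand \<nu> \<zeta> t \<le> K * a powr (- 1 - \<nu>)" if t: "0 < t" for t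
  proof -
    \<comment> \<open>In terms of \<open>z\<close> the singular factor is \<open>z powr (1 + \<nu>) * exp (- z)\<close>, which is bounded.\<close>
    define z where "z = a / (4 * t)"
    have z: "0 < z" using a t by (simp add: z_def)
    have tz: "t = (a / 4) / z" using a t by (simp add: z_def)
    have "t powr (- 1 - \<nu>) = (a / 4) powr (- 1 - \<nu>) / z powr (- 1 - \<nu>)"
      unfolding tz using a z by (simp add: powr_divide powr_mult)
    also have "\<dots> = (a / 4) powr (- 1 - \<nu>) * z powr (1 + \<nu>)"
      using powr_minus_divide[of z "1 + \<nu>"] z by simp
    finally have tp: "t powr (- 1 - \<nu>) = (a / 4) powr (- 1 - \<nu>) * z powr (1 + \<nu>)" .
    have "bessel_integrand \<nu> \<zeta> t = exp (- z - t) * t powr (- 1 - \<nu>)"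
      by (simp add: bessel_integrand_def z_def a_def)
    also have "\<dots> \<le> exp (- z) * t powr (- 1 - \<nu>)"
      using t by (intro mult_right_mono) auto
    also have "\<dots> = (a / 4) powr (- 1 - \<nu>) * (z powr (1 + \<nu>) * exp (- z))" unfolding tp by simp
    also have "\<dots> \<le> (a / 4) powr (- 1 - \<nu>) * (1 + \<nu>) powr (1 + \<nu>)"
      using \<nu> z by (intro mult_left_mono powr_mult_exp_neg_le) auto
    also have "(a / 4) powr (- 1 - \<nu>) = a powr (- 1 - \<nu>) * 4 powr (1 + \<nu>)"
      using a powr_minus_divide[of 4 "1 + \<nu>"] by (simp add: powr_divide)
    also have "a powr (- 1 - \<nu>) * 4 powr (1 + \<nu>) * (1 + \<nu>) powr (1 + \<nu>) = K * a powr (- 1 - \<nu>)"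
      unfolding K_def using \<nu> by (subst powr_mult) auto
    finally show ?thesis .
  qed
  have large: "bessel_integrand \<nu> \<zeta> t \<le> t powr (- 1 - \<nu>)" if "0 < t" for t
  proof -
    have "0 \<le> \<zeta>\<^sup>2 / (4 * t)" using that by simp
    then have "- \<zeta>\<^sup>2 / (4 * t) - t \<le> 0" using that unfolding minus_divide_left[symmetric] by linarith
    then have "exp (- \<zeta>\<^sup>2 / (4 * t) - t) \<le> 1" by (simp only: exp_le_one_iff)
    then have "exp (- \<zeta>\<^sup>2 / (4 * t) - t) * t powr (- 1 - \<nu>) \<le> 1 * t powr (- 1 - \<nu>)"
      by (intro mult_right_mono) auto
    then show ?thesis by (simp add: bessel_integrand_def)
  qed
  have "(\<integral>\<^sup>+t\<in>{0<..}. ennreal (bessel_integrand \<nu> \<zeta> t) \<partial>lborel)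
     \<le> (\<integral>\<^sup>+t. ennreal (K * a powr (- 1 - \<nu>)) * indicator {0..a} t + ennreal (t powr (- 1 - \<nu>)) * indicator {a..} t \<partial>lborel)"
  proof (rule nn_integral_mono)
    fix t :: real
    consider "t \<le> 0" | "0 < t" "t \<le> a" | "0 < t" "a < t" by linarith
    then show "ennreal (bessel_integrand \<nu> \<zeta> t) * indicator {0<..} t
      \<le> ennreal (K * a powr (- 1 - \<nu>)) * indicator {0..a} t + ennreal (t powr (- 1 - \<nu>)) * indicator {a..} t"
    proof cases
      case 2
      then have "ennreal (bessel_integrand \<nu> \<zeta> t) * indicator {0<..} t \<le> ennreal (K * a powr (- 1 - \<nu>)) * indicator {0..a} t"
        using small[of t] by (simp add: ennreal_leI)
      then show ?thesis by (rule order_trans) simp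
    next
      case 3
      then show ?thesis using large[of t] by (simp add: ennreal_leI)
    qed simp
  qed
  also have "\<dots> = ennreal (K * a powr (- 1 - \<nu>)) * emeasure lborel {0..a} + (\<integral>\<^sup>+t\<in>{a..}. ennreal (t powr (- 1 - \<nu>)) \<partial>lborel)"
    by (subst nn_integral_add) (simp_all add: nn_integral_cmult_indicator)
  also have "(\<integral>\<^sup>+t\<in>{a..}. ennreal (t powr (- 1 - \<nu>)) \<partial>lborel) = ennreal (0 - (- (a powr - \<nu>) / \<nu>))"
  proof (rule nn_integral_FTC_atLeast)
    show "DERIV (\<lambda>t. - (t powr - \<nu>) / \<nu>) t :> t powr (- 1 - \<nu>)" if "a \<le> t" for t
    proof -
      have "((\<lambda>t. t powr - \<nu>) has_real_derivative - \<nu> * t powr (- \<nu> - 1)) (at t)"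
        using a that by (intro has_real_derivative_powr) auto
      then have "((\<lambda>t. - (t powr - \<nu>) / \<nu>) has_real_derivative - (- \<nu> * t powr (- \<nu> - 1)) / \<nu>) (at t)"
        by (intro DERIV_cdivide DERIV_minus)
      moreover have "- \<nu> - 1 = - 1 - \<nu>" by simp
      ultimately show ?thesis using \<nu> by simp
    qed
    have "((\<lambda>t. t powr - \<nu>) \<longlongrightarrow> 0) at_top" using \<nu> by (intro tendsto_neg_powr filterlim_ident) auto
    then have "((\<lambda>t. - (t powr - \<nu>) / \<nu>) \<longlongrightarrow> - 0 / \<nu>) at_top" using \<nu> by (intro tendsto_intros) auto
    then show "((\<lambda>t. - (t powr - \<nu>) / \<nu>) \<longlongrightarrow> 0) at_top" by simp
  qed (use a in auto)
  also have "ennreal (K * a powr (- 1 - \<nu>)) * emeasure lborel {0..a} = ennreal (K * (a powr (- 1 - \<nu>) * a))"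
    using a by (simp add: ennreal_mult K_def mult.assoc)
  also have "a powr (- 1 - \<nu>) * a = a powr - \<nu>"
  proof -
    have "a powr (- 1 - \<nu>) * a powr 1 = a powr (- 1 - \<nu> + 1)" by (simp only: powr_add)
    then show ?thesis using a by simp
  qed
  also have "ennreal (K * a powr - \<nu>) + ennreal (0 - (- (a powr - \<nu>) / \<nu>)) = ennreal ((K + 1 / \<nu>) * a powr - \<nu>)"
    using \<nu> by (subst ennreal_plus[symmetric]) (auto simp: K_def field_simps)
  also have "a powr - \<nu> = \<zeta> powr (- 2 * \<nu>)"
  proof -
    have "a = \<zeta> powr 2" using \<zeta> by (simp add: a_def)
    then show ?thesis by (simp add: powr_powr)
  qed
  finally show ?thesis by (simp add: K_def)
qed

text \<open>On the interval from \<open>\<zeta>\<^sup>2\<close> to \<open>2 \<zeta>\<^sup>2\<close> the integrand already has the order of magnitude of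
  the upper bound.\<close>
lemma bessel_integrand_lower:
  assumes \<nu>: "0 < \<nu>" and \<zeta>: "0 < \<zeta>"
  shows "ennreal (exp (- 1 / 4 - 2 * \<zeta>\<^sup>2) * 2 powr (- 1 - \<nu>) * \<zeta> powr (- 2 * \<nu>))
    \<le> (\<integral>\<^sup>+t\<in>{0<..}. ennreal (bessel_integrand \<nu> \<zeta> t) \<partial>lborel)"
proof -
  define a where "a = \<zeta>\<^sup>2"
  have a: "0 < a" using \<zeta> by (simp add: a_def)
  have low: "exp (- 1 / 4 - 2 * a) * (2 * a) powr (- 1 - \<nu>) \<le> bessel_integrand \<nu> \<zeta> t" if t: "a \<le> t" "t \<le> 2 * a" for t
  proof -
    have "a / (4 * t) \<le> 1 / 4" using t a by (simp add: field_simps)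
    then have "- 1 / 4 - 2 * a \<le> - \<zeta>\<^sup>2 / (4 * t) - t" using t by (simp add: a_def)
    moreover have "(2 * a) powr (- 1 - \<nu>) \<le> t powr (- 1 - \<nu>)" using t a \<nu> by (intro powr_mono2') auto
    ultimately show ?thesis unfolding bessel_integrand_def by (intro mult_mono) auto
  qed
  have "ennreal (exp (- 1 / 4 - 2 * a) * (2 * a) powr (- 1 - \<nu>)) * emeasure lborel {a..2 * a}
      = (\<integral>\<^sup>+t. ennreal (exp (- 1 / 4 - 2 * a) * (2 * a) powr (- 1 - \<nu>)) * indicator {a..2 * a} t \<partial>lborel)"
    by (rule nn_integral_cmult_indicator[symmetric]) simp
  also have "\<dots> \<le> (\<integral>\<^sup>+t\<in>{0<..}. ennreal (bessel_integrand \<nu> \<zeta> t) \<partial>lborel)"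
    using a low by (intro nn_integral_mono) (auto simp: indicator_def ennreal_leI)
  finally have "ennreal (exp (- 1 / 4 - 2 * a) * (2 * a) powr (- 1 - \<nu>)) * emeasure lborel {a..2 * a}
     \<le> (\<integral>\<^sup>+t\<in>{0<..}. ennreal (bessel_integrand \<nu> \<zeta> t) \<partial>lborel)" .
  moreover have "ennreal (exp (- 1 / 4 - 2 * a) * (2 * a) powr (- 1 - \<nu>)) * emeasure lborel {a..2 * a}
    = ennreal (exp (- 1 / 4 - 2 * a) * 2 powr (- 1 - \<nu>) * (a powr (- 1 - \<nu>) * a))"
    using a by (simp add: ennreal_mult[symmetric] powr_mult mult_ac)
  moreover have "a powr (- 1 - \<nu>) * a = \<zeta> powr (- 2 * \<nu>)"
  proof -
    have "a powr (- 1 - \<nu>) * a powr 1 = a powr (- 1 - \<nu> + 1)" by (simp only: powr_add)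
    moreover have "a = \<zeta> powr 2" using \<zeta> by (simp add: a_def)
    ultimately show ?thesis using a by (simp add: powr_powr)
  qed
  ultimately show ?thesis by (simp add: a_def)
qed

lemma besselK_eq:
  "besselK \<nu> \<zeta> = 1 / 2 * (\<zeta> / 2) powr \<nu> * enn2real (\<integral>\<^sup>+t\<in>{0<..}. ennreal (bessel_integrand \<nu> \<zeta> t) \<partial>lborel)"
proof -
  have "(LBINT t:{0<..}. exp (- \<zeta>\<^sup>2 / (4 * t) - t) * t powr (- 1 - \<nu>))
      = (LBINT t. indicator {0<..} t *\<^sub>R bessel_integrand \<nu> \<zeta> t)"
    by (simp add: set_lebesgue_integral_def bessel_integrand_def)
  also have "\<dots> = enn2real (\<integral>\<^sup>+t. ennreal (indicator {0<..} t *\<^sub>R bessel_integrand \<nu> \<zeta> t) \<partial>lborel)"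
    by (rule integral_eq_nn_integral) (simp_all add: bessel_integrand_def)
  also have "(\<integral>\<^sup>+t. ennreal (indicator {0<..} t *\<^sub>R bessel_integrand \<nu> \<zeta> t) \<partial>lborel)
      = (\<integral>\<^sup>+t\<in>{0<..}. ennreal (bessel_integrand \<nu> \<zeta> t) \<partial>lborel)"
    by (intro nn_integral_cong) (simp add: indicator_def)
  finally show ?thesis by (simp add: besselK_def)
qed

lemma besselK_nonneg: "0 \<le> besselK \<nu> \<zeta>"
  by (simp add: besselK_eq)

lemma besselK_borel [measurable]: "besselK \<nu> \<in> borel_measurable borel"
  unfolding besselK_def[abs_def] set_lebesgue_integral_def by measurable

lemma besselK_bounds:
  assumes \<nu>: "0 < \<nu>" and \<zeta>: "0 < \<zeta>"
  shows "besselK \<nu> \<zeta> \<le> 1 / 2 * 2 powr - \<nu> * ((4 * (1 + \<nu>)) powr (1 + \<nu>) + 1 / \<nu>) * \<zeta> powr - \<nu>"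
    and "1 / 2 * 2 powr - \<nu> * exp (- 1 / 4 - 2 * \<zeta>\<^sup>2) * 2 powr (- 1 - \<nu>) * \<zeta> powr - \<nu> \<le> besselK \<nu> \<zeta>"
proof -
  let ?I = "\<integral>\<^sup>+t\<in>{0<..}. ennreal (bessel_integrand \<nu> \<zeta> t) \<partial>lborel"
  define K where "K = (4 * (1 + \<nu>)) powr (1 + \<nu>) + 1 / \<nu>"
  have K: "0 \<le> K" using \<nu> by (simp add: K_def)
  define c where "c = exp (- 1 / 4 - 2 * \<zeta>\<^sup>2) * 2 powr (- 1 - \<nu>)"
  have c: "0 \<le> c" by (simp add: c_def)
  have up: "?I \<le> ennreal (K * \<zeta> powr (- 2 * \<nu>))" unfolding K_def by (rule bessel_integrand_upper[OF assms])
  then obtain I where I: "0 \<le> I" "?I = ennreal I" by (cases ?I) (auto simp: top_unique)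
  have 1: "I \<le> K * \<zeta> powr (- 2 * \<nu>)" using up I K by simp
  have 2: "c * \<zeta> powr (- 2 * \<nu>) \<le> I"
    using bessel_integrand_lower[OF assms] I by (simp add: c_def)
  have B: "besselK \<nu> \<zeta> = 1 / 2 * 2 powr - \<nu> * \<zeta> powr \<nu> * I"
    unfolding besselK_eq I(2) using \<zeta> I(1) by (simp add: powr_divide powr_minus_divide)
  have z: "\<zeta> powr \<nu> * \<zeta> powr (- 2 * \<nu>) = \<zeta> powr - \<nu>"
    unfolding powr_add[symmetric] by simp
  have "1 / 2 * 2 powr - \<nu> * \<zeta> powr \<nu> * I \<le> 1 / 2 * 2 powr - \<nu> * \<zeta> powr \<nu> * (K * \<zeta> powr (- 2 * \<nu>))"
    by (intro mult_left_mono 1) auto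
  also have "\<dots> = 1 / 2 * 2 powr - \<nu> * K * \<zeta> powr - \<nu>" unfolding z[symmetric] by (simp only: mult_ac)
  finally show "besselK \<nu> \<zeta> \<le> 1 / 2 * 2 powr - \<nu> * ((4 * (1 + \<nu>)) powr (1 + \<nu>) + 1 / \<nu>) * \<zeta> powr - \<nu>"
    by (simp add: B K_def)
  have "1 / 2 * 2 powr - \<nu> * c * \<zeta> powr - \<nu> = 1 / 2 * 2 powr - \<nu> * \<zeta> powr \<nu> * (c * \<zeta> powr (- 2 * \<nu>))"
    unfolding z[symmetric] by (simp only: mult_ac)
  also have "\<dots> \<le> 1 / 2 * 2 powr - \<nu> * \<zeta> powr \<nu> * I" by (intro mult_left_mono 2) auto
  finally show "1 / 2 * 2 powr - \<nu> * exp (- 1 / 4 - 2 * \<zeta>\<^sup>2) * 2 powr (- 1 - \<nu>) * \<zeta> powr - \<nu> \<le> besselK \<nu> \<zeta>"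
    by (simp add: B c_def mult.assoc)
qed

text \<open>The weight of the magnetic form at distance \<open>r\<close>.\<close>
definition kernel :: "real \<Rightarrow> real \<Rightarrow> real \<Rightarrow> real" where
  "kernel s m r = besselK ((3 + 2 * s) / 2) (m * r) / r powr ((3 + 2 * s) / 2)"

lemma kernel_nonneg: "0 \<le> kernel s m r"
  by (simp add: kernel_def besselK_nonneg)

lemma kernel_borel [measurable]: "kernel s m \<in> borel_measurable borel"
  unfolding kernel_def[abs_def] by measurable

text \<open>The kernel is comparable to the fractional one at the distances that matter: the lower
  bound is needed within a unit cube, whose diameter is at most \<open>3\<close>.\<close>
lemma kernel_bounds:
  assumes s: "0 < s" and m: "0 < m"
  obtains c C where "0 < c" "0 < C" "\<And>r. 0 < r \<Longrightarrow> kernel s m r \<le> C * r powr - (3 + 2 * s)"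
    "\<And>r. 0 < r \<Longrightarrow> r \<le> 3 \<Longrightarrow> c * r powr - (3 + 2 * s) \<le> kernel s m r"
proof -
  define \<nu> where "\<nu> = (3 + 2 * s) / 2"
  have \<nu>: "0 < \<nu>" "2 * \<nu> = 3 + 2 * s" using s by (simp_all add: \<nu>_def)
  define C where "C = 1 / 2 * 2 powr - \<nu> * ((4 * (1 + \<nu>)) powr (1 + \<nu>) + 1 / \<nu>) * m powr - \<nu>"
  define c where "c = 1 / 2 * 2 powr - \<nu> * exp (- 1 / 4 - 18 * m\<^sup>2) * 2 powr (- 1 - \<nu>) * m powr - \<nu>"
  have rr: "(m * r) powr - \<nu> / r powr \<nu> = m powr - \<nu> * r powr - (3 + 2 * s)" if "0 < r" for r
  proof -
    have "(m * r) powr - \<nu> / r powr \<nu> = m powr - \<nu> * (r powr - \<nu> * r powr - \<nu>)"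
      using m that by (simp add: powr_mult powr_minus_divide)
    also have "r powr - \<nu> * r powr - \<nu> = r powr (- (2 * \<nu>))" unfolding powr_add[symmetric] by simp
    finally show ?thesis by (simp only: \<nu>(2))
  qed
  show thesis
  proof (rule that)
    show "0 < c" using m by (simp add: c_def)
    have "0 < (4 * (1 + \<nu>)) powr (1 + \<nu>) + 1 / \<nu>" using \<nu> by (intro add_nonneg_pos) auto
    then show "0 < C" using m unfolding C_def by (intro mult_pos_pos) auto
    show "kernel s m r \<le> C * r powr - (3 + 2 * s)" if r: "0 < r" for r
    proof -
      have "kernel s m r \<le> (1 / 2 * 2 powr - \<nu> * ((4 * (1 + \<nu>)) powr (1 + \<nu>) + 1 / \<nu>) * (m * r) powr - \<nu>) / r powr \<nu>"
        unfolding kernel_def \<nu>_def[symmetric] using m r \<nu> by (intro divide_right_mono besselK_bounds) auto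
      also have "\<dots> = 1 / 2 * 2 powr - \<nu> * ((4 * (1 + \<nu>)) powr (1 + \<nu>) + 1 / \<nu>) * ((m * r) powr - \<nu> / r powr \<nu>)" by simp
      also have "\<dots> = C * r powr - (3 + 2 * s)" unfolding rr[OF r] C_def by (simp only: mult_ac)
      finally show ?thesis .
    qed
    show "c * r powr - (3 + 2 * s) \<le> kernel s m r" if r: "0 < r" "r \<le> 3" for r
    proof -
      have "(m * r)\<^sup>2 \<le> 9 * m\<^sup>2"
      proof -
        have "r\<^sup>2 \<le> 3\<^sup>2" using r by (intro power_mono) auto
        then have "m\<^sup>2 * r\<^sup>2 \<le> m\<^sup>2 * 9" by (intro mult_left_mono) auto
        then show ?thesis by (simp add: power_mult_distrib mult.commute)
      qed
      then have e: "exp (- 1 / 4 - 18 * m\<^sup>2) \<le> exp (- 1 / 4 - 2 * (m * r)\<^sup>2)" by simp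
      have "c * r powr - (3 + 2 * s) = (1 / 2 * 2 powr - \<nu> * 2 powr (- 1 - \<nu>) * (m powr - \<nu> * r powr - (3 + 2 * s))) * exp (- 1 / 4 - 18 * m\<^sup>2)"
        unfolding c_def by (simp only: mult_ac)
      also have "\<dots> \<le> (1 / 2 * 2 powr - \<nu> * 2 powr (- 1 - \<nu>) * (m powr - \<nu> * r powr - (3 + 2 * s))) * exp (- 1 / 4 - 2 * (m * r)\<^sup>2)"
        by (intro mult_left_mono e) auto
      also have "\<dots> = (1 / 2 * 2 powr - \<nu> * exp (- 1 / 4 - 2 * (m * r)\<^sup>2) * 2 powr (- 1 - \<nu>) * (m * r) powr - \<nu>) / r powr \<nu>"
        unfolding rr[OF r(1), symmetric] by simp
      also have "\<dots> \<le> kernel s m r"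
        unfolding kernel_def \<nu>_def[symmetric] using m r \<nu> by (intro divide_right_mono besselK_bounds) auto
      finally show ?thesis .
    qed
  qed
qed

lemma AE_pair_fst_snd:
  assumes "AE x in (lborel :: R3 measure). P x"
  shows "AE z in lborel \<Otimes>\<^sub>M lborel. P (fst z) \<and> P (snd z)"
proof -
  obtain N where N: "N \<in> null_sets (lborel :: R3 measure)" "{x. \<not> P x} \<subseteq> N"
    using assms by (auto simp: eventually_ae_filter)
  have "N \<times> UNIV \<in> null_sets (lborel \<Otimes>\<^sub>M (lborel :: R3 measure))"
    "UNIV \<times> N \<in> null_sets (lborel \<Otimes>\<^sub>M (lborel :: R3 measure))"
    using N(1) lborel.times_in_null_sets1[OF N(1), of UNIV] lborel.times_in_null_sets2[OF _ N(1), of UNIV] by auto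
  then have "N \<times> UNIV \<union> UNIV \<times> N \<in> null_sets (lborel \<Otimes>\<^sub>M (lborel :: R3 measure))" by (rule null_sets.Un)
  then show ?thesis by (rule AE_I') (use N(2) in auto)
qed

text \<open>Members of the function spaces are only Lebesgue measurable, while product measures and
  averages are handled more easily for Borel functions; every statement below is invariant under
  changes on null sets.\<close>
lemma borel_representative:
  assumes "u \<in> borel_measurable (lebesgue :: R3 measure)"
  obtains u' :: "R3 \<Rightarrow> complex" where "u' \<in> borel_measurable borel" "AE x in lborel. u x = u' x"
proof -
  have 1: "(\<lambda>x. Re (u x)) \<in> borel_measurable lebesgue" and 2: "(\<lambda>x. Im (u x)) \<in> borel_measurable lebesgue"
    using assms by simp_all
  obtain f g where fg: "f \<in> borel_measurable lborel" "AE x in lborel. Re (u x) = f x"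
    "g \<in> borel_measurable lborel" "AE x in lborel. Im (u x) = g x"
    using completion_ex_borel_measurable_real[OF 1] completion_ex_borel_measurable_real[OF 2] by blast
  show thesis
  proof (rule that[of "\<lambda>x. Complex (f x) (g x)"])
    have "(\<lambda>x. of_real (f x) + \<i> * of_real (g x)) \<in> borel_measurable borel" using fg by simp
    then show "(\<lambda>x. Complex (f x) (g x)) \<in> borel_measurable borel" by (simp add: Complex_eq)
    show "AE x in lborel. u x = Complex (f x) (g x)"
      using fg(2,4) by eventually_elim (simp add: complex_eq_iff)
  qed
qed

lemma lebesgue_measurable_AE:
  fixes f g :: "'a::euclidean_space \<Rightarrow> complex"
  assumes f: "f \<in> borel_measurable lebesgue" and eq: "AE x in lborel. f x = g x"
  shows "g \<in> borel_measurable lebesgue"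
proof (rule measurableI)
  fix S :: "complex set" assume S: "S \<in> sets borel"
  have "AE x in lebesgue. f x = g x" using eq by (simp add: AE_completion_iff)
  then have "AE x in lebesgue. x \<in> f -` S \<longleftrightarrow> x \<in> g -` S" by eventually_elim simp
  moreover have "f -` S \<in> sets lebesgue" using measurable_sets[OF f S] by simp
  ultimately have "g -` S \<in> sets lebesgue" by (rule completion.in_sets_AE) simp
  then show "g -` S \<inter> space lebesgue \<in> sets lebesgue" by simp
qed simp

section \<open>The magnetic form\<close>

lemma liminf_add_le: "liminf a + liminf b \<le> liminf (\<lambda>n. a n + b n)" for a b :: "nat \<Rightarrow> ennreal"
proof -
  have inc: "incseq (\<lambda>n. INF k\<in>{n..}. f k)" for f :: "nat \<Rightarrow> ennreal"
    by (intro incseq_SucI INF_superset_mono) auto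
  have "liminf a + liminf b = (SUP n. (INF k\<in>{n..}. a k) + (INF k\<in>{n..}. b k))"
    unfolding liminf_SUP_INF by (rule ennreal_SUP_add[symmetric]) (intro inc)+
  also have "\<dots> \<le> (SUP n. INF k\<in>{n..}. a k + b k)"
    by (intro SUP_mono' INF_greatest add_mono INF_lower)
  finally show ?thesis by (simp add: liminf_SUP_INF)
qed

lemma mult_liminf_le: "c * liminf a \<le> liminf (\<lambda>n. c * a n)" for a :: "nat \<Rightarrow> ennreal"
proof -
  have "c * liminf a = (SUP n. c * (INF k\<in>{n..}. a k))"
    unfolding liminf_SUP_INF by (rule SUP_mult_left_ennreal)
  also have "\<dots> \<le> (SUP n. INF k\<in>{n..}. c * a k)"
    by (intro SUP_mono' INF_greatest mult_left_mono INF_lower) auto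
  finally show ?thesis by (simp add: liminf_SUP_INF)
qed

locale magnetic_form =
  fixes s m :: real and A :: "R3 \<Rightarrow> R3"
  assumes s: "0 < s" "s < 1" and m: "0 < m" and A: "continuous_on UNIV A"
begin

lemma A_borel [measurable]: "A \<in> borel_measurable borel"
  by (rule borel_measurable_continuous_onI[OF A])

lemma mag_diff_borel [measurable]:
  assumes [measurable]: "u \<in> borel_measurable borel"
  shows "(\<lambda>z. mag_diff A u (fst z) (snd z)) \<in> borel_measurable (borel \<Otimes>\<^sub>M borel)"
proof -
  have [measurable]: "(\<lambda>z. (fst z - snd z) \<bullet> A ((fst z + snd z) /\<^sub>R 2)) \<in> borel_measurable (borel \<Otimes>\<^sub>M (borel :: R3 measure))"
    by measurable
  have e: "exp (- \<i> * complex_of_real t) = complex_of_real (cos t) - \<i> * complex_of_real (sin t)" for t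
    by (simp add: complex_eq_iff Re_exp Im_exp)
  show ?thesis unfolding mag_diff_def e by measurable
qed

definition energy_density :: "(R3 \<Rightarrow> complex) \<Rightarrow> R3 \<times> R3 \<Rightarrow> real" where
  "energy_density u z = (cmod (mag_diff A u (fst z) (snd z)))\<^sup>2 * kernel s m (norm (fst z - snd z))"

lemma energy_density_borel [measurable]:
  assumes [measurable]: "u \<in> borel_measurable borel"
  shows "energy_density u \<in> borel_measurable (borel \<Otimes>\<^sub>M borel)"
  unfolding energy_density_def[abs_def] by measurable

lemma energy_density_nonneg: "0 \<le> energy_density u z"
  by (simp add: energy_density_def kernel_nonneg)

definition mag_energy :: "(R3 \<Rightarrow> complex) \<Rightarrow> ennreal" where
  "mag_energy u = (\<integral>\<^sup>+z. ennreal (energy_density u z) \<partial>(lborel \<Otimes>\<^sub>M lborel))"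

definition energy_coeff :: real where "energy_coeff = C_const s / 2 * m powr ((3 + 2 * s) / 2)"

lemma energy_coeff_pos: "0 < energy_coeff"
proof -
  have "0 < Gamma (1 - s)" using s by (intro Gamma_real_pos) auto
  then show ?thesis using s m by (simp add: energy_coeff_def C_const_def)
qed

text \<open>The squared norm as an extended nonnegative number. Infinity marks the functions outside
  the space, and the algebra of the form needs no integrability assumptions.\<close>
definition mag_form :: "(R3 \<Rightarrow> complex) \<Rightarrow> ennreal" where
  "mag_form u = ennreal energy_coeff * mag_energy u + ennreal (m powr (2 * s)) * mass u"

lemma mag_integrand_eq: "mag_integrand s m A u u z = complex_of_real (energy_density u z)"
proof -
  have "w * cnj w = complex_of_real ((cmod w)\<^sup>2)" for w by (simp add: complex_norm_square[symmetric])
  then show ?thesis by (simp add: mag_integrand_def energy_density_def kernel_def split_beta)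
qed

lemma energy_density_cong_AE:
  assumes "AE x in lborel. u x = v x"
  shows "AE z in lborel \<Otimes>\<^sub>M lborel. energy_density u z = energy_density v z"
  using AE_pair_fst_snd[OF assms] by eventually_elim (simp add: energy_density_def mag_diff_def)

lemma mag_form_cong_AE:
  assumes "AE x in lborel. u x = v x"
  shows "mag_form u = mag_form v"
proof -
  have "mag_energy u = mag_energy v" unfolding mag_energy_def
    using energy_density_cong_AE[OF assms] by (intro nn_integral_cong_AE, eventually_elim) simp
  moreover have "mass u = mass v"
    using assms by (intro nn_integral_cong_AE, eventually_elim) simp
  ultimately show ?thesis by (simp add: mag_form_def)
qed

lemma mag_form_finite_iff: "mag_form u < \<infinity> \<longleftrightarrow> mag_energy u < \<infinity> \<and> mass u < \<infinity>"
  using energy_coeff_pos m by (auto simp: mag_form_def ennreal_mult_less_top)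

text \<open>Translation between the norm, defined by Bochner integrals, and the extended form.\<close>
lemma mag_space_and_norm:
  assumes u: "u \<in> borel_measurable lebesgue"
  shows "u \<in> mag_space s m A \<longleftrightarrow> mag_form u < \<infinity>"
    and "mag_form u < \<infinity> \<Longrightarrow> mag_norm s m A u = sqrt (enn2real (mag_form u))"
proof -
  obtain v where v [measurable]: "v \<in> borel_measurable borel" and uv: "AE x in lborel. u x = v x"
    using borel_representative[OF u] by blast
  have dens: "(\<lambda>z. complex_of_real (energy_density v z)) \<in> borel_measurable lborel"
    by (simp flip: lborel_prod)
  have dens': "(\<lambda>z. energy_density v z) \<in> borel_measurable lborel"
    by (simp flip: lborel_prod)
  have eqd: "AE z in lborel. complex_of_real (energy_density v z) = mag_integrand s m A u u z"
    using energy_density_cong_AE[OF uv] unfolding mag_integrand_eq lborel_prod by eventually_elim simp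
  have m1: "mag_integrand s m A u u \<in> borel_measurable lebesgue"
    by (rule lebesgue_measurable_AE[OF _ eqd]) (rule measurable_completion[OF dens])
  have m2: "(\<lambda>z. complex_of_real (energy_density v z)) \<in> borel_measurable lebesgue"
    by (rule measurable_completion[OF dens])
  have eqd': "AE z in lebesgue. mag_integrand s m A u u z = complex_of_real (energy_density v z)"
    using eqd by (simp add: AE_completion_iff eq_commute)
  have E: "mag_energy u = (\<integral>\<^sup>+z. ennreal (energy_density v z) \<partial>lborel)"
    unfolding mag_energy_def lborel_prod[symmetric]
    using energy_density_cong_AE[OF uv] by (intro nn_integral_cong_AE, eventually_elim) simp
  have i1: "integrable lebesgue (mag_integrand s m A u u) \<longleftrightarrow> mag_energy u < \<infinity>"
  proof -
    have "integrable lebesgue (mag_integrand s m A u u) \<longleftrightarrow> integrable lebesgue (\<lambda>z. complex_of_real (energy_density v z))"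
      by (rule integrable_cong_AE[OF m1 m2 eqd'])
    also have "\<dots> \<longleftrightarrow> integrable lborel (\<lambda>z. complex_of_real (energy_density v z))"
      by (rule integrable_completion[OF dens])
    also have "\<dots> \<longleftrightarrow> mag_energy u < \<infinity>"
      using dens by (simp add: integrable_iff_bounded E energy_density_nonneg)
    finally show ?thesis .
  qed
  have v1: "Re (LINT z|lebesgue. mag_integrand s m A u u z) = enn2real (mag_energy u)"
  proof -
    have "(LINT z|lebesgue. mag_integrand s m A u u z) = (LINT z|lborel. complex_of_real (energy_density v z))"
      using integral_cong_AE[OF m1 m2 eqd'] integral_completion[OF dens] by simp
    also have "\<dots> = complex_of_real (LINT z|lborel. energy_density v z)" by simp
    also have "(LINT z|lborel. energy_density v z) = enn2real (mag_energy u)"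
      unfolding E by (rule integral_eq_nn_integral[OF dens']) (simp add: energy_density_nonneg)
    finally show ?thesis by simp
  qed
  have sq: "w * cnj w = complex_of_real ((cmod w)\<^sup>2)" for w by (simp add: complex_norm_square[symmetric])
  have n1: "(\<lambda>x. u x * cnj (u x)) \<in> borel_measurable lebesgue"
    unfolding sq using u by simp
  have n2: "(\<lambda>x. complex_of_real ((cmod (v x))\<^sup>2)) \<in> borel_measurable lborel" by simp
  have n2': "(\<lambda>x. complex_of_real ((cmod (v x))\<^sup>2)) \<in> borel_measurable lebesgue" by (rule measurable_completion[OF n2])
  have eqn: "AE x in lebesgue. u x * cnj (u x) = complex_of_real ((cmod (v x))\<^sup>2)"
    unfolding AE_completion_iff using uv by eventually_elim (simp add: sq)
  have Mu: "mass u = mass v"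
    using uv by (intro nn_integral_cong_AE, eventually_elim) simp
  have i2: "integrable lebesgue (\<lambda>x. u x * cnj (u x)) \<longleftrightarrow> mass u < \<infinity>"
  proof -
    have "integrable lebesgue (\<lambda>x. u x * cnj (u x)) \<longleftrightarrow> integrable lebesgue (\<lambda>x. complex_of_real ((cmod (v x))\<^sup>2))"
      by (rule integrable_cong_AE[OF n1 n2' eqn])
    also have "\<dots> \<longleftrightarrow> integrable lborel (\<lambda>x. complex_of_real ((cmod (v x))\<^sup>2))"
      by (rule integrable_completion[OF n2])
    also have "\<dots> \<longleftrightarrow> mass u < \<infinity>"
      using n2 by (simp add: integrable_iff_bounded Mu norm_power)
    finally show ?thesis .
  qed
  have v2: "Re (LINT x|lebesgue. u x * cnj (u x)) = enn2real (mass u)"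
  proof -
    have "(LINT x|lebesgue. u x * cnj (u x)) = (LINT x|lborel. complex_of_real ((cmod (v x))\<^sup>2))"
      using integral_cong_AE[OF n1 n2' eqn] integral_completion[OF n2] by simp
    also have "\<dots> = complex_of_real (LINT x|lborel. (cmod (v x))\<^sup>2)" by (rule integral_complex_of_real)
    also have "(LINT x|lborel. (cmod (v x))\<^sup>2) = enn2real (mass u)"
      unfolding Mu by (rule integral_eq_nn_integral) simp_all
    finally show ?thesis by simp
  qed
  show "u \<in> mag_space s m A \<longleftrightarrow> mag_form u < \<infinity>"
    unfolding mag_form_finite_iff using u i1 i2 by (simp add: mag_space_def)
  assume fin: "mag_form u < \<infinity>"
  then have "mag_energy u < \<infinity>" "mass u < \<infinity>" using mag_form_finite_iff[of u] by simp_all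
  then obtain a b where ab: "0 \<le> a" "mag_energy u = ennreal a" "0 \<le> b" "mass u = ennreal b"
    by (cases "mag_energy u"; cases "mass u") auto
  have "mag_inner s m A u u = energy_coeff * a + m powr (2 * s) * b"
    unfolding mag_inner_def mag_bracket_def v1 v2 ab energy_coeff_def[symmetric] using ab by simp
  also have "\<dots> = enn2real (mag_form u)"
  proof -
    have "mag_form u = ennreal (energy_coeff * a + m powr (2 * s) * b)"
      using ab energy_coeff_pos by (simp add: mag_form_def ennreal_mult ennreal_plus less_imp_le)
    then show ?thesis using ab energy_coeff_pos by (simp only:) (simp add: less_imp_le del: ennreal_plus)
  qed
  finally show "mag_norm s m A u = sqrt (enn2real (mag_form u))" by (simp add: mag_norm_def)
qed

lemma mag_diff_add: "mag_diff A (\<lambda>x. u x + v x) x y = mag_diff A u x y + mag_diff A v x y"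
  by (simp add: mag_diff_def algebra_simps)

lemma mag_diff_diff: "mag_diff A (\<lambda>x. u x - v x) x y = mag_diff A u x y - mag_diff A v x y"
  by (simp add: mag_diff_def algebra_simps)

lemma mag_diff_scale: "mag_diff A (\<lambda>x. c * u x) x y = c * mag_diff A u x y"
  by (simp add: mag_diff_def algebra_simps)

lemma complex_parallelogram: "(cmod (a + b))\<^sup>2 + (cmod (a - b))\<^sup>2 = 2 * (cmod a)\<^sup>2 + 2 * (cmod b)\<^sup>2"
  unfolding cmod_power2 by (simp add: power2_eq_square algebra_simps)

text \<open>Valid pointwise under the integral signs, because the magnetic difference is linear in
  \<open>u\<close>.\<close>
lemma mag_form_parallelogram:
  assumes [measurable]: "u \<in> borel_measurable borel" "v \<in> borel_measurable borel"
  shows "mag_form (\<lambda>x. u x + v x) + mag_form (\<lambda>x. u x - v x) = 2 * mag_form u + 2 * mag_form v"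
proof -
  have "mag_energy (\<lambda>x. u x + v x) + mag_energy (\<lambda>x. u x - v x)
     = (\<integral>\<^sup>+z. ennreal (energy_density (\<lambda>x. u x + v x) z) + ennreal (energy_density (\<lambda>x. u x - v x) z) \<partial>(lborel \<Otimes>\<^sub>M lborel))"
    unfolding mag_energy_def by (rule nn_integral_add[symmetric]) measurable
  also have "\<dots> = (\<integral>\<^sup>+z. 2 * ennreal (energy_density u z) + 2 * ennreal (energy_density v z) \<partial>(lborel \<Otimes>\<^sub>M lborel))"
  proof (intro nn_integral_cong)
    fix z
    have "energy_density (\<lambda>x. u x + v x) z + energy_density (\<lambda>x. u x - v x) z = 2 * energy_density u z + 2 * energy_density v z"
      unfolding energy_density_def mag_diff_add mag_diff_diff distrib_right[symmetric] complex_parallelogram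
      by (simp add: algebra_simps)
    then have "ennreal (energy_density (\<lambda>x. u x + v x) z + energy_density (\<lambda>x. u x - v x) z) = ennreal (2 * energy_density u z + 2 * energy_density v z)"
      by simp
    then show "ennreal (energy_density (\<lambda>x. u x + v x) z) + ennreal (energy_density (\<lambda>x. u x - v x) z) = 2 * ennreal (energy_density u z) + 2 * ennreal (energy_density v z)"
      by (simp add: energy_density_nonneg ennreal_plus ennreal_mult)
  qed
  also have "\<dots> = 2 * mag_energy u + 2 * mag_energy v"
    unfolding mag_energy_def by (simp add: nn_integral_add nn_integral_cmult)
  finally have E: "mag_energy (\<lambda>x. u x + v x) + mag_energy (\<lambda>x. u x - v x) = 2 * mag_energy u + 2 * mag_energy v" .
  have "mass (\<lambda>x. u x + v x) + mass (\<lambda>x. u x - v x)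
     = (\<integral>\<^sup>+x. ennreal ((cmod (u x + v x))\<^sup>2) + ennreal ((cmod (u x - v x))\<^sup>2) \<partial>lborel)"
    by (rule nn_integral_add[symmetric]) measurable
  also have "\<dots> = (\<integral>\<^sup>+x. 2 * ennreal ((cmod (u x))\<^sup>2) + 2 * ennreal ((cmod (v x))\<^sup>2) \<partial>lborel)"
  proof (intro nn_integral_cong)
    fix x
    have "ennreal ((cmod (u x + v x))\<^sup>2 + (cmod (u x - v x))\<^sup>2) = ennreal (2 * (cmod (u x))\<^sup>2 + 2 * (cmod (v x))\<^sup>2)"
      by (simp only: complex_parallelogram)
    then show "ennreal ((cmod (u x + v x))\<^sup>2) + ennreal ((cmod (u x - v x))\<^sup>2) = 2 * ennreal ((cmod (u x))\<^sup>2) + 2 * ennreal ((cmod (v x))\<^sup>2)"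
      by (simp add: ennreal_plus ennreal_mult)
  qed
  also have "\<dots> = 2 * mass u + 2 * mass v"
    by (simp add: nn_integral_add nn_integral_cmult)
  finally have M: "mass (\<lambda>x. u x + v x) + mass (\<lambda>x. u x - v x) = 2 * mass u + 2 * mass v" .
  have "mag_form (\<lambda>x. u x + v x) + mag_form (\<lambda>x. u x - v x)
     = ennreal energy_coeff * (mag_energy (\<lambda>x. u x + v x) + mag_energy (\<lambda>x. u x - v x)) + ennreal (m powr (2 * s)) * (mass (\<lambda>x. u x + v x) + mass (\<lambda>x. u x - v x))"
    unfolding mag_form_def by (simp only: distrib_left add_ac)
  also have "\<dots> = 2 * mag_form u + 2 * mag_form v"
    unfolding E M mag_form_def by (simp only: distrib_left mult_ac add_ac)
  finally show ?thesis .
qed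

lemma mag_form_scale:
  assumes [measurable]: "u \<in> borel_measurable borel"
  shows "mag_form (\<lambda>x. c * u x) = ennreal ((cmod c)\<^sup>2) * mag_form u"
proof -
  have "mag_energy (\<lambda>x. c * u x) = ennreal ((cmod c)\<^sup>2) * mag_energy u"
    unfolding mag_energy_def energy_density_def mag_diff_scale
    by (subst nn_integral_cmult[symmetric])
      (auto simp: norm_mult power_mult_distrib ennreal_mult[symmetric] kernel_nonneg mult.assoc)
  moreover have "mass (\<lambda>x. c * u x) = ennreal ((cmod c)\<^sup>2) * mass u"
    by (subst nn_integral_cmult[symmetric]) (auto simp: norm_mult power_mult_distrib ennreal_mult)
  ultimately show ?thesis unfolding mag_form_def by (simp add: distrib_left mult_ac)
qed

lemma mag_form_add_le:
  assumes "u \<in> borel_measurable borel" "v \<in> borel_measurable borel"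
  shows "mag_form (\<lambda>x. u x + v x) \<le> 2 * mag_form u + 2 * mag_form v"
  unfolding mag_form_parallelogram[OF assms, symmetric] by simp

lemma mag_form_diff_le:
  assumes "u \<in> borel_measurable borel" "v \<in> borel_measurable borel"
  shows "mag_form (\<lambda>x. u x - v x) \<le> 2 * mag_form u + 2 * mag_form v"
  unfolding mag_form_parallelogram[OF assms, symmetric] by simp

text \<open>Fatou's lemma in both integrals: convergence at almost every point gives convergence of
  the magnetic differences at almost every pair of points.\<close>
lemma mag_form_liminf:
  fixes u :: "nat \<Rightarrow> R3 \<Rightarrow> complex"
  assumes u [measurable]: "\<And>n. u n \<in> borel_measurable borel" and [measurable]: "w \<in> borel_measurable borel"
    and lim: "AE x in lborel. (\<lambda>n. u n x) \<longlonglongrightarrow> w x"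
    and le: "\<And>n. mag_form (u n) \<le> B"
  shows "mag_form w \<le> B"
proof -
  have lim2: "AE z in lborel \<Otimes>\<^sub>M lborel. (\<lambda>n. ennreal (energy_density (u n) z)) \<longlonglongrightarrow> ennreal (energy_density w z)"
    using AE_pair_fst_snd[OF lim]
  proof eventually_elim
    fix z assume z: "(\<lambda>n. u n (fst z)) \<longlonglongrightarrow> w (fst z) \<and> (\<lambda>n. u n (snd z)) \<longlonglongrightarrow> w (snd z)"
    show "(\<lambda>n. ennreal (energy_density (u n) z)) \<longlonglongrightarrow> ennreal (energy_density w z)"
      unfolding energy_density_def mag_diff_def using z by (intro tendsto_intros tendsto_ennrealI) auto
  qed
  have "mag_energy w = (\<integral>\<^sup>+z. liminf (\<lambda>n. ennreal (energy_density (u n) z)) \<partial>(lborel \<Otimes>\<^sub>M lborel))"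
    unfolding mag_energy_def using lim2
    by (intro nn_integral_cong_AE, eventually_elim) (simp add: lim_imp_Liminf)
  also have "\<dots> \<le> liminf (\<lambda>n. mag_energy (u n))"
    unfolding mag_energy_def by (rule nn_integral_liminf) measurable
  finally have E: "mag_energy w \<le> liminf (\<lambda>n. mag_energy (u n))" .
  have "mass w = (\<integral>\<^sup>+x. liminf (\<lambda>n. ennreal ((cmod (u n x))\<^sup>2)) \<partial>lborel)"
    using lim
  proof (intro nn_integral_cong_AE, eventually_elim)
    fix x assume "(\<lambda>n. u n x) \<longlonglongrightarrow> w x"
    then have "(\<lambda>n. ennreal ((cmod (u n x))\<^sup>2)) \<longlonglongrightarrow> ennreal ((cmod (w x))\<^sup>2)"
      by (intro tendsto_intros tendsto_ennrealI)
    then show "ennreal ((cmod (w x))\<^sup>2) = liminf (\<lambda>n. ennreal ((cmod (u n x))\<^sup>2))"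
      by (rule lim_imp_Liminf[OF sequentially_bot, symmetric])
  qed
  also have "\<dots> \<le> liminf (\<lambda>n. mass (u n))"
    by (rule nn_integral_liminf) measurable
  finally have M: "mass w \<le> liminf (\<lambda>n. mass (u n))" .
  have "mag_form w \<le> ennreal energy_coeff * liminf (\<lambda>n. mag_energy (u n)) + ennreal (m powr (2 * s)) * liminf (\<lambda>n. mass (u n))"
    unfolding mag_form_def by (intro add_mono mult_left_mono E M) auto
  also have "\<dots> \<le> liminf (\<lambda>n. ennreal energy_coeff * mag_energy (u n)) + liminf (\<lambda>n. ennreal (m powr (2 * s)) * mass (u n))"
    by (intro add_mono mult_liminf_le)
  also have "\<dots> \<le> liminf (\<lambda>n. mag_form (u n))"
    unfolding mag_form_def by (rule liminf_add_le)
  also have "\<dots> \<le> B" by (rule Liminf_le) (use le in auto)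
  finally show ?thesis .
qed

end

section \<open>Local energies and test functions\<close>

lemma cmod_exp_i_minus_1_le: "cmod (exp (- \<i> * complex_of_real t) - 1) \<le> \<bar>t\<bar>"
proof -
  have "(cmod (exp (- \<i> * complex_of_real t) - 1))\<^sup>2 = (cos t - 1)\<^sup>2 + (sin t)\<^sup>2"
    by (simp add: cmod_power2 Re_exp Im_exp)
  also have "\<dots> = 2 - 2 * cos t"
    using sin_cos_squared_add[of t] by (simp add: power2_eq_square algebra_simps)
  also have "\<dots> = 4 * (sin (t / 2))\<^sup>2" using cos_double_sin[of "t / 2"] by simp
  also have "\<dots> \<le> 4 * (t / 2)\<^sup>2"
    using power_mono[OF abs_sin_x_le_abs_x[of "t / 2"] abs_ge_zero, of 2] by (intro mult_left_mono) (simp_all only: power2_abs)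
  also have "\<dots> = \<bar>t\<bar>\<^sup>2" by (simp add: power2_eq_square)
  finally show ?thesis by (rule power2_le_imp_le) simp
qed

lemma sum_squared_le: "(a + b)\<^sup>2 \<le> 2 * a\<^sup>2 + 2 * (b::real)\<^sup>2"
  using zero_le_power2[of "a - b"] by (simp add: power2_eq_square algebra_simps)

context magnetic_form
begin

lemma cmod_phase [simp]: "cmod (exp (- \<i> * complex_of_real t)) = 1"
  by (simp add: norm_exp_eq_Re)

text \<open>The phase factor has modulus \<open>1\<close>.\<close>
lemma diamagnetic: "\<bar>cmod (u x) - cmod (u y)\<bar> \<le> cmod (mag_diff A u x y)"
proof -
  have "\<bar>cmod (exp (- \<i> * complex_of_real ((x - y) \<bullet> A ((x + y) /\<^sub>R 2))) * u x) - cmod (u y)\<bar> \<le> cmod (mag_diff A u x y)"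
    unfolding mag_diff_def by (rule norm_triangle_ineq3)
  then show ?thesis by (simp only: norm_mult cmod_phase mult_1)
qed

text \<open>Where \<open>A\<close> is bounded by \<open>L\<close>, the phase is at most \<open>L * norm (x - y)\<close>, so removing it costs
  a term of first order in \<open>x - y\<close>.\<close>
lemma diff_le_mag_diff:
  assumes "norm (A ((x + y) /\<^sub>R 2)) \<le> L"
  shows "cmod (u x - u y) \<le> cmod (mag_diff A u x y) + L * norm (x - y) * cmod (u x)"
    and "cmod (mag_diff A u x y) \<le> cmod (u x - u y) + L * norm (x - y) * cmod (u x)"
proof -
  define t where "t = (x - y) \<bullet> A ((x + y) /\<^sub>R 2)"
  define e where "e = exp (- \<i> * complex_of_real t)"
  have "\<bar>t\<bar> \<le> norm (x - y) * norm (A ((x + y) /\<^sub>R 2))" unfolding t_def by (rule Cauchy_Schwarz_ineq2)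
  also have "\<dots> \<le> norm (x - y) * L" by (intro mult_left_mono assms) auto
  finally have "cmod (e - 1) \<le> L * norm (x - y)"
    unfolding e_def using cmod_exp_i_minus_1_le[of t] by (simp add: mult.commute)
  then have b: "cmod ((e - 1) * u x) \<le> L * norm (x - y) * cmod (u x)"
    unfolding norm_mult by (rule mult_right_mono) simp
  have d: "mag_diff A u x y = (u x - u y) + (e - 1) * u x"
    by (simp add: mag_diff_def e_def t_def algebra_simps)
  show "cmod (mag_diff A u x y) \<le> cmod (u x - u y) + L * norm (x - y) * cmod (u x)"
    unfolding d using norm_triangle_ineq[of "u x - u y" "(e - 1) * u x"] b by linarith
  have d2: "u x - u y = mag_diff A u x y - (e - 1) * u x" by (simp add: d)
  show "cmod (u x - u y) \<le> cmod (mag_diff A u x y) + L * norm (x - y) * cmod (u x)"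
    unfolding d2 using norm_triangle_ineq4[of "mag_diff A u x y" "(e - 1) * u x"] b by linarith
qed

lemma mag_energy_iterated:
  assumes [measurable]: "u \<in> borel_measurable borel"
  shows "mag_energy u = (\<integral>\<^sup>+x. (\<integral>\<^sup>+y. ennreal (energy_density u (x, y)) \<partial>lborel) \<partial>lborel)"
  unfolding mag_energy_def by (rule lborel.nn_integral_fst[symmetric]) measurable

text \<open>By the diamagnetic inequality the modulus has a bounded fractional energy on all of space,
  although that of \<open>u\<close> itself need not be controlled there.\<close>
lemma local_energy_modulus_le:
  obtains K where "0 \<le> K" "\<And>u. u \<in> borel_measurable borel \<Longrightarrow>
    local_energy s (\<lambda>x. complex_of_real (cmod (u x))) UNIV \<le> ennreal K * mag_energy u"
proof -
  obtain c C where c: "0 < c" and "0 < C" and "\<And>r. 0 < r \<Longrightarrow> kernel s m r \<le> C * r powr - (3 + 2 * s)"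
    and low: "\<And>r. 0 < r \<Longrightarrow> r \<le> 3 \<Longrightarrow> c * r powr - (3 + 2 * s) \<le> kernel s m r"
    using kernel_bounds[OF s(1) m] by metis
  have "local_energy s (\<lambda>x. complex_of_real (cmod (u x))) UNIV \<le> ennreal (1 / c) * mag_energy u"
    if [measurable]: "u \<in> borel_measurable borel" for u
  proof -
    have pt: "(cmod (complex_of_real (cmod (u x)) - complex_of_real (cmod (u y))))\<^sup>2 * norm (x - y) powr - (3 + 2 * s)
        \<le> 1 / c * energy_density u (x, y)" if "y \<in> cell 0 x" for x y
    proof (cases "x = y")
      case False
      have n: "0 < norm (x - y)" "norm (x - y) \<le> 3" using False norm_diff_cell_le[OF that] by auto
      have "cmod (complex_of_real (cmod (u x)) - complex_of_real (cmod (u y))) = \<bar>cmod (u x) - cmod (u y)\<bar>"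
        by (simp flip: of_real_diff)
      then have 1: "(cmod (complex_of_real (cmod (u x)) - complex_of_real (cmod (u y))))\<^sup>2 \<le> (cmod (mag_diff A u x y))\<^sup>2"
        using diamagnetic[of u x y] by (intro power_mono) auto
      have 2: "norm (x - y) powr - (3 + 2 * s) \<le> 1 / c * kernel s m (norm (x - y))"
        using low[OF n] c by (simp add: field_simps)
      show ?thesis using mult_mono[OF 1 2] by (simp add: energy_density_def)
    qed (use c in \<open>simp add: energy_density_nonneg\<close>)
    have "local_energy s (\<lambda>x. complex_of_real (cmod (u x))) UNIV
       \<le> (\<integral>\<^sup>+x. (\<integral>\<^sup>+y. ennreal (1 / c) * ennreal (energy_density u (x, y)) \<partial>lborel) \<partial>lborel)"
      unfolding local_energy_def using pt c
      by (intro nn_integral_mono) (auto simp: indicator_def ennreal_mult[symmetric] energy_density_nonneg intro!: nn_integral_mono ennreal_leI)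
    also have "\<dots> = ennreal (1 / c) * mag_energy u"
      by (simp add: mag_energy_iterated nn_integral_cmult)
    finally show ?thesis .
  qed
  then show thesis using that[of "1 / c"] c by simp
qed

lemma norm_squared_mult_powr:
  "0 < n \<Longrightarrow> n\<^sup>2 * n powr - (3 + 2 * t) = n powr - (1 + 2 * t)" for n t :: real
proof -
  assume n: "0 < n"
  have "n powr 2 * n powr - (3 + 2 * t) = n powr - (1 + 2 * t)"
    unfolding powr_add[symmetric] by (simp add: algebra_simps)
  then show ?thesis using n by simp
qed

text \<open>On a box the field is bounded. The square of the error term of first order lowers the
  singularity of the weight from \<open>3 + 2 s\<close> to \<open>1 + 2 s\<close>, which is integrable in dimension three.\<close>
lemma local_energy_box_le:
  obtains K1 K2 where "0 \<le> K1" "0 \<le> K2" "\<And>u. u \<in> borel_measurable borel \<Longrightarrow>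
    local_energy s u (sbox R) \<le> ennreal K1 * mag_energy u + ennreal K2 * mass u"
proof -
  obtain c C where c: "0 < c" and "0 < C" and "\<And>r. 0 < r \<Longrightarrow> kernel s m r \<le> C * r powr - (3 + 2 * s)"
    and low: "\<And>r. 0 < r \<Longrightarrow> r \<le> 3 \<Longrightarrow> c * r powr - (3 + 2 * s) \<le> kernel s m r"
    using kernel_bounds[OF s(1) m] by metis
  have "compact (A ` cball 0 (3 * real R))"
    using A by (intro compact_continuous_image continuous_on_subset[OF A]) auto
  then obtain L where L: "0 < L" "\<And>x. x \<in> cball 0 (3 * real R) \<Longrightarrow> norm (A x) \<le> L"
    using compact_imp_bounded bounded_pos by (metis imageI)
  define k where "k h = norm h powr - (1 + 2 * s) * indicator (cball 0 3) h" for h :: R3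
  have km [measurable]: "k \<in> borel_measurable borel" unfolding k_def[abs_def] by measurable
  have "(\<integral>\<^sup>+h. ennreal (k h) \<partial>lborel) = (\<integral>\<^sup>+h\<in>cball 0 3. ennreal (norm (h :: R3) powr - (1 + 2 * s)) \<partial>lborel)"
    by (intro nn_integral_cong) (simp add: k_def indicator_def)
  also have "\<dots> < \<infinity>" using s by (intro norm_powr_integrable_near_0) auto
  finally obtain \<kappa> where \<kappa>: "0 \<le> \<kappa>" "(\<integral>\<^sup>+h. ennreal (k h) \<partial>lborel) = ennreal \<kappa>"
    by (cases "\<integral>\<^sup>+h. ennreal (k h) \<partial>lborel") auto
  have "local_energy s u (sbox R) \<le> ennreal (2 / c) * mag_energy u + ennreal (2 * L\<^sup>2 * \<kappa>) * mass u"
    if [measurable]: "u \<in> borel_measurable borel" for u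
  proof -
    have pt: "(cmod (u x - u y))\<^sup>2 * norm (x - y) powr - (3 + 2 * s)
        \<le> 2 / c * energy_density u (x, y) + 2 * L\<^sup>2 * (cmod (u x))\<^sup>2 * k (x - y)"
      if "y \<in> cell 0 x" "x \<in> sbox R" for x y
    proof (cases "x = y")
      case False
      have n: "0 < norm (x - y)" "norm (x - y) \<le> 3" using False norm_diff_cell_le[OF that(1)] by auto
      have "norm ((x + y) /\<^sub>R 2) \<le> 3 * real R"
        using norm_le_sbox[OF that(2)] norm_le_sbox[of y R] sbox_cell_iff[OF that(1)] that(2) norm_triangle_ineq[of x y] by simp
      then have LA: "norm (A ((x + y) /\<^sub>R 2)) \<le> L" by (intro L(2)) (simp add: dist_norm)
      have "(cmod (u x - u y))\<^sup>2 \<le> (cmod (mag_diff A u x y) + L * norm (x - y) * cmod (u x))\<^sup>2"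
        using diff_le_mag_diff(1)[OF LA] by (intro power_mono) auto
      also have "\<dots> \<le> 2 * (cmod (mag_diff A u x y))\<^sup>2 + 2 * (L * norm (x - y) * cmod (u x))\<^sup>2"
        by (rule sum_squared_le)
      finally have 1: "(cmod (u x - u y))\<^sup>2 * norm (x - y) powr - (3 + 2 * s)
        \<le> (2 * (cmod (mag_diff A u x y))\<^sup>2 + 2 * (L * norm (x - y) * cmod (u x))\<^sup>2) * norm (x - y) powr - (3 + 2 * s)"
        by (intro mult_right_mono) auto
      have 2: "norm (x - y) powr - (3 + 2 * s) \<le> 1 / c * kernel s m (norm (x - y))"
        using low[OF n] c by (simp add: field_simps)
      note 3 = norm_squared_mult_powr[OF n(1), of s]
      have "(2 * (cmod (mag_diff A u x y))\<^sup>2 + 2 * (L * norm (x - y) * cmod (u x))\<^sup>2) * norm (x - y) powr - (3 + 2 * s)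
        = 2 * (cmod (mag_diff A u x y))\<^sup>2 * norm (x - y) powr - (3 + 2 * s) + 2 * L\<^sup>2 * (cmod (u x))\<^sup>2 * ((norm (x - y))\<^sup>2 * norm (x - y) powr - (3 + 2 * s))"
        by (simp only: distrib_right distrib_left power_mult_distrib mult_ac)
      also have "\<dots> = 2 * (cmod (mag_diff A u x y))\<^sup>2 * norm (x - y) powr - (3 + 2 * s) + 2 * L\<^sup>2 * (cmod (u x))\<^sup>2 * k (x - y)"
        unfolding 3 using n by (simp add: k_def)
      also have "2 * (cmod (mag_diff A u x y))\<^sup>2 * norm (x - y) powr - (3 + 2 * s) \<le> 2 * (cmod (mag_diff A u x y))\<^sup>2 * (1 / c * kernel s m (norm (x - y)))"
        by (intro mult_left_mono 2) auto
      also have "\<dots> = 2 / c * energy_density u (x, y)" by (simp add: energy_density_def)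
      finally show ?thesis using 1 by linarith
    qed (use c in \<open>simp add: energy_density_nonneg k_def\<close>)
    define f where "f x = ennreal (2 * L\<^sup>2 * (cmod (u x))\<^sup>2)" for x
    have fm [measurable]: "f \<in> borel_measurable borel" unfolding f_def[abs_def] by measurable
    have "local_energy s u (sbox R)
       \<le> (\<integral>\<^sup>+x. (\<integral>\<^sup>+y. ennreal (2 / c) * ennreal (energy_density u (x, y)) + f x * ennreal (k (x - y)) \<partial>lborel) \<partial>lborel)"
      unfolding local_energy_def
    proof (intro nn_integral_mono, subst nn_integral_multc[symmetric], simp, intro nn_integral_mono)
      fix x y
      have "ennreal (2 / c * energy_density u (x, y) + 2 * L\<^sup>2 * (cmod (u x))\<^sup>2 * k (x - y))
          = ennreal (2 / c) * ennreal (energy_density u (x, y)) + f x * ennreal (k (x - y))"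
        using c energy_density_nonneg[of u "(x, y)"]
        by (subst ennreal_plus) (simp_all add: f_def k_def ennreal_mult[symmetric] del: ennreal_plus)
      then show "ennreal ((cmod (u x - u y))\<^sup>2 * norm (x - y) powr - (3 + 2 * s)) * indicator (cell 0 x) y * indicator (sbox R) x
          \<le> ennreal (2 / c) * ennreal (energy_density u (x, y)) + f x * ennreal (k (x - y))"
        using ennreal_leI[OF pt[of y x]] by (auto simp: indicator_def)
    qed
    also have "\<dots> = ennreal (2 / c) * mag_energy u + (\<integral>\<^sup>+x. f x \<partial>lborel) * ennreal \<kappa>"
      using nn_integral_convolution(1)[OF fm, of "\<lambda>h. ennreal (k h)"]
      by (simp add: nn_integral_add nn_integral_cmult mag_energy_iterated \<kappa>(2))
    also have "(\<integral>\<^sup>+x. f x \<partial>lborel) = ennreal (2 * L\<^sup>2) * mass u"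
      unfolding f_def by (subst nn_integral_cmult[symmetric]) (simp_all add: ennreal_mult)
    finally show ?thesis using \<kappa> by (simp add: ennreal_mult mult_ac)
  qed
  then show thesis using that[of "2 / c" "2 * L\<^sup>2 * \<kappa>"] c \<kappa> by simp
qed

end


lemma Ck_fun_add:
  "Ck_fun k f \<Longrightarrow> Ck_fun k g \<Longrightarrow> Ck_fun k (\<lambda>x. f x + g x)"
proof (induction k arbitrary: f g)
  case (Suc k)
  have "((\<lambda>x. f x + g x) has_derivative (\<lambda>v. frechet_derivative f (at x) v + frechet_derivative g (at x) v)) (at x)" for x
    using Suc.prems by (intro has_derivative_add frechet_derivative_works[THEN iffD1]) auto
  then have "frechet_derivative (\<lambda>x. f x + g x) (at x) = (\<lambda>v. frechet_derivative f (at x) v + frechet_derivative g (at x) v)" for x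
    by (rule frechet_derivative_at[symmetric])
  then show ?case using Suc by (simp add: differentiable_add)
qed (auto intro: continuous_on_add)

lemma Ck_fun_scale: "Ck_fun k f \<Longrightarrow> Ck_fun k (\<lambda>x. c * f x)"
proof (induction k arbitrary: f)
  case (Suc k)
  have d: "((\<lambda>x. c * f x) has_derivative (\<lambda>v. c * frechet_derivative f (at x) v)) (at x)" for x
    using Suc.prems by (intro has_derivative_mult_right frechet_derivative_works[THEN iffD1]) auto
  then have "frechet_derivative (\<lambda>x. c * f x) (at x) = (\<lambda>v. c * frechet_derivative f (at x) v)" for x
    by (rule frechet_derivative_at[symmetric])
  moreover have "(\<lambda>x. c * f x) differentiable (at x)" for x using d by (auto simp: differentiable_def)
  ultimately show ?case using Suc by simp
qed (auto intro: continuous_on_mult_left)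

lemma smooth_compact_support_add:
  assumes "f \<in> smooth_compact_support" "g \<in> smooth_compact_support"
  shows "(\<lambda>x. f x + g x) \<in> smooth_compact_support"
proof -
  have "bounded {x. f x \<noteq> 0}" "bounded {x. g x \<noteq> 0}"
    using assms by (auto simp: smooth_compact_support_def compact_closure)
  then have "bounded ({x. f x \<noteq> 0} \<union> {x. g x \<noteq> 0})" by simp
  then have "bounded {x. f x + g x \<noteq> 0}" by (rule bounded_subset) auto
  then show ?thesis using assms by (simp add: smooth_compact_support_def compact_closure Ck_fun_add)
qed

lemma smooth_compact_support_scale:
  assumes "f \<in> smooth_compact_support"
  shows "(\<lambda>x. c * f x) \<in> smooth_compact_support"
proof -
  have "bounded {x. f x \<noteq> 0}" using assms by (auto simp: smooth_compact_support_def compact_closure)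
  then have "bounded {x. c * f x \<noteq> 0}" by (rule bounded_subset) auto
  then show ?thesis using assms by (simp add: smooth_compact_support_def compact_closure Ck_fun_scale)
qed

lemma smooth_compact_support_borel:
  "f \<in> smooth_compact_support \<Longrightarrow> f \<in> borel_measurable borel"
proof -
  assume "f \<in> smooth_compact_support"
  then have "Ck_fun 0 f" unfolding smooth_compact_support_def by blast
  then show ?thesis by (intro borel_measurable_continuous_onI) simp
qed

text \<open>What is needed of a test function: bounded support, a bound, and a Lipschitz constant near
  the support, obtained from the continuity of the directional derivatives.\<close>
lemma test_function_bounds:
  assumes "\<phi> \<in> smooth_compact_support"
  obtains \<rho> M B where "0 < \<rho>" "0 \<le> M" "0 \<le> B" "\<And>x. \<rho> < norm x \<Longrightarrow> \<phi> x = 0" "\<And>x. cmod (\<phi> x) \<le> M"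
    "\<And>x y. norm x \<le> \<rho> + 1 \<Longrightarrow> norm y \<le> \<rho> + 1 \<Longrightarrow> cmod (\<phi> x - \<phi> y) \<le> B * norm (x - y)"
proof -
  have ck: "Ck_fun k \<phi>" for k using assms unfolding smooth_compact_support_def by blast
  have cont: "continuous_on UNIV \<phi>" using ck[of 0] by simp
  have diff: "\<phi> differentiable (at x)" for x using ck[of "Suc 0"] by simp
  have dcont: "continuous_on UNIV (\<lambda>x. frechet_derivative \<phi> (at x) v)" for v using ck[of "Suc 0"] by simp
  have "bounded {x. \<phi> x \<noteq> 0}" using assms by (auto simp: smooth_compact_support_def compact_closure)
  then obtain \<rho> where \<rho>: "0 < \<rho>" "\<And>x. \<phi> x \<noteq> 0 \<Longrightarrow> norm x \<le> \<rho>" by (auto simp: bounded_pos)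
  let ?S = "cball 0 (\<rho> + 1) :: R3 set"
  have "bounded (\<phi> ` ?S)"
    by (intro compact_imp_bounded compact_continuous_image continuous_on_subset[OF cont]) auto
  then obtain M where M: "0 < M" "\<And>x. x \<in> ?S \<Longrightarrow> cmod (\<phi> x) \<le> M" by (auto simp: bounded_pos)
  have "\<exists>b. \<forall>x\<in>?S. cmod (frechet_derivative \<phi> (at x) v) \<le> b" for v
  proof -
    have "bounded ((\<lambda>x. frechet_derivative \<phi> (at x) v) ` ?S)"
      by (intro compact_imp_bounded compact_continuous_image continuous_on_subset[OF dcont]) auto
    then show ?thesis by (auto simp: bounded_iff)
  qed
  then obtain b where b: "\<And>v x. x \<in> ?S \<Longrightarrow> cmod (frechet_derivative \<phi> (at x) v) \<le> b v" by metis
  define B where "B = (\<Sum>v\<in>Basis. b v)"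
  have on: "onorm (frechet_derivative \<phi> (at x)) \<le> B" if x: "x \<in> ?S" for x
  proof (rule onorm_le)
    fix v :: R3
    have lin: "linear (frechet_derivative \<phi> (at x))"
      using diff[of x] by (rule linear_frechet_derivative)
    have "frechet_derivative \<phi> (at x) v = frechet_derivative \<phi> (at x) (\<Sum>i\<in>Basis. (v \<bullet> i) *\<^sub>R i)"
      by (simp only: euclidean_representation)
    also have "\<dots> = (\<Sum>i\<in>Basis. (v \<bullet> i) *\<^sub>R frechet_derivative \<phi> (at x) i)"
      using lin by (simp add: linear_sum linear_scale)
    finally have "cmod (frechet_derivative \<phi> (at x) v) \<le> (\<Sum>i\<in>Basis. cmod ((v \<bullet> i) *\<^sub>R frechet_derivative \<phi> (at x) i))"
      by (simp only: norm_sum)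
    also have "\<dots> \<le> (\<Sum>i\<in>Basis. norm v * b i)"
    proof (rule sum_mono)
      fix i :: R3 assume i: "i \<in> Basis"
      have "\<bar>v \<bullet> i\<bar> * cmod (frechet_derivative \<phi> (at x) i) \<le> norm v * b i"
        using Basis_le_norm[OF i] b[OF x] by (intro mult_mono) auto
      then show "cmod ((v \<bullet> i) *\<^sub>R frechet_derivative \<phi> (at x) i) \<le> norm v * b i" by simp
    qed
    also have "\<dots> = B * norm v" by (simp add: B_def sum_distrib_left mult.commute)
    finally show "cmod (frechet_derivative \<phi> (at x) v) \<le> B * norm v" .
  qed
  have B0: "0 \<le> B"
  proof -
    have "0 \<le> onorm (frechet_derivative \<phi> (at 0))"
      by (intro onorm_pos_le has_derivative_bounded_linear[OF frechet_derivative_works[THEN iffD1, OF diff]])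
    then show ?thesis using on[of 0] \<rho> by simp
  qed
  show thesis
  proof (rule that[OF \<rho>(1) less_imp_le[OF M(1)] B0])
    show zero: "\<phi> x = 0" if "\<rho> < norm x" for x using \<rho>(2)[of x] that by force
    show "cmod (\<phi> x) \<le> M" for x
      using M zero[of x] by (cases "\<rho> < norm x") (auto simp: dist_norm less_imp_le)
    show "cmod (\<phi> x - \<phi> y) \<le> B * norm (x - y)" if "norm x \<le> \<rho> + 1" "norm y \<le> \<rho> + 1" for x y
    proof (rule differentiable_bound[of ?S \<phi> "\<lambda>x. frechet_derivative \<phi> (at x)"])
      show "(\<phi> has_derivative frechet_derivative \<phi> (at z)) (at z within ?S)" for z
        by (rule has_derivative_at_withinI) (rule frechet_derivative_works[THEN iffD1, OF diff])
      show "onorm (frechet_derivative \<phi> (at z)) \<le> B" if "z \<in> ?S" for z using that by (rule on)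
      show "x \<in> ?S" "y \<in> ?S" using that by simp_all
    qed simp
  qed
qed

context magnetic_form
begin

text \<open>For close points the magnetic difference is Lipschitz small and vanishes away from the
  support; for distant points the triangle inequality suffices, because the kernel is integrable
  at infinity. Both cases have the shape of a function of one variable times a function of the
  difference.\<close>
lemma test_function_mag_form_finite:
  assumes "\<phi> \<in> smooth_compact_support"
  shows "mag_form \<phi> < \<infinity>"
proof -
  note [measurable] = smooth_compact_support_borel[OF assms]
  obtain \<rho> M B where \<rho>: "0 < \<rho>" and M: "0 \<le> M" and B: "0 \<le> B"
    and supp: "\<And>x. \<rho> < norm x \<Longrightarrow> \<phi> x = 0" and bd: "\<And>x. cmod (\<phi> x) \<le> M"
    and lip: "\<And>x y. norm x \<le> \<rho> + 1 \<Longrightarrow> norm y \<le> \<rho> + 1 \<Longrightarrow> cmod (\<phi> x - \<phi> y) \<le> B * norm (x - y)"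
    by (rule test_function_bounds[OF assms]) (rule that)
  obtain c C where C: "0 < C" and up: "\<And>r. 0 < r \<Longrightarrow> kernel s m r \<le> C * r powr - (3 + 2 * s)"
    using kernel_bounds[OF s(1) m] by metis
  have "compact (A ` cball 0 (\<rho> + 1))"
    by (intro compact_continuous_image continuous_on_subset[OF A]) auto
  then obtain L where L: "0 < L" "\<And>x. x \<in> cball 0 (\<rho> + 1) \<Longrightarrow> norm (A x) \<le> L"
    using compact_imp_bounded bounded_pos by (metis imageI)
  define D where "D = B + L * M"
  have D: "0 \<le> D" using B L M by (simp add: D_def)
  let ?S = "cball 0 (\<rho> + 1) :: R3 set"
  define near far :: "R3 \<Rightarrow> real" where "near h = norm h powr - (1 + 2 * s) * indicator (cball 0 1) h"
    and "far h = norm h powr - (3 + 2 * s) * indicator (- cball 0 1) h" for h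
  have [measurable]: "near \<in> borel_measurable borel" "far \<in> borel_measurable borel"
    unfolding near_def[abs_def] far_def[abs_def] by measurable
  have en: "(\<lambda>h. ennreal (near h)) \<in> borel_measurable borel" and ef: "(\<lambda>h. ennreal (far h)) \<in> borel_measurable borel"
    by measurable
  have nonneg: "0 \<le> near h" "0 \<le> far h" for h by (simp_all add: near_def far_def)
  have mass: "mass \<phi> < \<infinity>"
  proof -
    have "mass \<phi> \<le> (\<integral>\<^sup>+x. ennreal (M\<^sup>2) * indicator ?S x \<partial>lborel)"
    proof (rule nn_integral_mono)
      fix x show "ennreal ((cmod (\<phi> x))\<^sup>2) \<le> ennreal (M\<^sup>2) * indicator ?S x"
        using supp[of x] power_mono[OF bd[of x], of 2] by (cases "x \<in> ?S") (auto simp: ennreal_leI)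
    qed
    also have "\<dots> = ennreal (M\<^sup>2) * emeasure lborel ?S" by (rule nn_integral_cmult_indicator) simp
    also have "\<dots> < \<infinity>" using \<rho> by (simp add: emeasure_cball_R3 ennreal_mult_less_top)
    finally show ?thesis .
  qed
  have pt: "energy_density \<phi> (x, y) \<le> C * D\<^sup>2 * indicator ?S x * near (x - y)
      + 2 * C * (cmod (\<phi> x))\<^sup>2 * far (x - y) + 2 * C * (cmod (\<phi> y))\<^sup>2 * far (x - y)" for x y
  proof (cases "x = y")
    case True
    then show ?thesis using C by (simp add: energy_density_def mag_diff_def nonneg)
  next
    case False
    then have n: "0 < norm (x - y)" by simp
    show ?thesis
    proof (cases "norm (x - y) \<le> 1")
      case close: True
      show ?thesis
      \<comment> \<open>If one of two points at distance at most \<open>1\<close> lies in the support, both lie in the larger ball \<open>?S\<close>.\<close>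
      proof (cases "x \<in> ?S \<and> y \<in> ?S")
        case True
        then have xy: "norm x \<le> \<rho> + 1" "norm y \<le> \<rho> + 1" by auto
        then have "norm ((x + y) /\<^sub>R 2) \<le> \<rho> + 1" using norm_triangle_ineq[of x y] by simp
        then have LA: "norm (A ((x + y) /\<^sub>R 2)) \<le> L" by (intro L(2)) (simp add: dist_norm)
        have "cmod (mag_diff A \<phi> x y) \<le> cmod (\<phi> x - \<phi> y) + L * norm (x - y) * cmod (\<phi> x)"
          by (rule diff_le_mag_diff(2)[OF LA])
        also have "\<dots> \<le> B * norm (x - y) + L * norm (x - y) * M"
          using L by (intro add_mono lip xy mult_left_mono bd) auto
        also have "\<dots> = D * norm (x - y)" by (simp add: D_def algebra_simps)
        finally have "(cmod (mag_diff A \<phi> x y))\<^sup>2 \<le> (D * norm (x - y))\<^sup>2" by (intro power_mono) auto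
        then have "energy_density \<phi> (x, y) \<le> (D * norm (x - y))\<^sup>2 * (C * norm (x - y) powr - (3 + 2 * s))"
          unfolding energy_density_def fst_conv snd_conv using up[OF n] kernel_nonneg by (intro mult_mono) auto
        also have "\<dots> = C * D\<^sup>2 * ((norm (x - y))\<^sup>2 * norm (x - y) powr - (3 + 2 * s))"
          by (simp only: power_mult_distrib mult_ac)
        also note norm_squared_mult_powr[OF n]
        finally show ?thesis using close True by (simp add: near_def far_def indicator_def)
      next
        case False
        have "\<rho> < norm x \<and> \<rho> < norm y"
          using False close norm_triangle_sub[of x y] norm_triangle_sub[of y x] by (auto simp: norm_minus_commute)
        then have "mag_diff A \<phi> x y = 0" by (simp add: mag_diff_def supp)
        then show ?thesis using C by (simp add: energy_density_def nonneg)
      qed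
    next
      case apart: False
      have "cmod (mag_diff A \<phi> x y) \<le> cmod (\<phi> x) + cmod (\<phi> y)"
        unfolding mag_diff_def using norm_triangle_ineq4[of "exp (- \<i> * complex_of_real ((x - y) \<bullet> A ((x + y) /\<^sub>R 2))) * \<phi> x" "\<phi> y"]
        by (simp only: norm_mult cmod_phase mult_1)
      then have "(cmod (mag_diff A \<phi> x y))\<^sup>2 \<le> (cmod (\<phi> x) + cmod (\<phi> y))\<^sup>2" by (intro power_mono) auto
      also have "\<dots> \<le> 2 * (cmod (\<phi> x))\<^sup>2 + 2 * (cmod (\<phi> y))\<^sup>2" by (rule sum_squared_le)
      finally have "energy_density \<phi> (x, y) \<le> (2 * (cmod (\<phi> x))\<^sup>2 + 2 * (cmod (\<phi> y))\<^sup>2) * (C * norm (x - y) powr - (3 + 2 * s))"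
        unfolding energy_density_def fst_conv snd_conv using up[OF n] kernel_nonneg by (intro mult_mono) auto
      also have "\<dots> = 2 * C * (cmod (\<phi> x))\<^sup>2 * far (x - y) + 2 * C * (cmod (\<phi> y))\<^sup>2 * far (x - y)"
        using apart by (simp add: far_def indicator_def distrib_right)
      finally show ?thesis using apart by (simp add: near_def far_def indicator_def)
    qed
  qed
  have near_fin: "(\<integral>\<^sup>+h. ennreal (near h) \<partial>lborel) < \<infinity>"
  proof -
    have "(\<integral>\<^sup>+h. ennreal (near h) \<partial>lborel) = (\<integral>\<^sup>+h\<in>cball 0 1. ennreal (norm (h :: R3) powr - (1 + 2 * s)) \<partial>lborel)"
      by (intro nn_integral_cong) (simp add: near_def far_def indicator_def)
    also have "\<dots> < \<infinity>" using s by (intro norm_powr_integrable_near_0) auto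
    finally show ?thesis .
  qed
  have far_fin: "(\<integral>\<^sup>+h. ennreal (far h) \<partial>lborel) < \<infinity>"
  proof -
    have "(\<integral>\<^sup>+h. ennreal (far h) \<partial>lborel) = (\<integral>\<^sup>+h\<in>- cball 0 1. ennreal (norm (h :: R3) powr - (3 + 2 * s)) \<partial>lborel)"
      by (intro nn_integral_cong) (simp add: near_def far_def indicator_def)
    also have "\<dots> < \<infinity>" using s by (intro norm_powr_integrable_at_infinity) auto
    finally show ?thesis .
  qed
  define f g where "f x = ennreal (C * D\<^sup>2 * indicator ?S x)" and "g x = ennreal (2 * C * (cmod (\<phi> x))\<^sup>2)" for x
  have fg [measurable]: "f \<in> borel_measurable borel" "g \<in> borel_measurable borel"
    unfolding f_def[abs_def] g_def[abs_def] by measurable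
  have "mag_energy \<phi> \<le> (\<integral>\<^sup>+x. (\<integral>\<^sup>+y. f x * ennreal (near (x - y)) + g x * ennreal (far (x - y)) + g y * ennreal (far (x - y)) \<partial>lborel) \<partial>lborel)"
    unfolding mag_energy_iterated[OF smooth_compact_support_borel[OF assms]]
  proof (intro nn_integral_mono)
    fix x y
    have "f x * ennreal (near (x - y)) + g x * ennreal (far (x - y)) + g y * ennreal (far (x - y)) = ennreal (C * D\<^sup>2 * indicator ?S x * near (x - y)
      + 2 * C * (cmod (\<phi> x))\<^sup>2 * far (x - y) + 2 * C * (cmod (\<phi> y))\<^sup>2 * far (x - y))"
      using C by (simp add: f_def g_def ennreal_plus ennreal_mult nonneg)
    then show "ennreal (energy_density \<phi> (x, y)) \<le> f x * ennreal (near (x - y)) + g x * ennreal (far (x - y)) + g y * ennreal (far (x - y))"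
      using ennreal_leI[OF pt] by simp
  qed
  also have "\<dots> = (\<integral>\<^sup>+x. (\<integral>\<^sup>+y. f x * ennreal (near (x - y)) \<partial>lborel) \<partial>lborel)
     + (\<integral>\<^sup>+x. (\<integral>\<^sup>+y. g x * ennreal (far (x - y)) \<partial>lborel) \<partial>lborel) + (\<integral>\<^sup>+x. (\<integral>\<^sup>+y. g y * ennreal (far (x - y)) \<partial>lborel) \<partial>lborel)"
    by (simp add: nn_integral_add)
  also have "\<dots> = (\<integral>\<^sup>+x. f x \<partial>lborel) * (\<integral>\<^sup>+h. ennreal (near h) \<partial>lborel)
     + (\<integral>\<^sup>+x. g x \<partial>lborel) * (\<integral>\<^sup>+h. ennreal (far h) \<partial>lborel) + (\<integral>\<^sup>+x. g x \<partial>lborel) * (\<integral>\<^sup>+h. ennreal (far h) \<partial>lborel)"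
    by (simp only: nn_integral_convolution[OF fg(1) en] nn_integral_convolution[OF fg(2) ef])
  also have "\<dots> < \<infinity>"
  proof -
    have "(\<integral>\<^sup>+x. f x \<partial>lborel) = ennreal (C * D\<^sup>2) * emeasure lborel ?S"
      by (subst nn_integral_cmult_indicator[symmetric]) (auto simp: f_def indicator_def intro!: nn_integral_cong)
    moreover have "(\<integral>\<^sup>+x. g x \<partial>lborel) = ennreal (2 * C) * mass \<phi>"
      unfolding g_def using C by (subst nn_integral_cmult[symmetric]) (simp_all add: ennreal_mult)
    ultimately show ?thesis
      using near_fin far_fin mass \<rho> by (auto simp: ennreal_mult_less_top emeasure_cball_R3)
  qed
  finally show ?thesis using mass by (simp add: mag_form_finite_iff[of \<phi>, simplified])
qed

end

section \<open>The magnetic Sobolev space\<close>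

context magnetic_form
begin

lemma mag_form_minus_test_finite:
  assumes u: "u \<in> borel_measurable lebesgue" and fin: "mag_form u < \<infinity>" and \<phi>: "\<phi> \<in> smooth_compact_support"
  shows "(\<lambda>x. u x - \<phi> x) \<in> borel_measurable lebesgue" "mag_form (\<lambda>x. u x - \<phi> x) < \<infinity>"
proof -
  note \<phi>m = smooth_compact_support_borel[OF \<phi>]
  have "\<phi> \<in> borel_measurable lebesgue" by (rule measurable_completion) (use \<phi>m in simp)
  then show "(\<lambda>x. u x - \<phi> x) \<in> borel_measurable lebesgue" using u by simp
  obtain v where v: "v \<in> borel_measurable borel" "AE x in lborel. u x = v x"
    using borel_representative[OF u] by blast
  have "mag_form (\<lambda>x. u x - \<phi> x) = mag_form (\<lambda>x. v x - \<phi> x)"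
    using v(2) by (intro mag_form_cong_AE, eventually_elim) simp
  also have "\<dots> \<le> 2 * mag_form v + 2 * mag_form \<phi>" by (rule mag_form_diff_le[OF v(1) \<phi>m])
  also have "\<dots> < \<infinity>"
    using fin test_function_mag_form_finite[OF \<phi>] mag_form_cong_AE[OF v(2)] by (simp add: ennreal_mult_less_top)
  finally show "mag_form (\<lambda>x. u x - \<phi> x) < \<infinity>" .
qed

text \<open>Membership in terms of the extended form. Test functions have finite form, so that the
  distances to them are genuine.\<close>
lemma HsA_iff:
  "u \<in> HsA s m A \<longleftrightarrow> u \<in> borel_measurable lebesgue \<and> mag_form u < \<infinity> \<and>
     (\<forall>\<epsilon>>0. \<exists>\<phi>\<in>smooth_compact_support. mag_form (\<lambda>x. u x - \<phi> x) < ennreal \<epsilon>)"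
proof (cases "u \<in> borel_measurable lebesgue \<and> mag_form u < \<infinity>")
  case True
  then have u: "u \<in> borel_measurable lebesgue" and fin: "mag_form u < \<infinity>" by auto
  have norm: "mag_norm s m A (\<lambda>x. u x - \<phi> x) < e \<longleftrightarrow> mag_form (\<lambda>x. u x - \<phi> x) < ennreal (e\<^sup>2)"
    if \<phi>: "\<phi> \<in> smooth_compact_support" and e: "0 < e" for \<phi> e
  proof -
    note d = mag_form_minus_test_finite[OF u fin \<phi>]
    obtain t where t: "0 \<le> t" "mag_form (\<lambda>x. u x - \<phi> x) = ennreal t"
      using d(2) by (cases "mag_form (\<lambda>x. u x - \<phi> x)") auto
    have "mag_norm s m A (\<lambda>x. u x - \<phi> x) = sqrt t"
      using mag_space_and_norm(2)[OF d] t by simp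
    moreover have "sqrt t < e \<longleftrightarrow> t < e\<^sup>2"
      using e t real_sqrt_less_iff[of t "e\<^sup>2"] by simp
    ultimately show ?thesis using t by (simp add: ennreal_less_iff)
  qed
  have "(\<forall>\<epsilon>>0. \<exists>\<phi>\<in>smooth_compact_support. mag_norm s m A (\<lambda>x. u x - \<phi> x) < \<epsilon>)
    \<longleftrightarrow> (\<forall>\<epsilon>>0. \<exists>\<phi>\<in>smooth_compact_support. mag_form (\<lambda>x. u x - \<phi> x) < ennreal \<epsilon>)" (is "?L \<longleftrightarrow> ?R")
  proof
    assume L: ?L
    show ?R
    proof (intro allI impI)
      fix e :: real assume e: "0 < e"
      then obtain \<phi> where "\<phi> \<in> smooth_compact_support" "mag_norm s m A (\<lambda>x. u x - \<phi> x) < sqrt e"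
        using L real_sqrt_gt_zero by blast
      then show "\<exists>\<phi>\<in>smooth_compact_support. mag_form (\<lambda>x. u x - \<phi> x) < ennreal e"
        using norm[of \<phi> "sqrt e"] e by auto
    qed
  next
    assume R: ?R
    show ?L
    proof (intro allI impI)
      fix e :: real assume e: "0 < e"
      then obtain \<phi> where "\<phi> \<in> smooth_compact_support" "mag_form (\<lambda>x. u x - \<phi> x) < ennreal (e\<^sup>2)"
        using R zero_less_power[of e 2] by blast
      then show "\<exists>\<phi>\<in>smooth_compact_support. mag_norm s m A (\<lambda>x. u x - \<phi> x) < e"
        using norm[of \<phi> e] e by auto
    qed
  qed
  then show ?thesis using u fin mag_space_and_norm(1)[OF u] unfolding HsA_def by blast
next
  case False
  then have "u \<notin> mag_space s m A" using mag_space_and_norm(1)[of u] by (auto simp: mag_space_def)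
  then show ?thesis using False unfolding HsA_def by blast
qed

lemma HsA_cong_AE:
  assumes "u \<in> HsA s m A" "AE x in lborel. u x = v x"
  shows "v \<in> HsA s m A"
proof -
  have "mag_form (\<lambda>x. v x - \<phi> x) = mag_form (\<lambda>x. u x - \<phi> x)" for \<phi>
    using assms(2) by (intro mag_form_cong_AE, eventually_elim) simp
  moreover have "mag_form v = mag_form u" using mag_form_cong_AE[OF assms(2)] by simp
  moreover have "v \<in> borel_measurable lebesgue"
    using assms(1) lebesgue_measurable_AE[OF _ assms(2)] by (simp add: HsA_iff)
  ultimately show ?thesis using assms(1) unfolding HsA_iff by simp
qed

lemma ennreal_two_two_less:
  assumes "a < ennreal (e / 4)" "b < ennreal (e / 4)" "0 < e"
  shows "2 * a + 2 * b < ennreal e"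
proof -
  obtain x y where xy: "a = ennreal x" "0 \<le> x" "b = ennreal y" "0 \<le> y"
    using assms by (cases a; cases b) auto
  have "x < e / 4" "y < e / 4" using assms xy by (simp_all add: ennreal_less_iff)
  then have "2 * x + 2 * y < e" by simp
  have "2 * a + 2 * b = ennreal (2 * x + 2 * y)" using xy by (simp add: ennreal_mult ennreal_plus)
  also have "\<dots> < ennreal e" by (rule ennreal_lessI[OF assms(3)]) fact
  finally show ?thesis .
qed

lemma HsA_add:
  assumes u: "u \<in> borel_measurable borel" "u \<in> HsA s m A" and v: "v \<in> borel_measurable borel" "v \<in> HsA s m A"
  shows "(\<lambda>x. u x + v x) \<in> HsA s m A"
  unfolding HsA_iff
proof (intro conjI allI impI)
  show "(\<lambda>x. u x + v x) \<in> borel_measurable lebesgue"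
    by (rule measurable_completion) (use u(1) v(1) in simp)
  have "mag_form u < \<infinity>" "mag_form v < \<infinity>" using u v by (auto simp: HsA_iff)
  then have "2 * mag_form u + 2 * mag_form v < \<infinity>" by (simp add: ennreal_mult_less_top)
  then show "mag_form (\<lambda>x. u x + v x) < \<infinity>" by (rule order_le_less_trans[OF mag_form_add_le[OF u(1) v(1)]])
  fix e :: real assume e: "0 < e"
  then have "0 < e / 4" by simp
  then obtain \<phi> \<psi> where \<phi>: "\<phi> \<in> smooth_compact_support" "mag_form (\<lambda>x. u x - \<phi> x) < ennreal (e / 4)"
    and \<psi>: "\<psi> \<in> smooth_compact_support" "mag_form (\<lambda>x. v x - \<psi> x) < ennreal (e / 4)"
    using u(2) v(2) unfolding HsA_iff by meson
  note [measurable] = smooth_compact_support_borel[OF \<phi>(1)] smooth_compact_support_borel[OF \<psi>(1)] u(1) v(1)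
  have "mag_form (\<lambda>x. (u x - \<phi> x) + (v x - \<psi> x)) \<le> 2 * mag_form (\<lambda>x. u x - \<phi> x) + 2 * mag_form (\<lambda>x. v x - \<psi> x)"
    by (intro mag_form_add_le) measurable
  also have "\<dots> < ennreal e" by (rule ennreal_two_two_less[OF \<phi>(2) \<psi>(2) e])
  also have "(\<lambda>x. (u x - \<phi> x) + (v x - \<psi> x)) = (\<lambda>x. u x + v x - (\<phi> x + \<psi> x))" by (simp add: fun_eq_iff)
  finally show "\<exists>\<phi>\<in>smooth_compact_support. mag_form (\<lambda>x. u x + v x - \<phi> x) < ennreal e"
    using smooth_compact_support_add[OF \<phi>(1) \<psi>(1)] by (intro bexI[of _ "\<lambda>x. \<phi> x + \<psi> x"])
qed

lemma HsA_scale: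
  assumes u: "u \<in> borel_measurable borel" "u \<in> HsA s m A"
  shows "(\<lambda>x. c * u x) \<in> HsA s m A"
  unfolding HsA_iff
proof (intro conjI allI impI)
  show "(\<lambda>x. c * u x) \<in> borel_measurable lebesgue"
    by (rule measurable_completion) (use u(1) in simp)
  have "mag_form u < \<infinity>" using u by (auto simp: HsA_iff)
  then show "mag_form (\<lambda>x. c * u x) < \<infinity>" by (simp add: mag_form_scale[OF u(1)] ennreal_mult_less_top)
  fix e :: real assume e: "0 < e"
  define d where "d = e / ((cmod c)\<^sup>2 + 1)"
  have p: "0 < (cmod c)\<^sup>2 + 1" by (rule add_nonneg_pos) auto
  have d: "0 < d" using e p by (simp add: d_def)
  then obtain \<phi> where \<phi>: "\<phi> \<in> smooth_compact_support" "mag_form (\<lambda>x. u x - \<phi> x) < ennreal d"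
    using u(2) unfolding HsA_iff by meson
  note [measurable] = smooth_compact_support_borel[OF \<phi>(1)] u(1)
  have "(\<lambda>x. c * u x - c * \<phi> x) = (\<lambda>x. c * (u x - \<phi> x))" by (simp add: fun_eq_iff algebra_simps)
  then have "mag_form (\<lambda>x. c * u x - c * \<phi> x) = ennreal ((cmod c)\<^sup>2) * mag_form (\<lambda>x. u x - \<phi> x)"
    using mag_form_scale[of "\<lambda>x. u x - \<phi> x" c] by simp
  also have "\<dots> \<le> ennreal ((cmod c)\<^sup>2) * ennreal d" by (intro mult_left_mono less_imp_le[OF \<phi>(2)]) auto
  also have "\<dots> = ennreal ((cmod c)\<^sup>2 * d)" using d by (simp add: ennreal_mult)
  also have "\<dots> < ennreal e"
  proof -
    have "(cmod c)\<^sup>2 * d < ((cmod c)\<^sup>2 + 1) * d" using d by (intro mult_strict_right_mono) auto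
    also have "\<dots> = e" using p by (simp add: d_def)
    finally show ?thesis using d by (intro ennreal_lessI e)
  qed
  finally show "\<exists>\<phi>\<in>smooth_compact_support. mag_form (\<lambda>x. c * u x - \<phi> x) < ennreal e"
    using smooth_compact_support_scale[OF \<phi>(1)] by (intro bexI[of _ "\<lambda>x. c * \<phi> x"])
qed

lemma HsA_closed:
  assumes w: "w \<in> borel_measurable borel"
    and approx: "\<And>e. 0 < e \<Longrightarrow> \<exists>u. u \<in> borel_measurable borel \<and> u \<in> HsA s m A \<and> mag_form (\<lambda>x. w x - u x) < ennreal e"
  shows "w \<in> HsA s m A"
  unfolding HsA_iff
proof (intro conjI allI impI)
  show "w \<in> borel_measurable lebesgue" by (rule measurable_completion) (use w in simp)
  obtain u where u: "u \<in> borel_measurable borel" "u \<in> HsA s m A" "mag_form (\<lambda>x. w x - u x) < ennreal 1"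
    using approx[of 1] by auto
  have "mag_form (\<lambda>x. (w x - u x) + u x) \<le> 2 * mag_form (\<lambda>x. w x - u x) + 2 * mag_form u"
    by (intro mag_form_add_le) (use u w in simp_all)
  also have "\<dots> < \<infinity>"
  proof -
    have "mag_form (\<lambda>x. w x - u x) < \<infinity>" using u(3) by (rule less_trans) simp
    moreover have "mag_form u < \<infinity>" using u(2) by (simp add: HsA_iff)
    ultimately show ?thesis by (simp add: ennreal_mult_less_top)
  qed
  finally show "mag_form w < \<infinity>" by simp
  fix e :: real assume e: "0 < e"
  then obtain u where u: "u \<in> borel_measurable borel" "u \<in> HsA s m A" "mag_form (\<lambda>x. w x - u x) < ennreal (e / 4)"
    using approx[of "e / 4"] by auto
  obtain \<phi> where \<phi>: "\<phi> \<in> smooth_compact_support" "mag_form (\<lambda>x. u x - \<phi> x) < ennreal (e / 4)"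
    using u(2) e unfolding HsA_iff by (meson divide_pos_pos zero_less_numeral)
  note [measurable] = smooth_compact_support_borel[OF \<phi>(1)] u(1) w
  have "mag_form (\<lambda>x. (w x - u x) + (u x - \<phi> x)) \<le> 2 * mag_form (\<lambda>x. w x - u x) + 2 * mag_form (\<lambda>x. u x - \<phi> x)"
    by (intro mag_form_add_le) measurable
  also have "\<dots> < ennreal e" by (rule ennreal_two_two_less[OF u(3) \<phi>(2) e])
  finally show "\<exists>\<phi>\<in>smooth_compact_support. mag_form (\<lambda>x. w x - \<phi> x) < ennreal e"
    using \<phi>(1) by auto
qed

lemma test_function_HsA:
  assumes "\<phi> \<in> smooth_compact_support"
  shows "\<phi> \<in> HsA s m A"
proof -
  have "mag_form (\<lambda>x. 0) = 0"
    by (simp add: mag_form_def mag_energy_def energy_density_def mag_diff_def)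
  moreover have "\<phi> \<in> borel_measurable lebesgue"
    by (rule measurable_completion) (use smooth_compact_support_borel[OF assms] in simp)
  ultimately show ?thesis
    using assms test_function_mag_form_finite[OF assms] unfolding HsA_iff
    by (auto intro!: bexI[of _ \<phi>])
qed

end

section \<open>A radial test function\<close>

text \<open>The factor \<open>(1 / t) ^ j\<close> is included because the derivatives of \<open>exp (- 1 / t)\<close> are
  combinations of these functions.\<close>
definition flat_exp :: "nat \<Rightarrow> real \<Rightarrow> real" where
  "flat_exp j t = (if t \<le> 0 then 0 else (1 / t) ^ j * exp (- (1 / t)))"

lemma flat_exp_bound: "\<bar>flat_exp j t\<bar> \<le> real (j + 2) powr real (j + 2) * t\<^sup>2"
proof (cases "0 < t")
  case True
  have "(1 / t) powr real (j + 2) * exp (- (1 / t)) \<le> real (j + 2) powr real (j + 2)"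
    using True by (intro powr_mult_exp_neg_le) auto
  then have "(1 / t) ^ (j + 2) * exp (- (1 / t)) \<le> real (j + 2) powr real (j + 2)"
    using True by (subst (asm) powr_realpow) auto
  then have "(1 / t) ^ (j + 2) * exp (- (1 / t)) * t\<^sup>2 \<le> real (j + 2) powr real (j + 2) * t\<^sup>2"
    by (rule mult_right_mono) simp
  moreover have "(1 / t) ^ (j + 2) * exp (- (1 / t)) * t\<^sup>2 = flat_exp j t"
    using True by (simp add: flat_exp_def power_add power2_eq_square field_simps)
  moreover have "0 \<le> flat_exp j t" using True by (simp add: flat_exp_def)
  ultimately show ?thesis by simp
qed (simp add: flat_exp_def)

text \<open>At \<open>t = 0\<close> the derivative vanishes because the function is dominated by a multiple of
  \<open>t\<^sup>2\<close>.\<close>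
lemma flat_exp_deriv:
  "(flat_exp j has_real_derivative - real j * flat_exp (Suc j) t + flat_exp (j + 2) t) (at t)"
proof -
  consider "t < 0" | "t = 0" | "0 < t" by linarith
  then show ?thesis
  proof cases
    case 1
    have "((\<lambda>t. 0) has_real_derivative 0) (at t)" by simp
    then have "(flat_exp j has_real_derivative 0) (at t)"
      by (rule has_field_derivative_transform_within[where d = "- t"]) (use 1 in \<open>auto simp: flat_exp_def dist_real_def\<close>)
    then show ?thesis using 1 by (simp add: flat_exp_def)
  next
    case 2
    let ?C = "real (j + 2) powr real (j + 2)"
    have "(\<lambda>h. (flat_exp j (0 + h) - flat_exp j 0) / h) \<midarrow>0\<rightarrow> 0"
    proof (rule Lim_null_comparison)
      show "\<forall>\<^sub>F h in at 0. norm ((flat_exp j (0 + h) - flat_exp j 0) / h) \<le> ?C * \<bar>h\<bar>"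
      proof (rule always_eventually, rule allI)
        fix h :: real
        have "\<bar>flat_exp j h\<bar> / \<bar>h\<bar> \<le> ?C * h\<^sup>2 / \<bar>h\<bar>" by (rule divide_right_mono[OF flat_exp_bound]) simp
        also have "\<dots> = ?C * \<bar>h\<bar>" by (cases "h = 0") (auto simp: power2_eq_square abs_if)
        finally show "norm ((flat_exp j (0 + h) - flat_exp j 0) / h) \<le> ?C * \<bar>h\<bar>" by (simp add: flat_exp_def[of _ 0])
      qed
      have "(\<lambda>h::real. ?C * \<bar>h\<bar>) \<midarrow>0\<rightarrow> ?C * \<bar>0\<bar>" by (intro tendsto_intros)
      then show "(\<lambda>h::real. ?C * \<bar>h\<bar>) \<midarrow>0\<rightarrow> 0" by simp
    qed
    then have "(flat_exp j has_real_derivative 0) (at 0)" by (simp add: DERIV_def)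
    then show ?thesis using 2 by (simp add: flat_exp_def[of _ 0])
  next
    case 3
    have "((\<lambda>t. (1 / t) ^ j * exp (- (1 / t))) has_real_derivative - real j * flat_exp (Suc j) t + flat_exp (j + 2) t) (at t)"
    proof -
      have d1: "((\<lambda>t. 1 / t) has_real_derivative - (1 / t)\<^sup>2) (at t)"
        using 3 by (auto intro!: derivative_eq_intros simp: power2_eq_square)
      have d2: "((\<lambda>t. (1 / t) ^ j) has_real_derivative real j * (- (1 / t)\<^sup>2 * (1 / t) ^ (j - Suc 0))) (at t)"
        by (rule DERIV_power[OF d1])
      have d3: "((\<lambda>t. exp (- (1 / t))) has_real_derivative exp (- (1 / t)) * (1 / t)\<^sup>2) (at t)"
        using DERIV_fun_exp[OF DERIV_minus[OF d1]] by simp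
      have e: "real j * ((1 / t)\<^sup>2 * (1 / t) ^ (j - Suc 0)) = real j * (1 / t) ^ Suc j"
        by (cases j) (simp_all add: power2_eq_square)
      have "real j * (- (1 / t)\<^sup>2 * (1 / t) ^ (j - Suc 0)) * exp (- (1 / t)) + exp (- (1 / t)) * (1 / t)\<^sup>2 * (1 / t) ^ j
          = - (real j * ((1 / t)\<^sup>2 * (1 / t) ^ (j - Suc 0))) * exp (- (1 / t)) + (1 / t) ^ (j + 2) * exp (- (1 / t))"
        by (simp only: power_add) (simp add: mult_ac)
      also have "\<dots> = - real j * flat_exp (Suc j) t + flat_exp (j + 2) t"
        unfolding e using 3 by (simp add: flat_exp_def)
      finally show ?thesis using DERIV_mult[OF d2 d3] by (simp only: mult_ac)
    qed
    then show ?thesis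
      by (rule has_field_derivative_transform_within[where d = t]) (use 3 in \<open>auto simp: flat_exp_def dist_real_def\<close>)
  qed
qed

text \<open>A class that contains the standard bump and is closed under directional derivatives
  (\<open>bump_class_derivative\<close>); hence all its members are smooth.\<close>
inductive bump_class :: "(R3 \<Rightarrow> complex) \<Rightarrow> bool" where
  base: "bump_class (\<lambda>x. complex_of_real (flat_exp j (1 - x \<bullet> x)))"
| add: "bump_class f \<Longrightarrow> bump_class g \<Longrightarrow> bump_class (\<lambda>x. f x + g x)"
| scale: "bump_class f \<Longrightarrow> bump_class (\<lambda>x. c * f x)"
| linear: "bump_class f \<Longrightarrow> bump_class (\<lambda>x. complex_of_real (x \<bullet> w) * f x)"

lemma bump_class_derivative:
  assumes "bump_class f"
  shows "\<exists>D. (\<forall>x. (f has_derivative D x) (at x)) \<and> (\<forall>v. bump_class (\<lambda>x. D x v))"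
  using assms
proof induction
  case (base j)
  let ?d = "\<lambda>x. - real j * flat_exp (Suc j) (1 - x \<bullet> x) + flat_exp (j + 2) (1 - x \<bullet> x)"
  define D :: "R3 \<Rightarrow> R3 \<Rightarrow> complex" where "D x v = complex_of_real (?d x * (- 2 * (x \<bullet> v)))" for x v
  have "((\<lambda>x. complex_of_real (flat_exp j (1 - x \<bullet> x))) has_derivative D x) (at x)" for x :: R3
  proof -
    have q: "((\<lambda>x::R3. 1 - x \<bullet> x) has_derivative (\<lambda>v. - 2 * (x \<bullet> v))) (at x)"
      by (auto intro!: derivative_eq_intros simp: inner_commute)
    have "((\<lambda>x. flat_exp j (1 - x \<bullet> x)) has_derivative (\<lambda>v. ?d x * (- 2 * (x \<bullet> v)))) (at x)"
      by (rule has_derivative_compose[OF q, of "flat_exp j" "\<lambda>h. ?d x * h"])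
        (use flat_exp_deriv[of j "1 - x \<bullet> x"] in \<open>simp add: has_field_derivative_def\<close>)
    then show ?thesis unfolding D_def by (rule has_derivative_of_real)
  qed
  moreover have "bump_class (\<lambda>x. D x v)" for v
  proof -
    have "bump_class (\<lambda>x. complex_of_real (x \<bullet> v) * (complex_of_real (2 * real j) * complex_of_real (flat_exp (Suc j) (1 - x \<bullet> x))
        + complex_of_real (- 2) * complex_of_real (flat_exp (j + 2) (1 - x \<bullet> x))))"
      by (intro bump_class.intros)
    moreover have "(\<lambda>x. D x v) = (\<lambda>x. complex_of_real (x \<bullet> v) * (complex_of_real (2 * real j) * complex_of_real (flat_exp (Suc j) (1 - x \<bullet> x))
        + complex_of_real (- 2) * complex_of_real (flat_exp (j + 2) (1 - x \<bullet> x))))"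
      by (simp add: D_def fun_eq_iff algebra_simps)
    ultimately show ?thesis by simp
  qed
  ultimately show ?case by blast
next
  case (add f g)
  then obtain D E where "\<forall>x. (f has_derivative D x) (at x)" "\<forall>v. bump_class (\<lambda>x. D x v)"
    "\<forall>x. (g has_derivative E x) (at x)" "\<forall>v. bump_class (\<lambda>x. E x v)" by blast
  then show ?case
    by (intro exI[of _ "\<lambda>x v. D x v + E x v"]) (auto intro: has_derivative_add bump_class.add)
next
  case (scale f c)
  then obtain D where "\<forall>x. (f has_derivative D x) (at x)" "\<forall>v. bump_class (\<lambda>x. D x v)" by blast
  then show ?case
    by (intro exI[of _ "\<lambda>x v. c * D x v"]) (auto intro: has_derivative_mult_right bump_class.scale)
next
  case (linear f w)
  then obtain D where D: "\<And>x. (f has_derivative D x) (at x)" "\<And>v. bump_class (\<lambda>x. D x v)" by blast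
  show ?case
  proof (intro exI[of _ "\<lambda>x v. complex_of_real (x \<bullet> w) * D x v + complex_of_real (v \<bullet> w) * f x"] conjI allI)
    fix x
    have l: "((\<lambda>x. complex_of_real (x \<bullet> w)) has_derivative (\<lambda>v. complex_of_real (v \<bullet> w))) (at x)"
      by (intro has_derivative_of_real) (auto intro!: derivative_eq_intros)
    show "((\<lambda>x. complex_of_real (x \<bullet> w) * f x) has_derivative (\<lambda>v. complex_of_real (x \<bullet> w) * D x v + complex_of_real (v \<bullet> w) * f x)) (at x)"
      by (rule has_derivative_mult[OF l D(1)])
  next
    fix v
    show "bump_class (\<lambda>x. complex_of_real (x \<bullet> w) * D x v + complex_of_real (v \<bullet> w) * f x)"
      by (intro bump_class.add bump_class.linear bump_class.scale D linear.hyps)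
  qed
qed

lemma bump_class_Ck: "bump_class f \<Longrightarrow> Ck_fun k f"
proof (induction k arbitrary: f)
  case 0
  obtain D where "\<And>x. (f has_derivative D x) (at x)" using bump_class_derivative[OF 0] by blast
  then show ?case by (simp only: Ck_fun.simps) (intro continuous_at_imp_continuous_on ballI has_derivative_continuous)
next
  case (Suc k)
  obtain D where D: "\<And>x. (f has_derivative D x) (at x)" "\<And>v. bump_class (\<lambda>x. D x v)"
    using bump_class_derivative[OF Suc.prems] by blast
  have "frechet_derivative f (at x) = D x" for x using frechet_derivative_at[OF D(1)] by simp
  then show ?case using D Suc.IH by (auto simp: differentiable_def)
qed

text \<open>This makes the set nonempty over which the infimum is taken.\<close>
lemma radial_test_function:
  obtains \<phi> where "\<phi> \<in> smooth_compact_support" "radially_symmetric \<phi>" "\<not> (AE x in lebesgue. \<phi> x = 0)"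
proof -
  define \<phi> :: "R3 \<Rightarrow> complex" where "\<phi> x = complex_of_real (flat_exp 0 (1 - x \<bullet> x))" for x
  have nz: "\<phi> x \<noteq> 0 \<longleftrightarrow> norm x < 1" for x
  proof -
    have "\<phi> x \<noteq> 0 \<longleftrightarrow> x \<bullet> x < 1" by (auto simp: \<phi>_def flat_exp_def)
    also have "x \<bullet> x < 1 \<longleftrightarrow> norm x < 1" by (simp add: norm_lt_square[of x 1])
    finally show ?thesis .
  qed
  have "bump_class \<phi>" unfolding \<phi>_def by (rule bump_class.base)
  then have ck: "Ck_fun k \<phi>" for k by (rule bump_class_Ck)
  have supp: "{x. \<phi> x \<noteq> 0} = ball 0 1" unfolding nz by auto
  have "compact (closure (ball (0 :: R3) 1))" unfolding compact_closure by (rule bounded_ball)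
  then have 1: "\<phi> \<in> smooth_compact_support"
    unfolding smooth_compact_support_def mem_Collect_eq supp using ck by blast
  have "\<phi> x = complex_of_real (flat_exp 0 (1 - (norm x)\<^sup>2))" for x
    by (simp add: \<phi>_def power2_norm_eq_inner)
  then have 2: "radially_symmetric \<phi>"
    unfolding radially_symmetric_def by (intro exI[of _ "\<lambda>r. complex_of_real (flat_exp 0 (1 - r\<^sup>2))"]) simp
  have 3: "\<not> (AE x in lebesgue. \<phi> x = 0)"
  proof
    assume "AE x in lebesgue. \<phi> x = 0"
    then have "AE x in lborel. x \<notin> ball (0 :: R3) 1" unfolding AE_completion_iff
      by eventually_elim (metis nz mem_ball_0)
    then have "ball (0 :: R3) 1 \<in> null_sets lborel" by (subst AE_iff_null_sets) auto
    then have "emeasure lborel (ball (0 :: R3) 1) = 0" by auto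
    then show False using unit_ball_vol_pos[of 3] by (simp add: emeasure_ball)
  qed
  show thesis using that 1 2 3 by blast
qed

section \<open>Limits of the Choquard energy and bounded sequences\<close>

lemma choquard_energy_scale:
  assumes [measurable]: "u \<in> borel_measurable borel"
  shows "choquard_energy \<alpha> p (\<lambda>x. c * u x) = ennreal (cmod c powr (2 * p)) * choquard_energy \<alpha> p u"
proof -
  have "ennreal (riesz_potential \<alpha> (fst z - snd z)) * ennreal (cmod (c * u (snd z)) powr p) * ennreal (cmod (c * u (fst z)) powr p)
      = ennreal (cmod c powr (2 * p)) * (ennreal (riesz_potential \<alpha> (fst z - snd z)) * ennreal (cmod (u (snd z)) powr p) * ennreal (cmod (u (fst z)) powr p))" for z
  proof -
    have 1: "cmod c powr (2 * p) = cmod c powr p * cmod c powr p" by (simp flip: powr_add)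
    show ?thesis unfolding 1 norm_mult by (simp add: powr_mult ennreal_mult mult_ac)
  qed
  then show ?thesis unfolding choquard_energy_pair[OF assms]
    by (subst choquard_energy_pair) (simp_all add: nn_integral_cmult)
qed

lemma choquard_energy_zero: "choquard_energy \<alpha> p (\<lambda>x. 0) = 0"
  by (simp add: choquard_energy_lborel)

text \<open>If the energy vanished, the potential would vanish at some point where \<open>u\<close> does not; as
  the Riesz kernel is positive, \<open>u\<close> would vanish almost everywhere.\<close>
lemma choquard_energy_pos:
  assumes \<alpha>: "0 < \<alpha>" "\<alpha> < 3" and [measurable]: "u \<in> borel_measurable borel" and nz: "\<not> (AE x in lborel. u x = 0)"
  shows "0 < choquard_energy \<alpha> p u"
proof (rule ccontr)
  assume "\<not> 0 < choquard_energy \<alpha> p u"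
  then have "choquard_energy \<alpha> p u = 0" by simp
  then have "AE x in lborel. (\<integral>\<^sup>+y. ennreal (riesz_potential \<alpha> (x - y)) * ennreal (cmod (u y) powr p) \<partial>lborel)
       * ennreal (cmod (u x) powr p) = 0"
    unfolding choquard_energy_lborel by (subst (asm) nn_integral_0_iff_AE) measurable
  moreover have "\<not> (AE x in lborel. (\<integral>\<^sup>+y. ennreal (riesz_potential \<alpha> (x - y)) * ennreal (cmod (u y) powr p) \<partial>lborel)
       * ennreal (cmod (u x) powr p) = 0 \<longrightarrow> u x = 0)"
  proof
    assume "AE x in lborel. (\<integral>\<^sup>+y. ennreal (riesz_potential \<alpha> (x - y)) * ennreal (cmod (u y) powr p) \<partial>lborel)
       * ennreal (cmod (u x) powr p) = 0 \<longrightarrow> u x = 0"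
    with calculation have "AE x in lborel. u x = 0" by eventually_elim simp
    then show False using nz by simp
  qed
  then obtain x where x: "(\<integral>\<^sup>+y. ennreal (riesz_potential \<alpha> (x - y)) * ennreal (cmod (u y) powr p) \<partial>lborel)
       * ennreal (cmod (u x) powr p) = 0" "u x \<noteq> 0"
    by (metis (mono_tags, lifting) AE_I2)
  then have "(\<integral>\<^sup>+y. ennreal (riesz_potential \<alpha> (x - y)) * ennreal (cmod (u y) powr p) \<partial>lborel) = 0" by simp
  then have "AE y in lborel. ennreal (riesz_potential \<alpha> (x - y)) * ennreal (cmod (u y) powr p) = 0"
    by (subst (asm) nn_integral_0_iff_AE) measurable
  moreover have "AE y in lborel. y \<noteq> x" by (rule AE_lborel_singleton)
  ultimately have "AE y in lborel. u y = 0"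
  proof eventually_elim
    fix y assume y: "ennreal (riesz_potential \<alpha> (x - y)) * ennreal (cmod (u y) powr p) = 0" "y \<noteq> x"
    have "0 < riesz_potential \<alpha> (x - y)" using riesz_const_pos[OF \<alpha>] y(2) by (simp add: riesz_potential_eq)
    then have "ennreal (cmod (u y) powr p) = 0" using y(1) by (simp add: ennreal_eq_0_iff)
    then have "cmod (u y) powr p = 0" by (metis ennreal_eq_zero_iff powr_ge_zero)
    then show "u y = 0" by simp
  qed
  then show False using nz by simp
qed

lemma choquard_energy_dominated:
  fixes u :: "nat \<Rightarrow> R3 \<Rightarrow> complex" and h :: "R3 \<Rightarrow> real"
  assumes u [measurable]: "\<And>n. u n \<in> borel_measurable borel" and w [measurable]: "w \<in> borel_measurable borel"
    and h [measurable]: "h \<in> borel_measurable borel" and h0: "\<And>x. 0 \<le> h x" and p: "0 < p"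
    and lim: "AE x in lborel. (\<lambda>n. u n x) \<longlonglongrightarrow> w x"
    and dom: "AE x in lborel. \<forall>n. cmod (u n x) \<le> h x"
    and fin: "choquard_energy \<alpha> p (\<lambda>x. complex_of_real (h x)) < \<infinity>"
  shows "(\<lambda>n. choquard_energy \<alpha> p (u n)) \<longlonglongrightarrow> choquard_energy \<alpha> p w"
proof -
  let ?F = "\<lambda>v z. ennreal (riesz_potential \<alpha> (fst z - snd z)) * ennreal (cmod (v (snd z)) powr p) * ennreal (cmod (v (fst z)) powr p)"
  let ?P = "lborel \<Otimes>\<^sub>M lborel :: (R3 \<times> R3) measure"
  have hm: "(\<lambda>x. complex_of_real (h x)) \<in> borel_measurable borel" by measurable
  have "(\<lambda>n. \<integral>\<^sup>+z. ?F (u n) z \<partial>?P) \<longlonglongrightarrow> (\<integral>\<^sup>+z. ?F w z \<partial>?P)"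
  proof (rule nn_integral_dominated_convergence[where w = "?F (\<lambda>x. complex_of_real (h x))"])
    show "(\<integral>\<^sup>+z. ?F (\<lambda>x. complex_of_real (h x)) z \<partial>?P) < \<infinity>"
      using fin unfolding choquard_energy_pair[OF hm] .
    show "AE z in ?P. ?F (u n) z \<le> ?F (\<lambda>x. complex_of_real (h x)) z" for n
      using AE_pair_fst_snd[OF dom]
    proof eventually_elim
      fix z assume z: "(\<forall>n. cmod (u n (fst z)) \<le> h (fst z)) \<and> (\<forall>n. cmod (u n (snd z)) \<le> h (snd z))"
      have "cmod (u n x) powr p \<le> cmod (complex_of_real (h x)) powr p" if "cmod (u n x) \<le> h x" for x
        using that p by (intro powr_mono2) auto
      then show "?F (u n) z \<le> ?F (\<lambda>x. complex_of_real (h x)) z"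
        using z by (intro mult_mono ennreal_leI order_refl) auto
    qed
    show "AE z in ?P. (\<lambda>n. ?F (u n) z) \<longlonglongrightarrow> ?F w z"
      using AE_pair_fst_snd[OF lim]
    proof eventually_elim
      fix z assume z: "(\<lambda>n. u n (fst z)) \<longlonglongrightarrow> w (fst z) \<and> (\<lambda>n. u n (snd z)) \<longlonglongrightarrow> w (snd z)"
      have c: "(\<lambda>n. ennreal (cmod (u n x) powr p)) \<longlonglongrightarrow> ennreal (cmod (w x) powr p)" if "(\<lambda>n. u n x) \<longlonglongrightarrow> w x" for x
        using that p by (intro tendsto_ennrealI tendsto_powr' tendsto_norm tendsto_const) auto
      have "(\<lambda>n. ennreal (riesz_potential \<alpha> (fst z - snd z)) * ennreal (cmod (u n (snd z)) powr p)) \<longlonglongrightarrow>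
         ennreal (riesz_potential \<alpha> (fst z - snd z)) * ennreal (cmod (w (snd z)) powr p)"
        using z by (intro tendsto_mult_ennreal tendsto_const c) auto
      then show "(\<lambda>n. ?F (u n) z) \<longlonglongrightarrow> ?F w z"
        using z by (intro tendsto_mult_ennreal c) (auto simp: ennreal_mult_eq_top_iff)
    qed
  qed measurable
  then show ?thesis by (simp add: choquard_energy_pair[OF u] choquard_energy_pair[OF w])
qed

text \<open>The profile of the limit is the pointwise limit of the profiles, wherever it exists.\<close>
lemma radially_symmetric_limit:
  assumes rad: "\<And>n. radially_symmetric (u n)" and lim: "AE x in lborel. (\<lambda>n. u n x) \<longlonglongrightarrow> w x"
  shows "radially_symmetric w"
proof -
  obtain f where f: "\<And>n. AE x in lborel. u n x = f n (norm x)"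
    using rad unfolding radially_symmetric_def AE_completion_iff by metis
  have "AE x in lborel. \<forall>n. u n x = f n (norm x)" using f by (simp add: AE_all_countable)
  then have "AE x in lborel. w x = lim (\<lambda>n. f n (norm x))" using lim
    by eventually_elim (simp add: limI)
  then show ?thesis unfolding radially_symmetric_def AE_completion_iff
    by (intro exI[of _ "\<lambda>t. lim (\<lambda>n. f n t)"])
qed

lemma radially_symmetric_cong_AE:
  assumes "radially_symmetric u" "AE x in lborel. u x = v x"
  shows "radially_symmetric v"
proof -
  obtain f where "AE x in lborel. u x = f (norm x)" using assms(1) unfolding radially_symmetric_def AE_completion_iff by blast
  then have "AE x in lborel. v x = f (norm x)" using assms(2) by eventually_elim simp
  then show ?thesis unfolding radially_symmetric_def AE_completion_iff by blast
qed

lemma radially_symmetric_lin_comb: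
  assumes "radially_symmetric u" "radially_symmetric v"
  shows "radially_symmetric (\<lambda>x. a * u x + b * v x)"
proof -
  obtain f g where "AE x in lborel. u x = f (norm x)" "AE x in lborel. v x = g (norm x)"
    using assms unfolding radially_symmetric_def AE_completion_iff by blast
  then have "AE x in lborel. a * u x + b * v x = a * f (norm x) + b * g (norm x)" by eventually_elim simp
  then show ?thesis unfolding radially_symmetric_def AE_completion_iff
    by (intro exI[of _ "\<lambda>t. a * f t + b * g t"])
qed

context magnetic_form
begin

lemma mag_form_bounds:
  assumes "mag_form u \<le> ennreal B" "0 \<le> B"
  shows "mag_energy u \<le> ennreal (B / energy_coeff)" "mass u \<le> ennreal (B / m powr (2 * s))"
proof -
  have c: "0 < m powr (2 * s)" using m by simp
  have "mag_form u < \<infinity>" using assms(1) by (rule order_le_less_trans) simp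
  then have "mag_energy u < \<infinity>" "mass u < \<infinity>" using mag_form_finite_iff by blast+
  then obtain a b where ab: "0 \<le> a" "mag_energy u = ennreal a" "0 \<le> b" "mass u = ennreal b"
    by (cases "mag_energy u"; cases "mass u") auto
  have "mag_form u = ennreal (energy_coeff * a + m powr (2 * s) * b)"
    using ab energy_coeff_pos by (simp add: mag_form_def ennreal_mult ennreal_plus less_imp_le)
  then have "energy_coeff * a + m powr (2 * s) * b \<le> B" using assms by simp
  moreover have "0 \<le> energy_coeff * a" "0 \<le> m powr (2 * s) * b" using ab energy_coeff_pos by simp_all
  ultimately have "energy_coeff * a \<le> B" "m powr (2 * s) * b \<le> B" by linarith+
  then have "a \<le> B / energy_coeff" "b \<le> B / m powr (2 * s)" using energy_coeff_pos c by (simp_all add: field_simps)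
  then show "mag_energy u \<le> ennreal (B / energy_coeff)" "mass u \<le> ennreal (B / m powr (2 * s))"
    unfolding ab by (simp_all add: ennreal_leI)
qed

text \<open>The subcritical Sobolev embedding, for the modulus: it differs from its averages over unit
  cubes by a function in \<open>L\<^sup>q\<close>, and these averages are bounded and square integrable.\<close>
lemma powr_integral_finite:
  assumes [measurable]: "u \<in> borel_measurable borel" and fin: "mag_form u < \<infinity>" and q: "2 < q" "q < 6 / (3 - 2 * s)"
  shows "powr_mass q u < \<infinity>"
proof -
  define v where "v x = complex_of_real (cmod (u x))" for x
  have vm [measurable]: "v \<in> borel_measurable borel" unfolding v_def[abs_def] by measurable
  have E: "mag_energy u < \<infinity>" and M: "mass u < \<infinity>" using fin mag_form_finite_iff by blast+
  obtain K where K: "0 \<le> K" "\<And>u. u \<in> borel_measurable borel \<Longrightarrow> local_energy s (\<lambda>x. complex_of_real (cmod (u x))) UNIV \<le> ennreal K * mag_energy u"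
    by (rule local_energy_modulus_le) (rule that)
  have "local_energy s v UNIV < \<infinity>"
    unfolding v_def using K(2)[OF assms(1)] by (rule order_le_less_trans) (use E in \<open>simp add: ennreal_mult_less_top\<close>)
  then obtain e where e: "0 \<le> e" "local_energy s v UNIV = ennreal e" by (cases "local_energy s v UNIV") auto
  obtain b where b: "0 \<le> b" "mass u = ennreal b" using M by (cases "mass u") auto
  have mv: "mass v = ennreal b"
    using b(2) by (simp add: v_def)
  have L2: "L2 v" by (simp add: L2_def mv)
  obtain C \<delta> where "0 \<le> C" "0 < \<delta>" and C: "\<And>N v \<Omega> M. L2 v \<Longrightarrow> saturated \<Omega> \<Longrightarrow> 0 \<le> M \<Longrightarrow> local_energy s v \<Omega> \<le> ennreal M \<Longrightarrow>
      powr_integral q \<Omega> (\<lambda>x. v x - avg N v x) \<le> ennreal (C * M powr (q / 2) * 2 powr (- \<delta> * real N))"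
    using avg_approximation[OF s q] by blast
  have 1: "powr_mass q (\<lambda>x. v x - avg 0 v x) < \<infinity>"
  proof (rule order_le_less_trans)
    show "powr_mass q (\<lambda>x. v x - avg 0 v x) \<le> ennreal (C * e powr (q / 2) * 2 powr (- \<delta> * real 0))"
      using C[OF L2 saturated_UNIV e(1), of 0] e(2) by simp
  qed simp
  have 2: "powr_mass q (avg 0 v) < \<infinity>"
  proof -
    have "powr_integral q UNIV (avg 0 v) \<le> ennreal ((8 ^ 0 * b) powr ((q - 2) / 2)) * mass v"
    proof (rule avg_powr_integral_le[OF L2 saturated_UNIV _ b(1)])
      show "sq_integral (cell 0 x) v \<le> ennreal b" for x
        unfolding mv[symmetric] by (intro nn_integral_mono) (auto simp: indicator_def)
    qed (use q in simp)
    also have "\<dots> < \<infinity>" unfolding mv by (simp add: ennreal_mult_less_top)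
    finally show ?thesis by simp
  qed
  have "powr_mass q u \<le> ennreal (2 powr q) * (powr_mass q (\<lambda>x. v x - avg 0 v x) + powr_mass q (avg 0 v))"
    using powr_integral_add_le[of "\<lambda>x. v x - avg 0 v x" "avg 0 v" UNIV q] q by (simp add: v_def)
  also have "\<dots> < \<infinity>" using 1 2 by (simp add: ennreal_mult_less_top)
  finally show ?thesis .
qed

text \<open>A bound on the form bounds the energy of the modulus globally and that of the function on
  every box, as \<open>radial_compactness\<close> requires. Of all the exponents that it provides, the
  majorant uses the two from \<open>choquard_energy_finite\<close>.\<close>
lemma bounded_radial_subsequence:
  fixes u :: "nat \<Rightarrow> R3 \<Rightarrow> complex"
  assumes \<alpha>: "0 < \<alpha>" "\<alpha> < 3" and p: "1 + \<alpha> / 3 < p" "p < (3 + \<alpha>) / (3 - 2 * s)"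
    and u: "\<And>n. u n \<in> borel_measurable borel" and rad: "\<And>n. radially_symmetric (u n)"
    and B: "0 \<le> B" "\<And>n. mag_form (u n) \<le> ennreal B"
  obtains r :: "nat \<Rightarrow> nat" and w :: "R3 \<Rightarrow> complex" and h :: "R3 \<Rightarrow> real"
  where "strict_mono r" "w \<in> borel_measurable borel" "h \<in> borel_measurable borel" "\<And>x. 0 \<le> h x"
    "AE x in lborel. (\<lambda>n. u (r n) x) \<longlonglongrightarrow> w x"
    "AE x in lborel. \<forall>n. cmod (u (r n) x) \<le> h x"
    "choquard_energy \<alpha> p (\<lambda>x. complex_of_real (h x)) < \<infinity>"
proof -
  have fin: "mag_form (u n) < \<infinity>" for n using B(2) by (rule order_le_less_trans) simp
  define E0 M0 where "E0 = B / energy_coeff" and "M0 = B / m powr (2 * s)"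
  have E0: "mag_energy (u n) \<le> ennreal E0" and M0: "mass (u n) \<le> ennreal M0" for n
    using mag_form_bounds[OF B(2) B(1)] by (simp_all add: E0_def M0_def)
  have nn: "0 \<le> E0" "0 \<le> M0" using B(1) energy_coeff_pos by (simp_all add: E0_def M0_def)
  obtain K where K: "0 \<le> K" "\<And>u. u \<in> borel_measurable borel \<Longrightarrow> local_energy s (\<lambda>x. complex_of_real (cmod (u x))) UNIV \<le> ennreal K * mag_energy u"
    by (rule local_energy_modulus_le) (rule that)
  define M where "M = max (K * E0) M0"
  have M: "0 \<le> M" using nn by (simp add: M_def)
  have L2: "L2 (u n)" for n
    using u[of n] fin[of n] mag_form_finite_iff[of "u n"] by (simp add: L2_def)
  have mass: "mass (u n) \<le> ennreal M" for n
    using M0[of n] by (rule order_trans) (simp add: M_def ennreal_leI)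
  have mod: "local_energy s (\<lambda>x. complex_of_real (cmod (u n x))) UNIV \<le> ennreal M" for n
  proof -
    have "local_energy s (\<lambda>x. complex_of_real (cmod (u n x))) UNIV \<le> ennreal K * ennreal E0"
      using K(2)[OF u] E0[of n] by (meson mult_left_mono order_trans zero_le)
    also have "\<dots> = ennreal (K * E0)" using K nn by (simp add: ennreal_mult)
    also have "\<dots> \<le> ennreal M" by (intro ennreal_leI) (simp add: M_def)
    finally show ?thesis .
  qed
  have box: "\<exists>K. \<forall>n. local_energy s (u n) (sbox R) \<le> ennreal K" for R
  proof -
    obtain K1 K2 where K12: "0 \<le> K1" "0 \<le> K2" "\<And>u. u \<in> borel_measurable borel \<Longrightarrow>
      local_energy s u (sbox R) \<le> ennreal K1 * mag_energy u + ennreal K2 * mass u"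
      by (rule local_energy_box_le[of R]) (rule that)
    have "local_energy s (u n) (sbox R) \<le> ennreal (K1 * E0 + K2 * M0)" for n
    proof -
      have "local_energy s (u n) (sbox R) \<le> ennreal K1 * mag_energy (u n) + ennreal K2 * mass (u n)" by (rule K12(3)[OF u])
      also have "\<dots> \<le> ennreal K1 * ennreal E0 + ennreal K2 * ennreal M0"
        by (intro add_mono mult_left_mono E0 M0) auto
      also have "\<dots> = ennreal (K1 * E0 + K2 * M0)" using K12 nn by (simp add: ennreal_mult ennreal_plus)
      finally show ?thesis .
    qed
    then show ?thesis by blast
  qed
  obtain r0 :: "nat \<Rightarrow> nat" where r0: "strict_mono r0"
    "\<And>q \<epsilon>. 2 < q \<Longrightarrow> q < 6 / (3 - 2 * s) \<Longrightarrow> 0 < \<epsilon> \<Longrightarrow>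
      \<exists>N. \<forall>n\<ge>N. \<forall>k\<ge>N. powr_mass q (\<lambda>x. u (r0 n) x - u (r0 k) x) \<le> ennreal \<epsilon>"
    by (rule radial_compactness[OF s M L2 rad mass mod box]) (rule that)
  obtain q1 q2 where q: "2 < q1" "q1 < 6 / (3 - 2 * s)" "2 < q2" "q2 < 6 / (3 - 2 * s)"
    and D: "\<And>u. u \<in> borel_measurable borel \<Longrightarrow> powr_mass q1 u < \<infinity> \<Longrightarrow>
      powr_mass q2 u < \<infinity> \<Longrightarrow> choquard_energy \<alpha> p u < \<infinity>"
    by (rule choquard_energy_finite[OF s \<alpha> p]) (rule that)
  let ?Q = "{q1, q2}"
  have Qr: "2 < t \<and> t < 6 / (3 - 2 * s)" if "t \<in> ?Q" for t using that q by auto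
  have a1: "finite ?Q" "?Q \<noteq> {}" by auto
  have a2: "0 < t" if "t \<in> ?Q" for t using Qr[OF that] by simp
  have a3: "powr_mass t (u (r0 n)) < \<infinity>" if "t \<in> ?Q" for n t
    using Qr[OF that] by (intro powr_integral_finite u fin) auto
  have a4: "\<exists>N. \<forall>n\<ge>N. \<forall>k\<ge>N. powr_mass t (\<lambda>x. u (r0 n) x - u (r0 k) x) \<le> ennreal \<epsilon>"
    if "t \<in> ?Q" "0 < \<epsilon>" for t \<epsilon> using Qr[OF that(1)] that(2) by (intro r0(2)) auto
  show thesis
  proof (rule dominated_subsequence[of "\<lambda>n. u (r0 n)" ?Q, OF u a1 a2 a3 a4])
    fix r :: "nat \<Rightarrow> nat" and w :: "R3 \<Rightarrow> complex" and h :: "R3 \<Rightarrow> real"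
    assume r: "strict_mono r" and w: "w \<in> borel_measurable borel" and h: "h \<in> borel_measurable borel" "\<And>x. 0 \<le> h x"
      and lim: "AE x in lborel. (\<lambda>n. u (r0 (r n)) x) \<longlonglongrightarrow> w x"
      and dom: "AE x in lborel. \<forall>n. cmod (u (r0 (r n)) x) \<le> h x"
      and hq: "\<And>q. q \<in> ?Q \<Longrightarrow> (\<integral>\<^sup>+x. ennreal (h x powr q) \<partial>lborel) < \<infinity>"
    have "choquard_energy \<alpha> p (\<lambda>x. complex_of_real (h x)) < \<infinity>"
      using hq[of q1] hq[of q2] h by (intro D) (auto simp: abs_of_nonneg)
    moreover have "strict_mono (\<lambda>n. r0 (r n))" using r0(1) r by (simp add: strict_mono_def)
    ultimately show thesis using that[of "\<lambda>n. r0 (r n)" w h] w h lim dom by blast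
  qed
qed

end

section \<open>Existence of a minimizer\<close>

context magnetic_form
begin

lemma HsA_rad_nonzero_representative:
  assumes "u \<in> HsA_rad_nonzero s m A"
  obtains v where "v \<in> borel_measurable borel" "AE x in lborel. u x = v x" "v \<in> HsA s m A"
    "radially_symmetric v" "\<not> (AE x in lborel. v x = 0)"
proof -
  have u: "u \<in> HsA s m A" "radially_symmetric u" "\<not> (AE x in lborel. u x = 0)"
    using assms by (auto simp: HsA_rad_nonzero_def HsA_rad_def AE_completion_iff)
  obtain v where v: "v \<in> borel_measurable borel" "AE x in lborel. u x = v x"
    using borel_representative u(1) unfolding HsA_iff by blast
  have "\<not> (AE x in lborel. v x = 0)"
  proof
    assume "AE x in lborel. v x = 0"
    with v(2) have "AE x in lborel. u x = 0" by eventually_elim simp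
    then show False using u(3) by simp
  qed
  then show thesis using that v HsA_cong_AE[OF u(1) v(2)] radially_symmetric_cong_AE[OF u(2) v(2)] by blast
qed

lemma HsA_rad_nonzeroI:
  assumes "v \<in> HsA s m A" "radially_symmetric v" "\<not> (AE x in lborel. v x = 0)"
  shows "v \<in> HsA_rad_nonzero s m A"
  using assms by (auto simp: HsA_rad_nonzero_def HsA_rad_def AE_completion_iff)

lemma choquard_quotient_eq:
  assumes "u \<in> HsA s m A"
  shows "choquard_quotient s m \<alpha> p A u = enn2real (mag_form u) / enn2real (choquard_energy \<alpha> p u) powr (1 / p)"
  using assms mag_space_and_norm(2)[of u] by (simp add: choquard_quotient_def HsA_iff)

lemma choquard_quotient_nonneg: "0 \<le> choquard_quotient s m \<alpha> p A u"
  by (simp add: choquard_quotient_def)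

lemma bdd_below_quotients: "bdd_below (choquard_quotient s m \<alpha> p A ` HsA_rad_nonzero s m A)"
  by (intro bdd_belowI2[of _ 0] choquard_quotient_nonneg)

lemma HsA_rad_nonzero_nonempty: "HsA_rad_nonzero s m A \<noteq> {}"
proof -
  obtain \<phi> where \<phi>: "\<phi> \<in> smooth_compact_support" "radially_symmetric \<phi>" "\<not> (AE x in lebesgue. \<phi> x = 0)"
    by (rule radial_test_function)
  then have "\<phi> \<in> HsA_rad_nonzero s m A"
    using test_function_HsA by (intro HsA_rad_nonzeroI) (auto simp: AE_completion_iff)
  then show ?thesis by blast
qed

lemma tau_rad_nonneg: "0 \<le> tau_rad s m \<alpha> p A"
  unfolding tau_rad_def by (rule cINF_greatest[OF HsA_rad_nonzero_nonempty]) (rule choquard_quotient_nonneg)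

context
  fixes \<alpha> p :: real
  assumes \<alpha>: "0 < \<alpha>" "\<alpha> < 3" and p: "1 + \<alpha> / 3 < p" "p < (3 + \<alpha>) / (3 - 2 * s)"
begin

lemma p_pos: "0 < p"
  using \<alpha> p by simp

text \<open>An infinite energy would be turned into \<open>0\<close> by \<open>enn2real\<close>, and the quotient with it; so
  finiteness is what gives the infimum its meaning.\<close>
lemma choquard_energy_HsA_finite:
  assumes "u \<in> borel_measurable borel" "u \<in> HsA s m A"
  shows "choquard_energy \<alpha> p u < \<infinity>"
proof (rule choquard_energy_finite[OF s \<alpha> p])
  fix q1 q2 assume q: "2 < q1" "q1 < 6 / (3 - 2 * s)" "2 < q2" "q2 < 6 / (3 - 2 * s)"
    and D: "\<And>u. u \<in> borel_measurable borel \<Longrightarrow> powr_mass q1 u < \<infinity> \<Longrightarrow>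
      powr_mass q2 u < \<infinity> \<Longrightarrow> choquard_energy \<alpha> p u < \<infinity>"
  have "mag_form u < \<infinity>" using assms(2) by (simp add: HsA_iff)
  then show ?thesis using assms(1) q by (intro D powr_integral_finite)
qed

text \<open>The definition of the infimum without division, so that it holds for the zero function as
  well and can be applied to midpoints.\<close>
lemma tau_rad_le:
  assumes u: "u \<in> borel_measurable borel" "u \<in> HsA s m A" and rad: "radially_symmetric u"
  shows "tau_rad s m \<alpha> p A * enn2real (choquard_energy \<alpha> p u) powr (1 / p) \<le> enn2real (mag_form u)"
proof (cases "AE x in lborel. u x = 0")
  case True
  then have "choquard_energy \<alpha> p u = 0"
    using choquard_energy_cong_AE[of u "\<lambda>x. 0" \<alpha> p] by (simp add: choquard_energy_zero)
  then show ?thesis by simp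
next
  case False
  have "0 < choquard_energy \<alpha> p u" "choquard_energy \<alpha> p u < \<infinity>"
    using choquard_energy_pos[OF \<alpha> u(1) False] choquard_energy_HsA_finite[OF u] by auto
  then have pos: "0 < enn2real (choquard_energy \<alpha> p u)" by (simp add: enn2real_positive_iff)
  have "tau_rad s m \<alpha> p A \<le> choquard_quotient s m \<alpha> p A u"
    unfolding tau_rad_def by (intro cINF_lower bdd_below_quotients HsA_rad_nonzeroI u rad False)
  then show ?thesis unfolding choquard_quotient_eq[OF u(2)] using pos by (simp add: field_simps)
qed

text \<open>Scaling to Choquard energy \<open>1\<close> turns the quotient into the squared norm.\<close>
lemma normalized_function:
  assumes "v \<in> HsA_rad_nonzero s m A"
  obtains u where "u \<in> borel_measurable borel" "u \<in> HsA s m A" "radially_symmetric u"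
    "choquard_energy \<alpha> p u = 1" "mag_form u = ennreal (choquard_quotient s m \<alpha> p A v)"
proof -
  obtain v' where v': "v' \<in> borel_measurable borel" "AE x in lborel. v x = v' x" "v' \<in> HsA s m A"
    "radially_symmetric v'" "\<not> (AE x in lborel. v' x = 0)"
    by (rule HsA_rad_nonzero_representative[OF assms])
  have v: "v \<in> HsA s m A" using assms by (simp add: HsA_rad_nonzero_def HsA_rad_def)
  obtain D where D: "0 < D" "choquard_energy \<alpha> p v' = ennreal D"
    using choquard_energy_pos[OF \<alpha> v'(1,5), of p] choquard_energy_HsA_finite[OF v'(1,3)]
    by (cases "choquard_energy \<alpha> p v'") auto
  obtain g where g: "0 \<le> g" "mag_form v' = ennreal g"
    using v'(3) by (cases "mag_form v'") (auto simp: HsA_iff)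
  have Q: "choquard_quotient s m \<alpha> p A v = g / D powr (1 / p)"
    unfolding choquard_quotient_eq[OF v] choquard_energy_cong_AE[OF v'(2)] mag_form_cong_AE[OF v'(2)]
    using D g by simp
  \<comment> \<open>The energy is homogeneous of degree \<open>2 p\<close>.\<close>
  define c where "c = D powr (- (1 / (2 * p)))"
  have c: "0 < c" using D by (simp add: c_def)
  define u where "u x = complex_of_real c * v' x" for x
  show thesis
  proof (rule that)
    show "u \<in> borel_measurable borel" unfolding u_def[abs_def] using v'(1) by simp
    show "u \<in> HsA s m A" unfolding u_def[abs_def] by (rule HsA_scale[OF v'(1,3)])
    show "radially_symmetric u"
      using radially_symmetric_lin_comb[OF v'(4) v'(4), of "complex_of_real c" 0] by (simp add: u_def[abs_def])
    have "c powr (2 * p) = D powr - 1" using p_pos by (simp add: c_def powr_powr)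
    then have "c powr (2 * p) * D = 1" using D by (simp add: powr_minus_divide)
    then show "choquard_energy \<alpha> p u = 1"
      unfolding u_def[abs_def] choquard_energy_scale[OF v'(1)] D(2) using c D by (simp add: ennreal_mult[symmetric])
    have "c\<^sup>2 = c powr 2" using c by simp
    also have "\<dots> = D powr (- (1 / p))" unfolding c_def powr_powr using p_pos by (simp add: field_simps)
    finally have "c\<^sup>2 * g = g / D powr (1 / p)" by (simp add: powr_minus_divide)
    then show "mag_form u = ennreal (choquard_quotient s m \<alpha> p A v)"
      unfolding u_def[abs_def] mag_form_scale[OF v'(1)] g(2) Q using c g by (simp add: ennreal_mult[symmetric])
  qed
qed

lemma minimizing_sequence:
  obtains u :: "nat \<Rightarrow> R3 \<Rightarrow> complex" and t :: "nat \<Rightarrow> real"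
  where "\<And>n. u n \<in> borel_measurable borel" "\<And>n. u n \<in> HsA s m A" "\<And>n. radially_symmetric (u n)"
    "\<And>n. choquard_energy \<alpha> p (u n) = 1" "\<And>n. mag_form (u n) = ennreal (t n)" "\<And>n. 0 \<le> t n"
    "\<And>n. t n < tau_rad s m \<alpha> p A + inverse (real (Suc n))"
proof -
  have "\<exists>v\<in>HsA_rad_nonzero s m A. choquard_quotient s m \<alpha> p A v < tau_rad s m \<alpha> p A + inverse (real (Suc n))" for n
  proof -
    have "tau_rad s m \<alpha> p A < tau_rad s m \<alpha> p A + inverse (real (Suc n))" by simp
    then show ?thesis
      unfolding tau_rad_def cINF_less_iff[OF HsA_rad_nonzero_nonempty bdd_below_quotients] by (simp add: tau_rad_def)
  qed
  then obtain v where v: "\<And>n. v n \<in> HsA_rad_nonzero s m A"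
    "\<And>n. choquard_quotient s m \<alpha> p A (v n) < tau_rad s m \<alpha> p A + inverse (real (Suc n))" by metis
  have "\<exists>u. u \<in> borel_measurable borel \<and> u \<in> HsA s m A \<and> radially_symmetric u \<and>
    choquard_energy \<alpha> p u = 1 \<and> mag_form u = ennreal (choquard_quotient s m \<alpha> p A (v n))" for n
    by (rule normalized_function[OF v(1)[of n]]) blast
  then obtain u where "\<And>n. u n \<in> borel_measurable borel \<and> u n \<in> HsA s m A \<and> radially_symmetric (u n) \<and>
    choquard_energy \<alpha> p (u n) = 1 \<and> mag_form (u n) = ennreal (choquard_quotient s m \<alpha> p A (v n))" by metis
  then show thesis
    using that[of u "\<lambda>n. choquard_quotient s m \<alpha> p A (v n)"] v(2) choquard_quotient_nonneg by blast
qed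

text \<open>Otherwise there are pairs with arbitrarily large indices \<open>a N\<close>, \<open>b N\<close> whose distance stays
  above \<open>e\<close>. Their midpoints \<open>y N\<close> still converge to \<open>w\<close> below \<open>h\<close>, so their energy tends to
  \<open>1\<close>; then \<open>4 \<tau> + e \<le> 4 \<tau>\<close> in the limit of the parallelogram law.\<close>
lemma minimizing_sequence_Cauchy:
  fixes u :: "nat \<Rightarrow> R3 \<Rightarrow> complex" and t :: "nat \<Rightarrow> real"
  assumes u: "\<And>n. u n \<in> borel_measurable borel" "\<And>n. u n \<in> HsA s m A" "\<And>n. radially_symmetric (u n)"
    and t: "\<And>n. mag_form (u n) = ennreal (t n)" "\<And>n. 0 \<le> t n" "t \<longlonglongrightarrow> tau_rad s m \<alpha> p A"
    and w: "w \<in> borel_measurable borel" "choquard_energy \<alpha> p w = 1"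
    and h: "h \<in> borel_measurable borel" "\<And>x. 0 \<le> h x" "choquard_energy \<alpha> p (\<lambda>x. complex_of_real (h x)) < \<infinity>"
    and lim: "AE x in lborel. (\<lambda>n. u n x) \<longlonglongrightarrow> w x"
    and dom: "AE x in lborel. \<forall>n. cmod (u n x) \<le> h x"
    and e: "0 < e"
  shows "\<exists>N. \<forall>n\<ge>N. \<forall>k\<ge>N. mag_form (\<lambda>x. u n x - u k x) \<le> ennreal e"
proof (rule ccontr)
  let ?\<tau> = "tau_rad s m \<alpha> p A"
  assume "\<not> ?thesis"
  then have "\<forall>N. \<exists>n k. N \<le> n \<and> N \<le> k \<and> ennreal e < mag_form (\<lambda>x. u n x - u k x)" by (meson not_le)
  then obtain a b where ab: "\<And>N. N \<le> a N" "\<And>N. N \<le> b N" "\<And>N. ennreal e < mag_form (\<lambda>x. u (a N) x - u (b N) x)"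
    by metis
  have fa: "filterlim a at_top sequentially" and fb: "filterlim b at_top sequentially"
    using ab(1,2) by (auto intro: filterlim_at_top_mono[OF filterlim_ident] always_eventually)
  define y where "y N x = 1 / 2 * (u (a N) x + u (b N) x)" for N x
  have ym: "y N \<in> borel_measurable borel" for N unfolding y_def[abs_def] using u(1) by simp
  have yH: "y N \<in> HsA s m A" for N
    unfolding y_def[abs_def] using u(1) by (intro HsA_scale HsA_add u) simp
  have yr: "radially_symmetric (y N)" for N
    using radially_symmetric_lin_comb[OF u(3) u(3), of "1 / 2" "a N" "1 / 2" "b N"]
    by (simp add: y_def[abs_def] add_divide_distrib)
  have ylim: "AE x in lborel. (\<lambda>N. y N x) \<longlonglongrightarrow> w x"
    using lim
  proof eventually_elim
    fix x assume l: "(\<lambda>n. u n x) \<longlonglongrightarrow> w x"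
    have "(\<lambda>N. 1 / 2 * (u (a N) x + u (b N) x)) \<longlonglongrightarrow> 1 / 2 * (w x + w x)"
      by (intro tendsto_intros filterlim_compose[OF l fa] filterlim_compose[OF l fb])
    then show "(\<lambda>N. y N x) \<longlonglongrightarrow> w x" by (simp add: y_def)
  qed
  have ydom: "AE x in lborel. \<forall>N. cmod (y N x) \<le> h x"
    using dom
  proof eventually_elim
    fix x assume d: "\<forall>n. cmod (u n x) \<le> h x"
    show "\<forall>N. cmod (y N x) \<le> h x"
    proof
      fix N
      have "cmod (y N x) = 1 / 2 * cmod (u (a N) x + u (b N) x)" by (simp add: y_def norm_mult)
      also have "\<dots> \<le> 1 / 2 * (h x + h x)"
      proof (rule mult_left_mono)
        show "cmod (u (a N) x + u (b N) x) \<le> h x + h x"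
          using d[rule_format, of "a N"] d[rule_format, of "b N"] norm_triangle_ineq[of "u (a N) x" "u (b N) x"] by linarith
      qed simp
      finally show "cmod (y N x) \<le> h x" by simp
    qed
  qed
  have "(\<lambda>N. choquard_energy \<alpha> p (y N)) \<longlonglongrightarrow> choquard_energy \<alpha> p w"
    by (rule choquard_energy_dominated[OF ym w(1) h(1,2) p_pos ylim ydom h(3)])
  then have "(\<lambda>N. choquard_energy \<alpha> p (y N)) \<longlonglongrightarrow> ennreal 1" by (simp add: w(2))
  then have "(\<lambda>N. enn2real (choquard_energy \<alpha> p (y N))) \<longlonglongrightarrow> 1"
    by (rule tendsto_enn2real) simp
  then have D: "(\<lambda>N. enn2real (choquard_energy \<alpha> p (y N)) powr (1 / p)) \<longlonglongrightarrow> 1 powr (1 / p)"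
    by (intro tendsto_powr tendsto_const) simp_all
  \<comment> \<open>The parallelogram law for \<open>u (a N)\<close> and \<open>u (b N)\<close>, whose sum is \<open>2 * y N\<close>.\<close>
  have key: "e \<le> 2 * t (a N) + 2 * t (b N) - 4 * (?\<tau> * enn2real (choquard_energy \<alpha> p (y N)) powr (1 / p))" for N
  proof -
    obtain g where g: "0 \<le> g" "mag_form (y N) = ennreal g"
      using yH[of N] by (cases "mag_form (y N)") (auto simp: HsA_iff)
    have "(\<lambda>x. u (a N) x + u (b N) x) = (\<lambda>x. 2 * y N x)" by (simp add: y_def fun_eq_iff)
    then have s4: "mag_form (\<lambda>x. u (a N) x + u (b N) x) = ennreal (4 * g)"
      using mag_form_scale[OF ym, of 2 N] g by (simp add: ennreal_mult)
    have par: "mag_form (\<lambda>x. u (a N) x + u (b N) x) + mag_form (\<lambda>x. u (a N) x - u (b N) x) = 2 * mag_form (u (a N)) + 2 * mag_form (u (b N))"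
      by (rule mag_form_parallelogram[OF u(1) u(1)])
    have rhs: "2 * mag_form (u (a N)) + 2 * mag_form (u (b N)) = ennreal (2 * t (a N) + 2 * t (b N))"
      using t(2) by (simp add: t(1) ennreal_mult ennreal_plus)
    have "ennreal (4 * g + e) = ennreal (4 * g) + ennreal e" using g e by (simp add: ennreal_plus)
    also have "\<dots> \<le> mag_form (\<lambda>x. u (a N) x + u (b N) x) + mag_form (\<lambda>x. u (a N) x - u (b N) x)"
      unfolding s4 by (intro add_left_mono less_imp_le[OF ab(3)])
    also have "\<dots> = ennreal (2 * t (a N) + 2 * t (b N))" unfolding par rhs ..
    finally have "4 * g + e \<le> 2 * t (a N) + 2 * t (b N)"
      using t(2)[of "a N"] t(2)[of "b N"] by (subst (asm) ennreal_le_iff) auto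
    moreover have "?\<tau> * enn2real (choquard_energy \<alpha> p (y N)) powr (1 / p) \<le> g"
      using tau_rad_le[OF ym yH yr, of N] g by simp
    ultimately show ?thesis by linarith
  qed
  have "(\<lambda>N. 2 * t (a N) + 2 * t (b N) - 4 * (?\<tau> * enn2real (choquard_energy \<alpha> p (y N)) powr (1 / p)))
    \<longlonglongrightarrow> 2 * ?\<tau> + 2 * ?\<tau> - 4 * (?\<tau> * 1 powr (1 / p))"
    by (intro tendsto_intros D filterlim_compose[OF t(3) fa] filterlim_compose[OF t(3) fb])
  then have "e \<le> 2 * ?\<tau> + 2 * ?\<tau> - 4 * (?\<tau> * 1 powr (1 / p))"
    by (rule LIMSEQ_le_const) (use key in blast)
  then show False using e by simp
qed

text \<open>The limit lies in the space because the sequence is Cauchy in norm, is nonzero because its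
  energy is \<open>1\<close>, and has squared norm at most \<open>\<tau>\<close> by Fatou.\<close>
lemma tau_rad_attained:
  "\<exists>u \<in> HsA_rad_nonzero s m A. choquard_quotient s m \<alpha> p A u = tau_rad s m \<alpha> p A"
proof -
  let ?\<tau> = "tau_rad s m \<alpha> p A"
  obtain u :: "nat \<Rightarrow> R3 \<Rightarrow> complex" and t :: "nat \<Rightarrow> real"
  where u: "\<And>n. u n \<in> borel_measurable borel" "\<And>n. u n \<in> HsA s m A" "\<And>n. radially_symmetric (u n)"
    and u1: "\<And>n. choquard_energy \<alpha> p (u n) = 1" and t: "\<And>n. mag_form (u n) = ennreal (t n)" "\<And>n. 0 \<le> t n"
    and t_less: "\<And>n. t n < ?\<tau> + inverse (real (Suc n))"
    by (rule minimizing_sequence) (rule that)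
  have t_ge: "?\<tau> \<le> t n" for n
    using tau_rad_le[OF u(1,2,3), of n] u1[of n] t by simp
  have "(\<lambda>n. ?\<tau> + inverse (real (Suc n))) \<longlonglongrightarrow> ?\<tau> + 0"
    by (intro tendsto_intros LIMSEQ_inverse_real_of_nat)
  then have up: "(\<lambda>n. ?\<tau> + inverse (real (Suc n))) \<longlonglongrightarrow> ?\<tau>" by (simp only: add_0_right)
  have tlim: "t \<longlonglongrightarrow> ?\<tau>"
  proof (rule tendsto_sandwich[OF _ _ tendsto_const up])
    show "\<forall>\<^sub>F n in sequentially. ?\<tau> \<le> t n" by (rule always_eventually) (intro allI t_ge)
    show "\<forall>\<^sub>F n in sequentially. t n \<le> ?\<tau> + inverse (real (Suc n))"
      by (rule always_eventually) (intro allI less_imp_le[OF t_less])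
  qed
  have B: "mag_form (u n) \<le> ennreal (?\<tau> + 1)" for n
  proof -
    have "inverse (real (Suc n)) \<le> 1" by (simp add: field_simps)
    then show ?thesis unfolding t(1) using t_less[of n] by (intro ennreal_leI) linarith
  qed
  have B0: "0 \<le> ?\<tau> + 1" using tau_rad_nonneg[of \<alpha> p] by simp
  obtain r :: "nat \<Rightarrow> nat" and w :: "R3 \<Rightarrow> complex" and h :: "R3 \<Rightarrow> real"
  where r: "strict_mono r" and w: "w \<in> borel_measurable borel" and h: "h \<in> borel_measurable borel" "\<And>x. 0 \<le> h x"
    and lim: "AE x in lborel. (\<lambda>n. u (r n) x) \<longlonglongrightarrow> w x"
    and dom: "AE x in lborel. \<forall>n. cmod (u (r n) x) \<le> h x"
    and hD: "choquard_energy \<alpha> p (\<lambda>x. complex_of_real (h x)) < \<infinity>"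
    by (rule bounded_radial_subsequence[OF \<alpha> p u(1) u(3) B0 B]) (rule that)
  have "(\<lambda>n. choquard_energy \<alpha> p (u (r n))) \<longlonglongrightarrow> choquard_energy \<alpha> p w"
    by (rule choquard_energy_dominated[OF u(1) w h p_pos lim dom hD])
  then have w1: "choquard_energy \<alpha> p w = 1" by (simp add: u1 LIMSEQ_const_iff)
  have trlim: "(\<lambda>n. t (r n)) \<longlonglongrightarrow> ?\<tau>"
    using LIMSEQ_subseq_LIMSEQ[OF tlim r] by (simp add: o_def)
  have cauchy: "\<exists>N. \<forall>n\<ge>N. \<forall>k\<ge>N. mag_form (\<lambda>x. u (r n) x - u (r k) x) \<le> ennreal e" if e: "0 < e" for e
    by (rule minimizing_sequence_Cauchy[of "\<lambda>n. u (r n)", OF u(1) u(2) u(3) t(1) t(2) trlim w w1 h hD lim dom e])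
  have wH: "w \<in> HsA s m A"
  proof (rule HsA_closed[OF w])
    fix e :: real assume e: "0 < e"
    then obtain N where N: "\<And>n k. N \<le> n \<Longrightarrow> N \<le> k \<Longrightarrow> mag_form (\<lambda>x. u (r n) x - u (r k) x) \<le> ennreal (e / 2)"
      using cauchy[of "e / 2"] by auto
    have "mag_form (\<lambda>x. w x - u (r N) x) \<le> ennreal (e / 2)"
    proof (rule mag_form_liminf[where u = "\<lambda>n x. u (r (n + N)) x - u (r N) x"])
      show "(\<lambda>x. u (r (n + N)) x - u (r N) x) \<in> borel_measurable borel" for n using u(1) by simp
      show "(\<lambda>x. w x - u (r N) x) \<in> borel_measurable borel" using u(1) w by simp
      show "AE x in lborel. (\<lambda>n. u (r (n + N)) x - u (r N) x) \<longlonglongrightarrow> w x - u (r N) x"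
        using lim
      proof eventually_elim
        fix x assume "(\<lambda>n. u (r n) x) \<longlonglongrightarrow> w x"
        then have "(\<lambda>n. u (r (n + N)) x) \<longlonglongrightarrow> w x" by (rule LIMSEQ_ignore_initial_segment)
        then show "(\<lambda>n. u (r (n + N)) x - u (r N) x) \<longlonglongrightarrow> w x - u (r N) x" by (intro tendsto_intros)
      qed
      show "mag_form (\<lambda>x. u (r (n + N)) x - u (r N) x) \<le> ennreal (e / 2)" for n by (rule N) auto
    qed
    also have "\<dots> < ennreal e" using e by (intro ennreal_lessI) auto
    finally show "\<exists>u. u \<in> borel_measurable borel \<and> u \<in> HsA s m A \<and> mag_form (\<lambda>x. w x - u x) < ennreal e"
      using u(1,2) by blast
  qed
  have wr: "radially_symmetric w" using u(3) lim by (rule radially_symmetric_limit)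
  have wnz: "\<not> (AE x in lborel. w x = 0)"
  proof
    assume "AE x in lborel. w x = 0"
    then have "choquard_energy \<alpha> p w = 0"
      using choquard_energy_cong_AE[of w "\<lambda>x. 0" \<alpha> p] by (simp add: choquard_energy_zero)
    then show False using w1 by simp
  qed
  have wS: "w \<in> HsA_rad_nonzero s m A" by (rule HsA_rad_nonzeroI[OF wH wr wnz])
  have Q: "choquard_quotient s m \<alpha> p A w = enn2real (mag_form w)"
    by (simp add: choquard_quotient_eq[OF wH] w1)
  have "enn2real (mag_form w) \<le> ?\<tau> + e" if e: "0 < e" for e
  proof -
    have "eventually (\<lambda>n. t (r n) < ?\<tau> + e) sequentially"
      using trlim e by (intro order_tendstoD(2)[OF trlim]) simp
    then obtain N where N: "\<And>n. N \<le> n \<Longrightarrow> t (r n) < ?\<tau> + e" by (auto simp: eventually_sequentially)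
    have "mag_form w \<le> ennreal (?\<tau> + e)"
    proof (rule mag_form_liminf[where u = "\<lambda>n. u (r (n + N))"])
      show "AE x in lborel. (\<lambda>n. u (r (n + N)) x) \<longlonglongrightarrow> w x"
        using lim by eventually_elim (rule LIMSEQ_ignore_initial_segment)
      show "mag_form (u (r (n + N))) \<le> ennreal (?\<tau> + e)" for n
        unfolding t(1) using N[of "n + N"] by (intro ennreal_leI) simp
    qed (use u(1) w in auto)
    then have "enn2real (mag_form w) \<le> enn2real (ennreal (?\<tau> + e))" by (rule enn2real_mono) simp
    also have "\<dots> = ?\<tau> + e" using tau_rad_nonneg[of \<alpha> p] e by (intro enn2real_ennreal) simp
    finally show ?thesis .
  qed
  then have "enn2real (mag_form w) \<le> ?\<tau>" by (rule field_le_epsilon)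
  moreover have "?\<tau> \<le> choquard_quotient s m \<alpha> p A w"
    unfolding tau_rad_def by (rule cINF_lower[OF bdd_below_quotients wS])
  ultimately show ?thesis using wS Q by (intro bexI[of _ w]) auto
qed

end

end

theorem theorem5p6:
  fixes s m \<alpha> p :: real and A :: "real ^ 3 \<Rightarrow> real ^ 3"
  assumes "0 < s" and "s < 1"
    and "0 < m"
    and "0 < \<alpha>" and "\<alpha> < 3"
    and "1 + \<alpha> / 3 < p" and "p < (3 + \<alpha>) / (3 - 2 * s)"
    and "continuous_on UNIV A"
    and "locally_bounded_gradient A"
    and "O3_compatible A"
  shows "\<exists>u \<in> HsA_rad_nonzero s m A. choquard_quotient s m \<alpha> p A u = tau_rad s m \<alpha> p A"
proof -
  interpret magnetic_form s m A by unfold_locales fact+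
  show ?thesis by (rule tau_rad_attained) fact+
qed

end
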